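(* Let $d\ge 2$, $q\in\{1,\ldots,d-1\}$, $\gamma\in\{0,\ldots,q-1\}$, $u>0$ and $K<0$. Let $\mathbf{L}$ be a random element of $G_K(d,q)$ with distribution $\nu_{q,K}$ and let $\mathbf{E}$ be a random element of $A_K(d,d-q+\gamma)$, independent of $\mathbf{L}$, whose distribution is the restriction of $C_K(d,d-q+\gamma,u)^{-1}\mu_{d-q+\gamma,K}$ to $[uB_K^d]_{d-q+\gamma,K}$. Then: (i) For $\alpha\in\mathbb{R}$, $\mathbb{E}[d_K(o,\mathbf{E}\cap\mathbf{L})^\alpha]<\infty$ if and only if $\alpha\in(\gamma-q,0]$. (ii) $\mathbb{E}[d_K(o,\mathbf{E}\cap\mathbf{L})^\alpha\mid d_K(o,\mathbf{E}\cap\mathbf{L})<\infty]<\infty$ for every $\alpha>0$.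
   Context: For $K<0$, $\mathbb{M}_K^d$ is the $d$-dimensional simply connected complete space of constant sectional curvature $K$ (hyperbolic space), with Riemannian distance $d_K$ and a fixed point $o$ (the origin). For $F\subset\mathbb{M}_K^d$, $d_K(o,F):=\inf\{d_K(o,x):x\in F\}$, with $\inf\varnothing=+\infty$; thus $d_K(o,\mathbf{E}\cap\mathbf{L})$ takes values in $[0,+\infty]$. Conventions: $(+\infty)^\alpha=+\infty$ for $\alpha>0$, $(+\infty)^\alpha=0$ for $\alpha<0$, and $(+\infty)^0=1$. $uB_K^d:=\{x\in\mathbb{M}_K^d: d_K(x,o)\le u\}$. For a dimension $k$, a $k$-flat is a $k$-dimensional totally geodesic submanifold of $\mathbb{M}_K^d$ (complete, i.e. in the Beltrami-Klein model a non-empty intersection of a $k$-dimensional affine subspace of $\mathbb{R}^d$ with the open Euclidean ball of radius $1/\sqrt{-K}$). $A_K(d,k)$ is the space of all $k$-flats, $G_K(d,k)$ the space of all $k$-flats passing through $o$. $\nu_{k,K}$ is the unique Borel probability measure on $G_K(d,k)$ invariant under all isometries of $\mathbb{M}_K^d$ fixing $o$. $\mu_{k,K}$ is the isometry-invariant measure on $A_K(d,k)$ normalized as $$\mu_{k,K}(\cdot)=\int_{G_K(d,d-k)}\int_L\mathbf{1}\{E(L,x)\in\cdot\}\cosh^k(\sqrt{-K}\,d_K(x,o))\,\mathcal{H}_K^{d-k}(\mathrm{d}x)\,\nu_{d-k,K}(\mathrm{d}L),$$ where $E(L,x)$ is the unique $k$-flat passing through $x$ orthogonally to $L$ and $\mathcal{H}_K^{d-k}$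 is the $(d-k)$-dimensional Hausdorff measure with respect to $d_K$. $[uB_K^d]_{k,K}:=\{E\in A_K(d,k):E\cap uB_K^d\neq\varnothing\}$. For $n\in\mathbb{N}$, $\omega_n:=2\pi^{n/2}/\Gamma(n/2)$. Moreover $$C_K(d,k,u):=\mu_{k,K}([uB_K^d]_{k,K})=\omega_{d-k}(\sqrt{-K})^{-d+k+1}\int_0^u\cosh^k(\sqrt{-K}r)\sinh^{d-k-1}(\sqrt{-K}r)\,\mathrm{d}r.$$ *)

theory Defs
  imports "HOL-Probability.Probability"
begin

section \<open>Hyperbolic space of curvature \<open>K < 0\<close>, in the Beltrami-Klein model\<close>

text \<open>
  The dimension is \<open>DIM('a)\<close> and the origin is \<open>0\<close>. All notions below are meant for \<open>K < 0\<close>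
  and for points of \<open>hyp_space K\<close> only.
\<close>

definition hyp_space :: "real \<Rightarrow> 'a::euclidean_space set" where
  "hyp_space K = ball 0 (1 / sqrt (- K))"

definition hyp_dist :: "real \<Rightarrow> 'a::euclidean_space \<Rightarrow> 'a \<Rightarrow> real" where
  "hyp_dist K x y =
     arcosh ((1 + K * (x \<bullet> y)) / sqrt ((1 + K * (x \<bullet> x)) * (1 + K * (y \<bullet> y)))) / sqrt (- K)"

text \<open>The Riemannian metric of the model at \<open>x\<close>, evaluated at the tangent vectors \<open>v\<close> and \<open>w\<close>.\<close>

definition hyp_inner :: "real \<Rightarrow> 'a::euclidean_space \<Rightarrow> 'a \<Rightarrow> 'a \<Rightarrow> real" where
  "hyp_inner K x v w =
     (v \<bullet> w) / (1 + K * (x \<bullet> x)) - K * (x \<bullet> v) * (x \<bullet> w) / (1 + K * (x \<bullet> x))\<^sup>2"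

definition origin_isometry :: "real \<Rightarrow> ('a::euclidean_space \<Rightarrow> 'a) \<Rightarrow> bool" where
  "origin_isometry K \<phi> \<longleftrightarrow>
     bij_betw \<phi> (hyp_space K) (hyp_space K) \<and>
     (\<forall>x\<in>hyp_space K. \<forall>y\<in>hyp_space K. hyp_dist K (\<phi> x) (\<phi> y) = hyp_dist K x y) \<and>
     \<phi> 0 = 0"

definition hyp_cball :: "real \<Rightarrow> real \<Rightarrow> 'a::euclidean_space set" where
  "hyp_cball K u = {x \<in> hyp_space K. hyp_dist K x 0 \<le> u}"

text \<open>The distance of a set from the origin; the infimum of the empty set is \<open>\<infinity>\<close>.\<close>

definition origin_dist :: "real \<Rightarrow> 'a::euclidean_space set \<Rightarrow> ennreal" where
  "origin_dist K F = (INF x\<in>F. ennreal (hyp_dist K 0 x))"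

text \<open>
  Real powers on \<open>[0, \<infinity>]\<close>. In contrast to \<open>powr\<close>, which has \<open>0 powr a = 0\<close> for all \<open>a\<close>,
  a negative power of \<open>0\<close> is \<open>\<infinity>\<close> here.
\<close>

definition ennreal_powr :: "ennreal \<Rightarrow> real \<Rightarrow> ennreal" where
  "ennreal_powr t a =
     (if a = 0 then 1
      else if t = 0 then (if a > 0 then 0 else \<infinity>)
      else if t = \<infinity> then (if a > 0 then \<infinity> else 0)
      else ennreal (enn2real t powr a))"


section \<open>Spaces of flats\<close>

definition flats :: "real \<Rightarrow> nat \<Rightarrow> 'a::euclidean_space set set" where
  "flats K k =
     {A \<inter> hyp_space K | A. affine A \<and> aff_dim A = int k \<and> A \<inter> hyp_space K \<noteq> {}}"

definition origin_flats :: "real \<Rightarrow> nat \<Rightarrow> 'a::euclidean_space set set" where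
  "origin_flats K k = {E \<in> flats K k. 0 \<in> E}"

definition flats_hitting_ball :: "real \<Rightarrow> nat \<Rightarrow> real \<Rightarrow> 'a::euclidean_space set set" where
  "flats_hitting_ball K k u = {E \<in> flats K k. E \<inter> hyp_cball K u \<noteq> {}}"

text \<open>
  Spaces of flats carry the subspace topology of the Fell topology on the closed subsets of
  hyperbolic space. The distance \<open>hyp_dist K\<close> induces the Euclidean topology on \<open>hyp_space K\<close>.
\<close>

definition fell_topology :: "real \<Rightarrow> 'a::euclidean_space set topology" where
  "fell_topology K = topology_generated_by
     ({{F. closedin (top_of_set (hyp_space K)) F \<and> F \<inter> C = {}} | C.
         compact C \<and> C \<subseteq> hyp_space K} \<union>
      {{F. closedin (top_of_set (hyp_space K)) F \<and> F \<inter> U \<noteq> {}} | U.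
         open U \<and> U \<subseteq> hyp_space K})"

definition fell_borel ::
    "real \<Rightarrow> 'a::euclidean_space set set \<Rightarrow> 'a set measure" where
  "fell_borel K \<F> = sigma \<F> {W. openin (subtopology (fell_topology K) \<F>) W}"


section \<open>Hausdorff measure\<close>

definition hyp_diam :: "real \<Rightarrow> 'a::euclidean_space set \<Rightarrow> ennreal" where
  "hyp_diam K U = (SUP x\<in>U. SUP y\<in>U. ennreal (hyp_dist K x y))"

text \<open>
  The factor \<open>unit_ball_vol n / 2 ^ n\<close> makes the \<open>n\<close>-dimensional Hausdorff measure agree with
  the Riemannian volume on \<open>n\<close>-flats. The empty set is treated separately because of
  \<open>0 ^ 0 = 1\<close>.
\<close>

definition hausdorff_outer :: "real \<Rightarrow> nat \<Rightarrow> 'a::euclidean_space set \<Rightarrow> ennreal" where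
  "hausdorff_outer K n A =
     (SUP \<delta>\<in>{0<..}. INF C\<in>{C :: nat \<Rightarrow> 'a set. A \<subseteq> (\<Union>i. C i) \<and>
                                (\<forall>i. C i \<subseteq> hyp_space K \<and> hyp_diam K (C i) \<le> \<delta>)}.
        \<Sum>i. if C i = {} then 0
             else ennreal (unit_ball_vol (real n) / 2 ^ n) * hyp_diam K (C i) ^ n)"

definition hausdorff_on ::
    "real \<Rightarrow> nat \<Rightarrow> 'a::euclidean_space set \<Rightarrow> 'a measure" where
  "hausdorff_on K n L =
     measure_of L (sets (restrict_space borel L)) (hausdorff_outer K n)"


section \<open>Invariant measures on spaces of flats\<close>

text \<open>
  The rotation invariant Borel probability measure on \<open>origin_flats K k\<close> is unique for
  \<open>k \<le> DIM('a)\<close>, so that this predicate determines it.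
\<close>

definition invariant_origin_flat_prob ::
    "real \<Rightarrow> nat \<Rightarrow> 'a::euclidean_space set measure \<Rightarrow> bool" where
  "invariant_origin_flat_prob K k \<nu> \<longleftrightarrow>
     prob_space \<nu> \<and>
     space \<nu> = origin_flats K k \<and>
     sets \<nu> = sets (fell_borel K (origin_flats K k)) \<and>
     (\<forall>\<phi>. origin_isometry K \<phi> \<longrightarrow> distr \<nu> \<nu> (\<lambda>L. \<phi> ` L) = \<nu>)"

text \<open>
  The \<open>k\<close>-flat through \<open>x\<close> orthogonal to \<open>L\<close>. In the Klein model, geodesics are straight line
  segments, so that the tangent directions at \<open>x\<close> of a flat \<open>E\<close> containing \<open>x\<close> are spanned by
  the vectors \<open>y - x\<close> for \<open>y \<in> E\<close>.
\<close>

definition orthogonal_flat ::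
    "real \<Rightarrow> nat \<Rightarrow> 'a::euclidean_space set \<Rightarrow> 'a \<Rightarrow> 'a set" where
  "orthogonal_flat K k L x =
     (THE E. E \<in> flats K k \<and> x \<in> E \<and>
        (\<forall>y\<in>E. \<forall>z\<in>L. hyp_inner K x (y - x) (z - x) = 0))"

text \<open>
  The invariant measure on the space of \<open>k\<close>-flats; \<open>\<nu>\<close> is the invariant probability measure
  on the flats of dimension \<open>DIM('a) - k\<close> through the origin.
\<close>

definition flat_measure ::
    "real \<Rightarrow> nat \<Rightarrow> 'a::euclidean_space set measure \<Rightarrow> 'a set measure" where
  "flat_measure K k \<nu> =
     measure_of (flats K k) (sets (fell_borel K (flats K k)))
       (\<lambda>X. \<integral>\<^sup>+L. (\<integral>\<^sup>+x. indicator X (orthogonal_flat K k L x)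
                          * ennreal (cosh (sqrt (- K) * hyp_dist K x 0) ^ k)
                     \<partial>hausdorff_on K (DIM('a) - k) L) \<partial>\<nu>)"

text \<open>
  The normalised restriction of \<^term>\<open>flat_measure K k \<nu>\<close> to the flats hitting the ball of
  radius \<open>u\<close>; the normalising constant is the total mass of this restriction.
\<close>

definition hitting_flat_distribution ::
    "real \<Rightarrow> nat \<Rightarrow> real \<Rightarrow> 'a::euclidean_space set measure \<Rightarrow> 'a set measure" where
  "hitting_flat_distribution K k u \<nu> =
     uniform_measure (flat_measure K k \<nu>) (flats_hitting_ball K k u)"

end

theory Submission
  imports Defs "HOL-Real_Asymp.Real_Asymp"
begin

text \<open>
  Put \<open>m = q - \<gamma>\<close> and let \<open>\<rho> = 1 / sqrt (- K)\<close> be the radius of the Klein ball. If \<open>W\<close> is the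
  linear span of a flat through the origin and \<open>x \<in> W\<close>, then the flat orthogonal to \<open>W\<close> at \<open>x\<close>
  consists of all points of the ball whose Euclidean orthogonal projection to \<open>W\<close> is \<open>x\<close>
  (\<open>orthogonal_flat_eq\<close>). So \<open>x\<close> is the point of this flat \<open>E\<close> nearest to the origin, and
  \<open>E \<inter> L\<close> consists of the points of \<open>L\<close> that project to \<open>x\<close>. The distance \<open>R\<close> of \<open>E \<inter> L\<close> from
  the origin is then governed by four facts about the joint law of \<open>(E, L)\<close>.

  \<^item> \<open>R\<close> is at least the distance of \<open>E\<close> from the origin, so that \<open>P(R \<le> r) = O(r\<^sup>m)\<close>
    (\<open>joint_small_le\<close>); hence \<open>R\<close> has finite moments of all orders in \<open>(- m, 0)\<close>.
  \<^item> Conversely, if \<open>E\<close> passes near the origin, then, with a positive probability that does not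
    depend on \<open>E\<close>, the flat \<open>L\<close> is so transversal to \<open>E\<close> that \<open>R\<close> is at most a constant multiple of that distance; so \<open>P(R \<le> r)\<close> is also at
    least a multiple of \<open>r\<^sup>m\<close> (\<open>joint_small_ge\<close>), and the moments of order at most \<open>- m\<close> are
    infinite.
  \<^item> \<open>E\<close> and \<open>L\<close> are disjoint with positive probability (\<open>joint_disjoint_pos\<close>), because \<open>L\<close> may
    be close to the hyperplane orthogonal to \<open>x\<close>; so all positive moments are infinite.
  \<^item> If \<open>E\<close> meets \<open>L\<close> only far away, then the Euclidean distance of \<open>E \<inter> L\<close> from the origin lies
    in a thin shell \<open>[(1 - \<epsilon>) \<rho>, \<rho>)\<close>. This distance is positively homogeneous in \<open>x\<close>, and about
    \<open>1 / \<epsilon>\<close> rescaled copies of the set of these \<open>x\<close> are disjoint, so that the shell has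
    probability \<open>O(\<epsilon>)\<close> (\<open>joint_far_le\<close>). The hyperbolic distance is only logarithmic in
    \<open>1 / \<epsilon>\<close>, and all conditional positive moments are finite.

  The Hausdorff measure enters through its scaling behaviour. On a smaller concentric ball the hyperbolic
  and the Euclidean distance are bi-Lipschitz equivalent, so that a dilation by \<open>l\<close> multiplies the
  \<open>m\<close>-dimensional Hausdorff measure by \<open>l\<^sup>m\<close> up to a constant factor
  (\<open>emeasure_hausdorff_on_scaleR\<close>). All estimates compare the measure of a set of flats with the
  measure of the flats that hit the ball of radius \<open>u\<close>; that the latter measure is
  neither \<open>0\<close> nor \<open>\<infinity>\<close> is part of the assumption that its normalisation is the law of \<open>E\<close>.

  For the random flat \<open>L\<close>, rotation invariance shows that an event has positive probability as
  soon as every flat has a rotated copy all of whose nearby rotated copies belong to the event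
  (\<open>invariant_origin_flat_prob_positive\<close>).
\<close>

section \<open>The hyperbolic metric in the Klein model\<close>

lemma sinh_le_mult_cosh:
  fixes t :: real assumes "t \<ge> 0" shows "sinh t \<le> t * cosh t"
proof -
  have "(\<lambda>x. x * cosh x - sinh x) 0 \<le> (\<lambda>x. x * cosh x - sinh x) t"
  proof (rule DERIV_nonneg_imp_nondecreasing[OF assms])
    fix x :: real assume "0 \<le> x" "x \<le> t"
    moreover have "((\<lambda>x. x * cosh x - sinh x) has_real_derivative (x * sinh x)) (at x)"
      by (auto intro!: derivative_eq_intros)
    ultimately show "\<exists>y. ((\<lambda>x. x * cosh x - sinh x) has_real_derivative y) (at x) \<and> 0 \<le> y"
      by (intro exI[of _ "x * sinh x"]) auto
  qed
  then show ?thesis by simp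
qed

lemma le_sinh:
  fixes t :: real assumes "t \<ge> 0" shows "t \<le> sinh t"
  using real_le_x_sinh[OF assms] by (simp add: sinh_def exp_minus)

lemma mem_hyp_space_iff: "K < 0 \<Longrightarrow> x \<in> hyp_space K \<longleftrightarrow> 0 < 1 + K * (x \<bullet> x)"
proof -
  assume K: "K < 0"
  have "norm x < 1 / sqrt (- K) \<longleftrightarrow> sqrt (- K) * norm x < 1"
    using K by (simp add: field_simps)
  also have "\<dots> \<longleftrightarrow> (sqrt (- K) * norm x)\<^sup>2 < 1\<^sup>2"
    using K by (simp only: abs_square_less_1 one_power2) simp
  also have "\<dots> \<longleftrightarrow> 0 < 1 + K * (x \<bullet> x)"
    using K by (auto simp: power_mult_distrib power2_norm_eq_inner)
  finally show ?thesis by (simp add: hyp_space_def)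
qed

lemma cball_subset_hyp_space_if:
  assumes K: "K < 0" and b: "0 < 1 + K * b\<^sup>2"
  shows "cball 0 b \<subseteq> (hyp_space K :: 'a::euclidean_space set)"
proof
  fix x :: 'a assume "x \<in> cball 0 b"
  then have "K * b\<^sup>2 \<le> K * (x \<bullet> x)"
    using K by (intro mult_left_mono_neg) (auto simp flip: power2_norm_eq_inner intro: power_mono)
  then show "x \<in> hyp_space K" using b by (simp add: mem_hyp_space_iff[OF K])
qed

text \<open>Writing \<open>t\<close> for \<open>sqrt (- K)\<close> times the distance, \<open>sinh\<^sup>2 t = cosh\<^sup>2 t - 1\<close> is a quotient whose numerator
  \<open>N\<close> is \<open>- K \<bar>x - y\<bar>\<^sup>2\<close> minus \<open>K\<^sup>2\<close> times a Gram determinant; the Cauchy-Schwarz inequality shows that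
  \<open>N\<close> is comparable to \<open>\<bar>x - y\<bar>\<^sup>2\<close>. Finally \<open>t \<le> sinh t \<le> t cosh t\<close>, where \<open>cosh t\<close> is bounded.\<close>

lemma hyp_dist_bilipschitz:
  fixes x y :: "'a::euclidean_space"
  assumes K: "K < 0" and b: "0 < 1 + K * b\<^sup>2" and x: "norm x \<le> b" and y: "norm y \<le> b"
  shows "hyp_dist K x y \<le> norm (x - y) / (1 + K * b\<^sup>2)"
    and "norm (x - y) \<le> 2 / (1 + K * b\<^sup>2)\<^sup>2 * hyp_dist K x y"
proof -
  define c where "c = 1 + K * b\<^sup>2"
  define X where "X = 1 + K * (x \<bullet> x)"
  define Y where "Y = 1 + K * (y \<bullet> y)"
  define P where "P = 1 + K * (x \<bullet> y)"
  define t where "t = arcosh (P / sqrt (X * Y))"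
  have c: "0 < c" "c \<le> 1" using b K by (auto simp: c_def mult_le_0_iff)
  have xx: "x \<bullet> x \<le> b\<^sup>2" "y \<bullet> y \<le> b\<^sup>2" "0 \<le> x \<bullet> x" "0 \<le> y \<bullet> y"
    using x y by (auto simp flip: power2_norm_eq_inner intro: power_mono)
  have X: "c \<le> X" "X \<le> 1" and Y: "c \<le> Y" "Y \<le> 1"
    using xx K by (auto simp: c_def X_def Y_def mult_le_0_iff)
  have xy: "\<bar>x \<bullet> y\<bar> \<le> b\<^sup>2"
  proof -
    have "\<bar>x \<bullet> y\<bar> \<le> norm x * norm y" by (rule Cauchy_Schwarz_ineq2)
    also have "\<dots> \<le> b * b" using x y by (intro mult_mono) (auto intro: order_trans[OF norm_ge_zero])
    finally show ?thesis by (simp add: power2_eq_square)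
  qed
  have XY: "c\<^sup>2 \<le> X * Y" "X * Y \<le> 1"
    using X Y c by (auto simp: power2_eq_square intro!: mult_mono mult_le_one)
  have P: "c \<le> P" "P \<le> 2"
  proof -
    have "K * b\<^sup>2 \<le> K * (x \<bullet> y)" using xy K by (intro mult_left_mono_neg) auto
    then show "c \<le> P" by (simp add: c_def P_def)
    have "K * (x \<bullet> y) \<le> K * (- b\<^sup>2)" using xy K by (intro mult_left_mono_neg) auto
    then show "P \<le> 2" using c by (simp add: c_def P_def)
  qed
  define N where "N = P\<^sup>2 - X * Y"
  have N: "N = - K * (norm (x - y))\<^sup>2 - K\<^sup>2 * ((x \<bullet> x) * (norm (y - x))\<^sup>2 - (x \<bullet> (y - x))\<^sup>2)"
    unfolding N_def P_def X_def Y_def power2_norm_eq_inner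
    by (simp add: inner_diff_left inner_diff_right inner_commute algebra_simps power2_eq_square)
  have CS: "(x \<bullet> (y - x))\<^sup>2 \<le> (x \<bullet> x) * (norm (y - x))\<^sup>2"
    using Cauchy_Schwarz_ineq[of x "y - x"] by (simp add: power2_norm_eq_inner)
  have N1: "N \<le> - K * (norm (x - y))\<^sup>2"
    unfolding N using CS by (simp add: mult_nonneg_nonneg)
  have N2: "- K * c * (norm (x - y))\<^sup>2 \<le> N"
  proof -
    have "K\<^sup>2 * ((x \<bullet> x) * (norm (y - x))\<^sup>2 - (x \<bullet> (y - x))\<^sup>2) \<le> K\<^sup>2 * (b\<^sup>2 * (norm (x - y))\<^sup>2)"
    proof (rule mult_left_mono)
      have "(x \<bullet> x) * (norm (y - x))\<^sup>2 \<le> b\<^sup>2 * (norm (y - x))\<^sup>2"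
        using xx by (intro mult_right_mono) auto
      then show "(x \<bullet> x) * (norm (y - x))\<^sup>2 - (x \<bullet> (y - x))\<^sup>2 \<le> b\<^sup>2 * (norm (x - y))\<^sup>2"
        using zero_le_power2[of "x \<bullet> (y - x)"] unfolding norm_minus_commute[of y x] by linarith
    qed simp
    then show ?thesis unfolding N c_def by (simp add: algebra_simps power2_eq_square)
  qed
  have N0: "0 \<le> N" using N2 K c
    by (metis (no_types, opaque_lifting) dual_order.trans less_eq_real_def mult_nonneg_nonneg neg_0_le_iff_le zero_le_power2)
  have XYp: "0 < X * Y" using XY c by (metis less_le_trans zero_less_power)
  have s1: "1 \<le> P / sqrt (X * Y)"
    using N0 P c XYp by (simp add: N_def real_le_rsqrt real_le_lsqrt)
  have t0: "0 \<le> t" and ct: "cosh t = P / sqrt (X * Y)"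
    using s1 by (auto simp: t_def)
  have st: "(sinh t)\<^sup>2 = N / (X * Y)"
  proof -
    have "X * Y \<noteq> 0" using XYp by linarith
    then show ?thesis
      using cosh_square_eq[of t] XYp unfolding ct N_def
      by (simp add: power_divide diff_divide_distrib del: mult_eq_0_iff)
  qed
  have td: "hyp_dist K x y = t / sqrt (- K)"
    by (simp add: hyp_dist_def t_def P_def X_def Y_def)
  have "(sinh t)\<^sup>2 \<le> (- K * (norm (x - y))\<^sup>2) / c\<^sup>2"
    unfolding st using N1 N0 XY c by (intro frac_le) auto
  also have "\<dots> = (sqrt (- K) * norm (x - y) / c)\<^sup>2"
    using K by (simp add: power_mult_distrib power_divide)
  finally have "sinh t \<le> sqrt (- K) * norm (x - y) / c"
    by (rule power2_le_imp_le) (use c K in simp)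
  then have "t \<le> sqrt (- K) * norm (x - y) / c" using le_sinh[OF t0] by linarith
  then show "hyp_dist K x y \<le> norm (x - y) / (1 + K * b\<^sup>2)"
    unfolding td c_def[symmetric] using K c by (simp add: field_simps)
  have "(sqrt (- K) * c * norm (x - y))\<^sup>2 = - K * c\<^sup>2 * (norm (x - y))\<^sup>2"
    using K by (simp add: power_mult_distrib)
  also have "\<dots> \<le> - K * c * (norm (x - y))\<^sup>2"
    using K c by (intro mult_right_mono mult_left_mono) (auto simp: power2_eq_square mult_le_cancel_left1)
  also have "\<dots> \<le> N" by (rule N2)
  also have "\<dots> \<le> (sinh t)\<^sup>2"
    unfolding st using XYp XY N0 by (simp add: field_simps mult_left_le)
  finally have "sqrt (- K) * c * norm (x - y) \<le> sinh t"
    by (rule power2_le_imp_le) (use t0 in auto)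
  also have "\<dots> \<le> t * cosh t" by (rule sinh_le_mult_cosh[OF t0])
  also have "\<dots> \<le> t * (2 / c)"
  proof (intro mult_left_mono)
    have "c \<le> sqrt (X * Y)" using XY c by (intro real_le_rsqrt) auto
    then show "cosh t \<le> 2 / c" unfolding ct using P c by (intro frac_le) auto
  qed (rule t0)
  finally have "sqrt (- K) * c * norm (x - y) \<le> t * (2 / c)" .
  then show "norm (x - y) \<le> 2 / (1 + K * b\<^sup>2)\<^sup>2 * hyp_dist K x y"
    unfolding td c_def[symmetric] using K c by (simp add: field_simps power2_eq_square)
qed

lemma hyp_dist_0:
  assumes K: "K < 0" and x: "x \<in> hyp_space K"
  shows "hyp_dist K 0 x = artanh (sqrt (- K) * norm x) / sqrt (- K)"
    and "hyp_dist K x 0 = artanh (sqrt (- K) * norm x) / sqrt (- K)"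
proof -
  define t where "t = sqrt (- K) * norm x"
  have t: "0 \<le> t" "t\<^sup>2 = - K * (x \<bullet> x)" using K by (auto simp: t_def power_mult_distrib power2_norm_eq_inner)
  have t1: "t\<^sup>2 < 1" using x K t by (simp add: mem_hyp_space_iff)
  then have t1': "t < 1" using t(1) by (simp add: power2_less_1_iff abs_if)
  define s where "s = 1 / sqrt (1 - t\<^sup>2)"
  have s: "1 \<le> s" using t1 zero_le_power2[of t] unfolding s_def by (simp del: zero_le_power2 add: t(2)[symmetric])
  have "s\<^sup>2 - 1 = (t / sqrt (1 - t\<^sup>2))\<^sup>2" using t1 by (simp add: s_def power_divide field_simps)
  then have "sqrt (s\<^sup>2 - 1) = t / sqrt (1 - t\<^sup>2)" using t t1 by (simp add: real_sqrt_divide)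
  then have "arcosh s = ln ((1 + t) / sqrt (1 - t\<^sup>2))"
    using s by (simp add: arcosh_real_def s_def add_divide_distrib)
  also have "\<dots> = ln (sqrt ((1 + t) / (1 - t)))"
  proof -
    have "1 - t\<^sup>2 = (1 + t) * (1 - t)" by (simp add: algebra_simps power2_eq_square)
    then have "(1 + t) / sqrt (1 - t\<^sup>2) = (sqrt (1 + t) * sqrt (1 + t)) / (sqrt (1 + t) * sqrt (1 - t))"
      using t by (simp only: real_sqrt_mult) simp
    also have "\<dots> = sqrt ((1 + t) / (1 - t))"
      using t t1' by (simp add: real_sqrt_divide del: real_sqrt_mult_self)
    finally have "(1 + t) / sqrt (1 - t\<^sup>2) = sqrt ((1 + t) / (1 - t))" .
    then show ?thesis by simp
  qed
  also have "\<dots> = artanh t" using t t1' by (simp add: ln_sqrt artanh_def)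
  finally have "arcosh s = artanh t" .
  moreover have "1 + K * (x \<bullet> x) = 1 - t\<^sup>2" using t by simp
  ultimately show "hyp_dist K 0 x = artanh (sqrt (- K) * norm x) / sqrt (- K)"
    and "hyp_dist K x 0 = artanh (sqrt (- K) * norm x) / sqrt (- K)"
    by (simp_all add: hyp_dist_def s_def t_def)
qed

lemma artanh_mono_iff:
  fixes s t :: real assumes "0 \<le> s" "s < 1" "0 \<le> t" "t < 1"
  shows "artanh s \<le> artanh t \<longleftrightarrow> s \<le> t"
  using assms by (simp add: artanh_def field_simps)

lemma hyp_dist_0_le_iff:
  assumes K: "K < 0" and x: "x \<in> hyp_space K"
  shows "hyp_dist K x 0 \<le> r \<longleftrightarrow> norm x \<le> tanh (sqrt (- K) * r) / sqrt (- K)"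
proof (cases "r \<ge> 0")
  case True
  have "sqrt (- K) * norm x < 1" using x K by (simp add: hyp_space_def field_simps)
  moreover have "hyp_dist K x 0 \<le> r \<longleftrightarrow> artanh (sqrt (- K) * norm x) \<le> artanh (tanh (sqrt (- K) * r))"
    using K by (simp add: hyp_dist_0[OF K x] artanh_tanh_real field_simps)
  ultimately show ?thesis
    using True K tanh_real_lt_1[of "sqrt (- K) * r"] by (subst (asm) artanh_mono_iff) (auto simp: field_simps)
next
  case False
  have "0 \<le> hyp_dist K x 0"
  proof -
    have "sqrt (- K) * norm x < 1" using x K by (simp add: hyp_space_def field_simps)
    then have "artanh 0 \<le> artanh (sqrt (- K) * norm x)" using K by (subst artanh_mono_iff) auto
    then show ?thesis using K by (simp add: hyp_dist_0[OF K x])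
  qed
  moreover have "tanh (sqrt (- K) * r) / sqrt (- K) < 0"
    using False K by (simp add: divide_less_0_iff mult_less_0_iff)
  ultimately show ?thesis using False norm_ge_zero[of x] by linarith
qed

lemma hyp_cball_eq:
  assumes "K < 0"
  shows "(hyp_cball K r :: 'a::euclidean_space set) = cball 0 (tanh (sqrt (- K) * r) / sqrt (- K))"
proof -
  have "tanh (sqrt (- K) * r) / sqrt (- K) < 1 / sqrt (- K)"
    using assms tanh_real_lt_1 by (simp add: divide_strict_right_mono)
  then show ?thesis
    using assms by (auto simp: hyp_cball_def hyp_dist_0_le_iff) (auto simp: hyp_space_def hyp_dist_0_le_iff)
qed

lemma norm_le_hyp_dist_0:
  assumes K: "K < 0" and x: "x \<in> hyp_space K"
  shows "norm x \<le> hyp_dist K 0 x"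
proof -
  define r where "r = hyp_dist K 0 x"
  have r: "r = hyp_dist K x 0" by (simp add: r_def hyp_dist_0[OF K x])
  have n: "norm x \<le> tanh (sqrt (- K) * r) / sqrt (- K)"
    using hyp_dist_0_le_iff[OF K x, of r] r by simp
  have "0 \<le> tanh (sqrt (- K) * r) / sqrt (- K)" by (rule order_trans[OF norm_ge_zero n])
  then have "0 \<le> sqrt (- K) * r" using K by (simp add: zero_le_divide_iff zero_le_mult_iff)
  then have "tanh (sqrt (- K) * r) \<le> sqrt (- K) * r"
    using sinh_le_mult_cosh by (simp add: tanh_def divide_le_eq)
  then have "tanh (sqrt (- K) * r) / sqrt (- K) \<le> r" using K by (simp add: divide_le_eq mult.commute)
  with n show ?thesis by (simp add: r_def)
qed

lemma hyp_dist_0_le_mult: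
  assumes K: "K < 0" and x: "norm x \<le> 1 / (2 * sqrt (- K))"
  shows "hyp_dist K 0 x \<le> 2 * norm x"
proof -
  have "(norm x)\<^sup>2 \<le> (1 / (2 * sqrt (- K)))\<^sup>2" using x by (intro power_mono) auto
  then have "K * (1 / (2 * sqrt (- K)))\<^sup>2 \<le> K * (norm x)\<^sup>2" using K by (intro mult_left_mono_neg) auto
  then have c: "3 / 4 \<le> 1 + K * (norm x)\<^sup>2" using K by (simp add: power_divide power_mult_distrib)
  then have "hyp_dist K 0 x \<le> norm (0 - x) / (1 + K * (norm x)\<^sup>2)"
    by (intro hyp_dist_bilipschitz(1) K) auto
  also have "\<dots> \<le> norm x / (3 / 4)" using c by (simp add: frac_le del: divide_divide_eq_right)
  also have "\<dots> \<le> 2 * norm x" by simp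
  finally show ?thesis .
qed

text \<open>Towards the boundary the distance from the origin grows only logarithmically: halving the
  Euclidean distance to the boundary adds a bounded amount.\<close>

lemma hyp_dist_0_le_of_norm_le:
  assumes K: "K < 0" and x: "norm x \<le> (1 - (1 / 2) ^ n) / sqrt (- K)"
  shows "hyp_dist K 0 x \<le> (real n + 1) / sqrt (- K)"
proof -
  define t where "t = sqrt (- K) * norm x"
  have t: "0 \<le> t" "t \<le> 1 - (1 / 2) ^ n" using K x by (auto simp: t_def field_simps)
  have p: "(0::real) < (1 / 2) ^ n" by simp
  with t have t1: "t < 1" by linarith
  have xs: "x \<in> hyp_space K" using K t1 by (simp add: hyp_space_def t_def field_simps)
  have "(1 + t) / (1 - t) \<le> 2 / (1 / 2) ^ n" using t t1 p by (intro frac_le) linarith+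
  also have "\<dots> = 2 ^ (n + 1)" by (simp add: power_divide)
  finally have "ln ((1 + t) / (1 - t)) \<le> ln (2 ^ (n + 1))"
    using t t1 by (subst ln_le_cancel_iff) auto
  also have "\<dots> = (real n + 1) * ln 2" by (subst ln_realpow) auto
  also have "\<dots> \<le> (real n + 1) * 1" using ln_2_less_1 by (intro mult_left_mono) auto
  finally have "artanh t \<le> real n + 1" using t t1 by (simp add: artanh_def)
  then show ?thesis using K by (simp add: hyp_dist_0[OF K xs] t_def divide_right_mono)
qed

section \<open>Lipschitz images and the Hausdorff measure\<close>

lemma ennreal_divide_le_iff:
  "0 < c \<Longrightarrow> z / ennreal c \<le> y \<longleftrightarrow> z \<le> ennreal c * y"
  by (cases z; cases y)
     (auto simp: divide_ennreal ennreal_top_divide ennreal_mult_top field_simps top_unique simp flip: ennreal_mult)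

lemma hyp_diam_image_le:
  assumes C: "0 \<le> C" and lip: "\<And>x y. x \<in> S \<Longrightarrow> y \<in> S \<Longrightarrow> hyp_dist K (f x) (f y) \<le> C * hyp_dist K x y"
  shows "hyp_diam K (f ` S) \<le> ennreal C * hyp_diam K S"
  unfolding hyp_diam_def
proof (intro SUP_least)
  fix a b assume "a \<in> f ` S" "b \<in> f ` S"
  then obtain x y where xy: "x \<in> S" "y \<in> S" "a = f x" "b = f y" by auto
  have "ennreal (hyp_dist K a b) \<le> ennreal (C * hyp_dist K x y)"
    using lip[OF xy(1,2)] xy by (intro ennreal_leI) simp
  also have "\<dots> = ennreal C * ennreal (hyp_dist K x y)" by (rule ennreal_mult'[OF C])
  also have "\<dots> \<le> ennreal C * (SUP x\<in>S. SUP y\<in>S. ennreal (hyp_dist K x y))"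
    using xy by (intro mult_left_mono SUP_upper2[of x] SUP_upper2[of y]) auto
  finally show "ennreal (hyp_dist K a b) \<le> ennreal C * (SUP x\<in>S. SUP y\<in>S. ennreal (hyp_dist K x y))" .
qed

lemma hyp_diam_mono: "S \<subseteq> T \<Longrightarrow> hyp_diam K S \<le> hyp_diam K T"
  unfolding hyp_diam_def by (intro SUP_subset_mono) auto

text \<open>Restricting a cover of \<open>A\<close> to \<open>A\<close> and mapping it by \<open>f\<close> gives a cover of the image whose diameters
  have grown at most by the factor \<open>C\<close>.\<close>

lemma hausdorff_outer_image_le:
  assumes C: "0 < C" and A: "f ` A \<subseteq> hyp_space K"
    and lip: "\<And>x y. x \<in> A \<Longrightarrow> y \<in> A \<Longrightarrow> hyp_dist K (f x) (f y) \<le> C * hyp_dist K x y"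
  shows "hausdorff_outer K n (f ` A) \<le> ennreal (C ^ n) * hausdorff_outer K n A"
  unfolding hausdorff_outer_def
proof (rule SUP_least)
  let ?v = "\<lambda>D. if D = {} then 0 else ennreal (unit_ball_vol (real n) / 2 ^ n) * hyp_diam K D ^ n"
  let ?cov = "\<lambda>A \<delta>. {D :: nat \<Rightarrow> _ set. A \<subseteq> (\<Union>i. D i) \<and> (\<forall>i. D i \<subseteq> hyp_space K \<and> hyp_diam K (D i) \<le> \<delta>)}"
  fix \<delta> :: ennreal assume "\<delta> \<in> {0<..}"
  then have \<delta>: "\<delta> / ennreal C \<in> {0<..}"
    using C by (cases \<delta>) (auto simp: divide_ennreal ennreal_zero_less_divide ennreal_top_divide)
  have "(INF D\<in>?cov (f ` A) \<delta>. \<Sum>i. ?v (D i)) / ennreal (C ^ n)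
      \<le> (INF D\<in>?cov A (\<delta> / ennreal C). \<Sum>i. ?v (D i))"
  proof (rule INF_greatest)
    fix D assume D: "D \<in> ?cov A (\<delta> / ennreal C)"
    define D' where "D' i = f ` (D i \<inter> A)" for i :: nat
    have diam: "hyp_diam K (D' i) \<le> ennreal C * hyp_diam K (D i)" for i
    proof -
      have "hyp_diam K (D' i) \<le> ennreal C * hyp_diam K (D i \<inter> A)"
        unfolding D'_def using C lip by (intro hyp_diam_image_le) auto
      also have "\<dots> \<le> ennreal C * hyp_diam K (D i)"
        by (intro mult_left_mono hyp_diam_mono) auto
      finally show ?thesis .
    qed
    have "ennreal C * hyp_diam K (D i) \<le> \<delta>" for i
    proof -
      have "ennreal C * hyp_diam K (D i) \<le> ennreal C * (\<delta> / ennreal C)"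
        using D by (intro mult_left_mono) auto
      also have "\<dots> = \<delta>" using C
        by (simp add: ennreal_times_divide mult.commute[of _ \<delta>] mult_divide_eq_ennreal)
      finally show ?thesis .
    qed
    then have "hyp_diam K (D' i) \<le> \<delta>" for i by (rule order_trans[OF diam])
    moreover have "f ` A \<subseteq> (\<Union>i. D' i)" using D by (fastforce simp: D'_def)
    ultimately have "D' \<in> ?cov (f ` A) \<delta>" using A by (auto simp: D'_def)
    then have "(INF D\<in>?cov (f ` A) \<delta>. \<Sum>i. ?v (D i)) \<le> (\<Sum>i. ?v (D' i))" by (rule INF_lower)
    also have "\<dots> \<le> (\<Sum>i. ennreal (C ^ n) * ?v (D i))"
    proof (intro suminf_le)
      fix i
      show "?v (D' i) \<le> ennreal (C ^ n) * ?v (D i)"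
      proof (cases "D' i = {}")
        case False
        then have "D i \<noteq> {}" by (auto simp: D'_def)
        moreover have "hyp_diam K (D' i) ^ n \<le> (ennreal C * hyp_diam K (D i)) ^ n"
          by (intro power_mono diam) auto
        then have "hyp_diam K (D' i) ^ n \<le> ennreal (C ^ n) * hyp_diam K (D i) ^ n"
          using C by (simp add: power_mult_distrib ennreal_power)
        then have "ennreal (unit_ball_vol (real n) / 2 ^ n) * hyp_diam K (D' i) ^ n \<le>
            ennreal (unit_ball_vol (real n) / 2 ^ n) * (ennreal (C ^ n) * hyp_diam K (D i) ^ n)"
          by (intro mult_left_mono) auto
        ultimately show ?thesis using False by (simp add: mult.left_commute)
      qed simp
    qed auto
    also have "\<dots> = ennreal (C ^ n) * (\<Sum>i. ?v (D i))" by simp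
    finally show "(INF D\<in>?cov (f ` A) \<delta>. \<Sum>i. ?v (D i)) / ennreal (C ^ n) \<le> (\<Sum>i. ?v (D i))"
      using C by (intro divide_le_posI_ennreal) auto
  qed
  also have "\<dots> \<le> (SUP \<delta>\<in>{0<..}. INF D\<in>?cov A \<delta>. \<Sum>i. ?v (D i))"
    using \<delta> by (rule SUP_upper)
  finally show "(INF D\<in>?cov (f ` A) \<delta>. \<Sum>i. ?v (D i))
      \<le> ennreal (C ^ n) * (SUP \<delta>\<in>{0<..}. INF D\<in>?cov A \<delta>. \<Sum>i. ?v (D i))"
    using C by (simp add: ennreal_divide_le_iff)
qed

section \<open>Measurability in the Fell topology\<close>

lemma closedin_flat: "E \<in> flats K k \<Longrightarrow> closedin (top_of_set (hyp_space K)) E"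
proof -
  assume "E \<in> flats K k"
  then obtain A where "affine A" "E = A \<inter> hyp_space K" unfolding flats_def by blast
  then show ?thesis using affine_closed[of A] by (metis Int_commute closedin_closed_Int)
qed

lemma compact_flat_Int:
  assumes "closedin (top_of_set (hyp_space K)) E" "compact C" "C \<subseteq> hyp_space K"
  shows "compact (E \<inter> C)"
proof -
  obtain T where T: "closed T" "E = hyp_space K \<inter> T" using assms(1) by (auto simp: closedin_closed)
  then have "E \<inter> C = C \<inter> T" using assms(3) by auto
  then show ?thesis using T assms(2) by (simp add: compact_Int_closed)
qed

lemma space_fell_borel [simp]: "space (fell_borel K \<F>) = \<F>"
  by (simp add: fell_borel_def space_measure_of_conv)

lemma sets_fell_borelI: "openin (subtopology (fell_topology K) \<F>) W \<Longrightarrow> W \<in> sets (fell_borel K \<F>)"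
  unfolding fell_borel_def
  by (subst sets_measure_of) (auto simp: openin_subtopology)

lemma fell_openin_missing:
  assumes "compact C" "C \<subseteq> hyp_space K"
  shows "openin (fell_topology K) {F. closedin (top_of_set (hyp_space K)) F \<and> F \<inter> C = {}}"
  unfolding fell_topology_def
  by (intro topology_generated_by_Basis UnI1 CollectI exI[of _ C] conjI refl assms)

lemma fell_openin_hitting:
  assumes "open U" "U \<subseteq> hyp_space K"
  shows "openin (fell_topology K) {F. closedin (top_of_set (hyp_space K)) F \<and> F \<inter> U \<noteq> {}}"
  unfolding fell_topology_def
  by (intro topology_generated_by_Basis UnI2 CollectI exI[of _ U] conjI refl assms)

lemma topspace_fell_topology:
  "topspace (fell_topology K) = {F. closedin (top_of_set (hyp_space K)) F}"
proof
  show "topspace (fell_topology K) \<subseteq> {F. closedin (top_of_set (hyp_space K)) F}"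
    unfolding fell_topology_def topology_generated_by_topspace by (intro Union_least) auto
  show "{F. closedin (top_of_set (hyp_space K)) F} \<subseteq> topspace (fell_topology K)"
    using openin_subset[OF fell_openin_missing[of "{}" K]] by simp
qed

lemma openin_missing_compact:
  assumes \<F>: "\<And>F. F \<in> \<F> \<Longrightarrow> closedin (top_of_set (hyp_space K)) F"
    and C: "compact C" "C \<subseteq> hyp_space K"
  shows "openin (subtopology (fell_topology K) \<F>) {F \<in> \<F>. F \<inter> C = {}}"
  using fell_openin_missing[OF C] \<F> by (auto simp: openin_subtopology)

lemma sets_hitting_compact:
  assumes \<F>: "\<And>F. F \<in> \<F> \<Longrightarrow> closedin (top_of_set (hyp_space K)) F"
    and C: "compact C" "C \<subseteq> hyp_space K"
  shows "{F \<in> \<F>. F \<inter> C \<noteq> {}} \<in> sets (fell_borel K \<F>)"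
proof -
  have "{F \<in> \<F>. F \<inter> C \<noteq> {}} = space (fell_borel K \<F>) - {F \<in> \<F>. F \<inter> C = {}}" by auto
  then show ?thesis
    using sets_fell_borelI[OF openin_missing_compact[OF assms]] by (simp only: sets.compl_sets)
qed

text \<open>Two disjoint compact sets can be separated by finite unions of members of a countable basis,
  so that disjointness is witnessed by one of countably many pairs of conditions, each of which
  concerns only one of the two sets.\<close>

lemma sets_hitting_compact_pair:
  fixes \<F> \<G> :: "'a::euclidean_space set set"
  assumes \<F>: "\<And>F. F \<in> \<F> \<Longrightarrow> closedin (top_of_set (hyp_space K)) F"
    and \<G>: "\<And>F. F \<in> \<G> \<Longrightarrow> closedin (top_of_set (hyp_space K)) F"
    and C: "compact C" "C \<subseteq> hyp_space K"
  shows "{p \<in> \<F> \<times> \<G>. fst p \<inter> snd p \<inter> C \<noteq> {}} \<in> sets (fell_borel K \<F> \<Otimes>\<^sub>M fell_borel K \<G>)"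
proof -
  obtain B :: "'a set set" where B: "countable B" "topological_basis B"
    using ex_countable_basis by blast
  have oB: "open (\<Union>S)" if "S \<subseteq> B" for S using B(2) that by (auto dest: topological_basis_open)
  have cover: "\<exists>S. finite S \<and> S \<subseteq> B \<and> P \<subseteq> \<Union>S \<and> \<Union>S \<subseteq> U" if PU: "compact P" "open U" "P \<subseteq> U" for P U
  proof -
    obtain B' where B': "B' \<subseteq> B" "\<Union>B' = U" using B(2) PU(2) by (auto simp: topological_basis_def)
    obtain S where "S \<subseteq> B'" "finite S" "P \<subseteq> \<Union>S"
    proof (rule compactE[OF PU(1), of B'])
      show "P \<subseteq> \<Union>B'" using PU B' by auto
      show "\<And>b. b \<in> B' \<Longrightarrow> open b" using B' B(2) by (auto dest: topological_basis_open)
    qed auto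
    then show ?thesis using B' by (intro exI[of _ S]) auto
  qed
  define I where "I = {(S, T). S \<subseteq> B \<and> finite S \<and> T \<subseteq> B \<and> finite T \<and> \<Union>S \<inter> \<Union>T = {}}"
  have "countable ({S. S \<subseteq> B \<and> finite S} \<times> {S. S \<subseteq> B \<and> finite S})"
    using countable_Collect_finite_subset[OF B(1)] by (simp add: conj_commute)
  then have I: "countable I" by (rule countable_subset[rotated]) (auto simp: I_def)
  let ?R = "\<lambda>(S, T). {F \<in> \<F>. F \<inter> (C - \<Union>S) = {}} \<times> {F \<in> \<G>. F \<inter> (C - \<Union>T) = {}}"
  have "(\<Union>p\<in>I. ?R p) = {p \<in> \<F> \<times> \<G>. fst p \<inter> snd p \<inter> C = {}}" (is "?L = ?R'")
  proof
    show "?L \<subseteq> ?R'" by (auto simp: I_def) blast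
    show "?R' \<subseteq> ?L"
    proof
      fix p assume p: "p \<in> ?R'"
      obtain E L where EL: "p = (E, L)" by (cases p)
      have c: "compact (E \<inter> C)" "compact (L \<inter> C)"
        using p EL \<F> \<G> C by (auto intro!: compact_flat_Int)
      then obtain U V where UV: "open U" "open V" "E \<inter> C \<subseteq> U" "L \<inter> C \<subseteq> V" "U \<inter> V = {}"
        using separation_normal[of "E \<inter> C" "L \<inter> C"] p EL by (auto dest!: compact_imp_closed)
      obtain S where S: "finite S" "S \<subseteq> B" "E \<inter> C \<subseteq> \<Union>S" "\<Union>S \<subseteq> U" using cover[OF c(1)] UV by metis
      obtain T where T: "finite T" "T \<subseteq> B" "L \<inter> C \<subseteq> \<Union>T" "\<Union>T \<subseteq> V" using cover[OF c(2)] UV by metis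
      have "\<Union>S \<inter> \<Union>T = {}" using S(4) T(4) UV(5) by blast
      then have "(S, T) \<in> I" using S T by (simp add: I_def)
      moreover have "p \<in> ?R (S, T)" using p EL S T by auto
      ultimately show "p \<in> ?L" by blast
    qed
  qed
  moreover have "(\<Union>p\<in>I. ?R p) \<in> sets (fell_borel K \<F> \<Otimes>\<^sub>M fell_borel K \<G>)"
  proof (rule sets.countable_UN''[OF I])
    fix p assume "p \<in> I"
    then obtain S T where p: "p = (S, T)" "S \<subseteq> B" "T \<subseteq> B" by (auto simp: I_def)
    have "compact (C - \<Union>S)" "compact (C - \<Union>T)" using C(1) oB p by (auto intro: compact_diff)
    moreover have "C - \<Union>S \<subseteq> hyp_space K" "C - \<Union>T \<subseteq> hyp_space K" using C(2) by auto
    ultimately have "{F \<in> \<F>. F \<inter> (C - \<Union>S) = {}} \<in> sets (fell_borel K \<F>)"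
      "{F \<in> \<G>. F \<inter> (C - \<Union>T) = {}} \<in> sets (fell_borel K \<G>)"
      by (simp_all add: sets_fell_borelI[OF openin_missing_compact] \<F> \<G>)
    then show "?R p \<in> sets (fell_borel K \<F> \<Otimes>\<^sub>M fell_borel K \<G>)"
      unfolding p prod.case by (rule pair_measureI)
  qed
  ultimately have "{p \<in> \<F> \<times> \<G>. fst p \<inter> snd p \<inter> C = {}} \<in> sets (fell_borel K \<F> \<Otimes>\<^sub>M fell_borel K \<G>)"
    by simp
  moreover have "{p \<in> \<F> \<times> \<G>. fst p \<inter> snd p \<inter> C \<noteq> {}} =
      space (fell_borel K \<F> \<Otimes>\<^sub>M fell_borel K \<G>) - {p \<in> \<F> \<times> \<G>. fst p \<inter> snd p \<inter> C = {}}"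
    by (auto simp: space_pair_measure)
  ultimately show ?thesis by (simp only: sets.compl_sets)
qed

section \<open>Orthogonal transformations\<close>

text \<open>An orthogonal transformation is determined by the images of the basis vectors. For every assignment of vectors from
  a countable dense set to the basis vectors and every precision \<open>1 / (n + 1)\<close>, one
  orthogonal transformation within this precision is chosen, if there is any.\<close>

lemma countable_dense_orthogonal_transformations:
  obtains Q :: "('a::euclidean_space \<Rightarrow> 'a) set" where "countable Q"
    and "\<And>\<phi>. \<phi> \<in> Q \<Longrightarrow> orthogonal_transformation \<phi>"
    and "\<And>\<phi>0 \<epsilon>. orthogonal_transformation \<phi>0 \<Longrightarrow> \<epsilon> > 0 \<Longrightarrow>
      \<exists>\<phi>\<in>Q. \<forall>x. norm (\<phi> x - \<phi>0 x) \<le> \<epsilon> * norm x"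
proof -
  obtain D :: "'a set" where D: "countable D" "\<And>X. open X \<Longrightarrow> X \<noteq> {} \<Longrightarrow> \<exists>d\<in>D. d \<in> X"
    by (rule countable_dense_setE) blast
  let ?near = "\<lambda>g n \<phi>. orthogonal_transformation \<phi> \<and> (\<forall>b\<in>Basis. norm (\<phi> b - g b) < 1 / real (Suc n))"
  let ?pick = "\<lambda>(g, n). SOME \<phi> :: 'a \<Rightarrow> 'a. ?near g n \<phi>"
  define P where "P = {(g, n). g \<in> PiE Basis (\<lambda>_. D) \<and> (\<exists>\<phi> :: 'a \<Rightarrow> 'a. ?near g n \<phi>)}"
  have "countable (PiE (Basis :: 'a set) (\<lambda>_. D) \<times> (UNIV :: nat set))"
    using D(1) by (intro countable_SIGMA countable_PiE) auto
  then have cP: "countable P" by (rule countable_subset[rotated]) (auto simp: P_def)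
  have pick: "?near g n (?pick (g, n))" if "(g, n) \<in> P" for g n
    using someI_ex[of "?near g n"] that by (auto simp: P_def)
  show thesis
  proof
    show "countable (?pick ` P)" using cP by (rule countable_image)
    show "orthogonal_transformation \<phi>" if "\<phi> \<in> ?pick ` P" for \<phi>
      using that pick by (force simp del: split_paired_Ex)
    fix \<phi>0 :: "'a \<Rightarrow> 'a" and \<epsilon> :: real assume \<phi>0: "orthogonal_transformation \<phi>0" and \<epsilon>: "\<epsilon> > 0"
    obtain n where n: "2 * real DIM('a) / \<epsilon> < real (Suc n)"
      using reals_Archimedean2 less_SucI by (metis lessI less_trans of_nat_less_iff)
    have "\<exists>d\<in>D. norm (\<phi>0 b - d) < 1 / real (Suc n)" for b
      using D(2)[of "ball (\<phi>0 b) (1 / real (Suc n))"] by (auto simp: dist_norm)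
    then obtain g0 where g0: "\<And>b. g0 b \<in> D" "\<And>b. norm (\<phi>0 b - g0 b) < 1 / real (Suc n)" by metis
    define g where "g = restrict g0 Basis"
    have P: "(g, n) \<in> P" using g0 \<phi>0 by (auto simp: P_def g_def intro!: exI[of _ \<phi>0])
    define \<phi> where "\<phi> = ?pick (g, n)"
    have \<phi>: "linear \<phi>" "linear \<phi>0" using pick[OF P] \<phi>0 by (auto simp: \<phi>_def orthogonal_transformation_def)
    have d: "norm (\<phi> b - \<phi>0 b) \<le> 2 / real (Suc n)" if "b \<in> Basis" for b
    proof -
      have "norm (\<phi> b - g0 b) < 1 / real (Suc n)" using pick[OF P] that by (auto simp: \<phi>_def g_def)
      then have "norm (\<phi> b - g0 b) + norm (g0 b - \<phi>0 b) \<le> 1 / real (Suc n) + 1 / real (Suc n)"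
        using g0(2)[of b] by (simp add: norm_minus_commute)
      then show ?thesis using norm_triangle_ineq[of "\<phi> b - g0 b" "g0 b - \<phi>0 b"] by simp
    qed
    have "norm (\<phi> x - \<phi>0 x) \<le> \<epsilon> * norm x" for x
    proof -
      have "\<phi> x - \<phi>0 x = (\<Sum>b\<in>Basis. (x \<bullet> b) *\<^sub>R (\<phi> b - \<phi>0 b))"
        using \<phi> by (subst (1 2) euclidean_representation[of x, symmetric])
          (simp add: linear_sum linear_cmul scaleR_diff_right sum_subtractf del: euclidean_representation)
      also have "norm \<dots> \<le> (\<Sum>b\<in>Basis. norm ((x \<bullet> b) *\<^sub>R (\<phi> b - \<phi>0 b)))" by (rule norm_sum)
      also have "\<dots> \<le> (\<Sum>b\<in>(Basis::'a set). norm x * (2 / real (Suc n)))"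
        using d by (intro sum_mono) (simp only: norm_scaleR real_norm_def, intro mult_mono Basis_le_norm, auto)
      also have "\<dots> = (2 * real DIM('a) / real (Suc n)) * norm x" by simp
      also have "\<dots> \<le> \<epsilon> * norm x"
        using n \<epsilon> by (intro mult_right_mono) (auto simp: field_simps)
      finally show ?thesis .
    qed
    then show "\<exists>\<phi>\<in>?pick ` P. \<forall>x. norm (\<phi> x - \<phi>0 x) \<le> \<epsilon> * norm x"
      using P unfolding \<phi>_def by blast
  qed
qed

text \<open>The orthogonal projection to \<open>W\<close>, chosen as a linear map as a whole, so that linearity is part of
  its characterisation.\<close>

definition orth_proj :: "'a::euclidean_space set \<Rightarrow> 'a \<Rightarrow> 'a" where
  "orth_proj W = (SOME p. linear p \<and> (\<forall>x. p x \<in> W \<and> (\<forall>w\<in>W. (x - p x) \<bullet> w = 0)))"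

lemma orth_proj:
  assumes "subspace W"
  shows "linear (orth_proj W)" "orth_proj W x \<in> W" "w \<in> W \<Longrightarrow> (x - orth_proj W x) \<bullet> w = 0"
proof -
  obtain B where B: "pairwise orthogonal B" "span B = W" "independent B"
    using orthogonal_basis_subspace[OF assms] by metis
  define p where "p x = (\<Sum>b\<in>B. (b \<bullet> x / (b \<bullet> b)) *\<^sub>R b)" for x
  have "linear p"
    by (rule linearI)
      (simp_all add: p_def inner_add_right add_divide_distrib scaleR_add_left sum.distrib scaleR_sum_right)
  moreover have "p x \<in> W" for x
    unfolding p_def using B(2) assms by (intro subspace_sum subspace_scale) (auto simp: span_base)
  moreover have "(x - p x) \<bullet> w = 0" if "w \<in> W" for x w
    using Gram_Schmidt_step[OF B(1), of w x] that B(2) by (simp add: p_def orthogonal_def inner_commute)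
  ultimately have "\<exists>p. linear p \<and> (\<forall>x. p x \<in> W \<and> (\<forall>w\<in>W. (x - p x) \<bullet> w = 0))" by blast
  from someI_ex[OF this] show "linear (orth_proj W)" "orth_proj W x \<in> W"
    "w \<in> W \<Longrightarrow> (x - orth_proj W x) \<bullet> w = 0"
    by (simp_all add: orth_proj_def)
qed

lemma orth_proj_unique:
  assumes W: "subspace W" and x: "x \<in> W" "\<And>w. w \<in> W \<Longrightarrow> (y - x) \<bullet> w = 0"
  shows "orth_proj W y = x"
proof -
  let ?d = "orth_proj W y - x"
  have d: "?d \<in> W" using W x orth_proj(2)[OF W] by (intro subspace_diff)
  have "?d \<bullet> ?d = (y - x) \<bullet> ?d - (y - orth_proj W y) \<bullet> ?d" by (simp flip: inner_diff_left)
  then have "?d \<bullet> ?d = 0" using x(2)[OF d] orth_proj(3)[OF W d, of y] by simp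
  then show ?thesis by simp
qed

lemma orth_proj_id: "subspace W \<Longrightarrow> x \<in> W \<Longrightarrow> orth_proj W x = x"
  by (rule orth_proj_unique) auto

lemma norm_orth_proj_le: "subspace W \<Longrightarrow> norm (orth_proj W x) \<le> norm x"
proof -
  assume W: "subspace W"
  have "(norm (orth_proj W x))\<^sup>2 + (norm (x - orth_proj W x))\<^sup>2 = (norm (orth_proj W x + (x - orth_proj W x)))\<^sup>2"
    using orth_proj(3)[OF W orth_proj(2)[OF W], of x x]
    by (intro norm_add_Pythagorean[symmetric]) (simp add: orthogonal_def inner_commute)
  then have "(norm (orth_proj W x))\<^sup>2 \<le> (norm x)\<^sup>2"
    using zero_le_power2[of "norm (x - orth_proj W x)"] unfolding add.commute[of _ "x - _"] diff_add_cancel by linarith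
  then show ?thesis by (rule power2_le_imp_le) simp
qed

text \<open>A linear isometry between the subspaces and one between their orthogonal complements fit together.\<close>

lemma orthogonal_transformation_between_subspaces:
  fixes S T :: "'a::euclidean_space set"
  assumes S: "subspace S" and T: "subspace T" and d: "dim S = dim T"
  obtains \<phi> where "orthogonal_transformation \<phi>" "\<phi> ` S = T"
proof -
  define S' where "S' = {y. \<forall>x\<in>S. orthogonal x y}"
  define T' where "T' = {y. \<forall>x\<in>T. orthogonal x y}"
  have S': "subspace S'" "subspace T'"
    by (auto simp: S'_def T'_def subspace_def orthogonal_def inner_add_right)
  have "dim S' + dim S = DIM('a)" "dim T' + dim T = DIM('a)"
    using dim_subspace_orthogonal_to_vectors[OF S subspace_UNIV] dim_subspace_orthogonal_to_vectors[OF T subspace_UNIV]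
    by (simp_all add: S'_def T'_def)
  then have d': "dim S' = dim T'" using d by simp
  obtain f g where f: "linear f" "f ` S = T" "\<And>x. x \<in> S \<Longrightarrow> norm (f x) = norm x"
    using isometries_subspaces[OF S T d] by metis
  obtain f' where f': "linear f'" "f' ` S' = T'" "\<And>x. x \<in> S' \<Longrightarrow> norm (f' x) = norm x"
    using isometries_subspaces[OF S' d'] by metis
  define p where "p = orth_proj S"
  have p: "linear p" "p x \<in> S" "x - p x \<in> S'" for x
    using orth_proj[OF S] by (auto simp: p_def S'_def orthogonal_def inner_commute)
  define \<phi> where "\<phi> x = f (p x) + f' (x - p x)" for x
  have "linear \<phi>"
    using p(1) f(1) f'(1)
    by (intro linearI) (simp_all add: \<phi>_def linear_add linear_cmul linear_diff algebra_simps)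
  moreover have "norm (\<phi> x) = norm x" for x
  proof -
    have "orthogonal (f (p x)) (f' (x - p x))" "orthogonal (p x) (x - p x)"
      using f(2) f'(2) p(2,3)[of x] by (auto simp: T'_def S'_def)
    then have "(norm (\<phi> x))\<^sup>2 = (norm (p x + (x - p x)))\<^sup>2"
      unfolding \<phi>_def using p(2,3)[of x] f(3) f'(3) by (simp only: norm_add_Pythagorean)
    then show ?thesis by simp
  qed
  moreover have "\<phi> x = f x" if "x \<in> S" for x
    using that linear_0[OF f'(1)] by (simp add: \<phi>_def p_def orth_proj_id[OF S])
  ultimately show thesis
    using f(2) by (intro that[of \<phi>]) (auto simp: orthogonal_transformation image_iff)
qed

section \<open>Rotation invariance\<close>

lemma origin_flats_iff:
  "L \<in> origin_flats K k \<longleftrightarrow> (\<exists>W. subspace W \<and> dim W = k \<and> L = W \<inter> hyp_space K)" if "K < 0"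
proof -
  have 0: "0 \<in> hyp_space K" using that by (simp add: hyp_space_def)
  show ?thesis
  proof
    assume "L \<in> origin_flats K k"
    then obtain A where A: "affine A" "aff_dim A = int k" "L = A \<inter> hyp_space K" "0 \<in> A"
      by (auto simp: origin_flats_def flats_def)
    then have "subspace A" by (simp add: subspace_affine)
    then show "\<exists>W. subspace W \<and> dim W = k \<and> L = W \<inter> hyp_space K"
      using A by (intro exI[of _ A]) (auto simp: aff_dim_subspace)
  next
    assume "\<exists>W. subspace W \<and> dim W = k \<and> L = W \<inter> hyp_space K"
    then obtain W where W: "subspace W" "dim W = k" "L = W \<inter> hyp_space K" by auto
    then have "affine W" "0 \<in> W" "aff_dim W = int k" by (auto simp: subspace_affine aff_dim_subspace)
    then show "L \<in> origin_flats K k" using 0 W unfolding origin_flats_def flats_def by blast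
  qed
qed

lemma orthogonal_image_hyp_space:
  fixes \<phi> :: "'a::euclidean_space \<Rightarrow> 'a"
  assumes "orthogonal_transformation \<phi>" shows "\<phi> ` hyp_space K = hyp_space K"
  using image_orthogonal_transformation_ball[OF assms, of 0] linear_0[OF orthogonal_transformation_linear[OF assms]]
  by (simp add: hyp_space_def)

lemma orthogonal_transformation_origin_isometry:
  assumes "orthogonal_transformation \<phi>"
  shows "origin_isometry K \<phi>"
proof -
  have "bij \<phi>" using assms by (rule orthogonal_transformation_bij)
  then have "bij_betw \<phi> (hyp_space K) (\<phi> ` hyp_space K)"
    by (meson bij_betw_imp_inj_on inj_on_imp_bij_betw inj_on_subset subset_UNIV)
  moreover have "\<phi> ` hyp_space K = hyp_space K"
    by (rule orthogonal_image_hyp_space[OF assms])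
  ultimately show ?thesis
    using assms by (auto simp: origin_isometry_def hyp_dist_def orthogonal_transformation_def linear_0)
qed

text \<open>A rotation acts continuously in the Fell topology, since the preimages of the subbasic open sets
  are again subbasic: \<open>\<phi> F\<close> misses \<open>C\<close> if and only if \<open>F\<close> misses the preimage of \<open>C\<close>.\<close>

lemma measurable_image_origin_flats:
  fixes \<phi> :: "'a::euclidean_space \<Rightarrow> 'a"
  assumes \<phi>: "orthogonal_transformation \<phi>" and K: "K < 0"
  shows "(`) \<phi> \<in> measurable (fell_borel K (origin_flats K q)) (fell_borel K (origin_flats K q))"
proof -
  let ?\<F> = "origin_flats K q"
  have lin: "linear \<phi>" and bij: "bij \<phi>"
    using \<phi> by (auto intro: orthogonal_transformation_bij orthogonal_transformation_linear)
  have inj: "inj \<phi>" using bij by (rule bij_is_inj)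
  have H: "\<phi> ` hyp_space K = hyp_space K" by (rule orthogonal_image_hyp_space[OF \<phi>])
  have invH: "\<phi> -` hyp_space K = hyp_space K" using inj_vimage_image_eq[OF inj, of "hyp_space K"] by (simp only: H)
  have cont: "continuous_on UNIV \<phi>" using lin by (simp add: linear_continuous_on linear_conv_bounded_linear)
  have im: "\<phi> ` L \<in> ?\<F>" if L: "L \<in> ?\<F>" for L
  proof -
    obtain W where W: "subspace W" "dim W = q" "L = W \<inter> hyp_space K"
      using L by (auto simp: origin_flats_iff[OF K])
    then have "\<phi> ` L = \<phi> ` W \<inter> hyp_space K" using H inj by (simp add: image_Int)
    moreover have "subspace (\<phi> ` W)" using W lin by (simp add: linear_subspace_image)
    moreover have "dim (\<phi> ` W) = q" using W lin inj by (simp add: dim_image_eq inj_on_subset)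
    ultimately show ?thesis by (auto simp: origin_flats_iff[OF K])
  qed
  have inv_compact: "compact (\<phi> -` C)" if "compact C" for C
  proof -
    have "\<phi> -` C = inv \<phi> ` C" using bij by (simp add: bij_vimage_eq_inv_image)
    moreover have "linear (inv \<phi>)" using \<phi> orthogonal_transformation_inv orthogonal_transformation_linear by blast
    then have "continuous_on C (inv \<phi>)" by (simp add: linear_continuous_on linear_conv_bounded_linear)
    ultimately show ?thesis using that by (simp add: compact_continuous_image)
  qed
  have closed_im: "closedin (top_of_set (hyp_space K)) (\<phi> ` F)"
    if F: "closedin (top_of_set (hyp_space K)) F" for F
  proof -
    obtain T where "closed T" "F = hyp_space K \<inter> T" using F by (auto simp: closedin_closed)
    moreover then have "closed (\<phi> ` T)" using closed_injective_linear_image[OF _ lin inj] by blast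
    ultimately show ?thesis using H inj by (auto simp: closedin_closed image_Int)
  qed
  have "continuous_map (fell_topology K) (fell_topology K) ((`) \<phi>)"
    unfolding fell_topology_def[of K]
  proof (rule continuous_on_generated_topo, unfold fell_topology_def[symmetric])
    let ?miss = "\<lambda>C. {F :: 'a set. closedin (top_of_set (hyp_space K)) F \<and> F \<inter> C = {}}"
    let ?hit = "\<lambda>U. {F :: 'a set. closedin (top_of_set (hyp_space K)) F \<and> F \<inter> U \<noteq> {}}"
    let ?S = "{?miss C | C. compact C \<and> C \<subseteq> hyp_space K} \<union> {?hit U | U. open U \<and> U \<subseteq> hyp_space K}"
    show "(`) \<phi> ` topspace (fell_topology K) \<subseteq> \<Union>?S"
    proof (rule order_trans)
      show "(`) \<phi> ` topspace (fell_topology K) \<subseteq> ?miss {}"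
        using closed_im by (auto simp: topspace_fell_topology)
      have "?miss {} \<in> ?S" by (intro UnI1 CollectI exI[of _ "{}"] conjI refl) auto
      then show "?miss {} \<subseteq> \<Union>?S" by (rule Union_upper)
    qed
    fix X assume "X \<in> ?S"
    then show "openin (fell_topology K) ((`) \<phi> -` X \<inter> topspace (fell_topology K))"
    proof (elim UnE CollectE exE conjE)
      fix C assume C: "X = ?miss C" "compact C" "C \<subseteq> hyp_space K"
      have "(`) \<phi> -` X \<inter> topspace (fell_topology K) = ?miss (\<phi> -` C)"
        using C closed_im by (auto simp: topspace_fell_topology)
      moreover have "\<phi> -` C \<subseteq> hyp_space K" using C invH by auto
      ultimately show ?thesis using inv_compact[OF C(2)] by (simp only: fell_openin_missing)
    next
      fix U assume U: "X = ?hit U" "open U" "U \<subseteq> hyp_space K"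
      have "(`) \<phi> -` X \<inter> topspace (fell_topology K) = ?hit (\<phi> -` U)"
        using U closed_im by (auto simp: topspace_fell_topology)
      moreover have "\<phi> -` U \<subseteq> hyp_space K" using U invH by auto
      moreover have "open (\<phi> -` U)" using open_vimage[OF U(2) cont] .
      ultimately show ?thesis by (simp only: fell_openin_hitting)
    qed
  qed
  then have cm: "continuous_map (subtopology (fell_topology K) ?\<F>) (subtopology (fell_topology K) ?\<F>) ((`) \<phi>)"
    using im by (auto simp: continuous_map_in_subtopology continuous_map_from_subtopology)
  have topsp: "topspace (subtopology (fell_topology K) ?\<F>) = ?\<F>"
    by (auto simp: topspace_fell_topology origin_flats_def closedin_flat)
  show ?thesis
    unfolding fell_borel_def[of K ?\<F>]
  proof (rule measurable_measure_of, unfold fell_borel_def[symmetric])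
    fix W :: "'a set set" assume W: "W \<in> {W. openin (subtopology (fell_topology K) ?\<F>) W}"
    then have "openin (subtopology (fell_topology K) ?\<F>) {x \<in> ?\<F>. \<phi> ` x \<in> W}"
      using openin_continuous_map_preimage[OF cm, of W] by (simp only: topsp mem_Collect_eq)
    moreover have "(`) \<phi> -` W \<inter> space (fell_borel K ?\<F>) = {x \<in> ?\<F>. \<phi> ` x \<in> W}" by auto
    ultimately show "(`) \<phi> -` W \<inter> space (fell_borel K ?\<F>) \<in> sets (fell_borel K ?\<F>)"
      by (simp only: sets_fell_borelI)
  qed (use im in \<open>auto simp: openin_subtopology\<close>)
qed

text \<open>If \<open>X\<close> were a null set, then so would be the union of its preimages under a countable dense set
  of rotations. But by assumption every flat lies in one of these preimages.\<close>

lemma invariant_origin_flat_prob_positive: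
  fixes \<nu> :: "'a::euclidean_space set measure"
  assumes \<nu>: "invariant_origin_flat_prob K q \<nu>" and K: "K < 0" and X: "X \<in> sets \<nu>"
    and loc: "\<And>V. V \<in> origin_flats K q \<Longrightarrow> \<exists>(\<phi>0 :: 'a \<Rightarrow> 'a) \<epsilon>. orthogonal_transformation \<phi>0 \<and> \<epsilon> > 0 \<and>
      (\<forall>\<phi> :: 'a \<Rightarrow> 'a. orthogonal_transformation \<phi> \<and> (\<forall>x. norm (\<phi> x - \<phi>0 x) \<le> \<epsilon> * norm x) \<longrightarrow> \<phi> ` V \<in> X)"
  shows "emeasure \<nu> X > 0"
proof (rule ccontr)
  assume "\<not> emeasure \<nu> X > 0"
  then have X0: "emeasure \<nu> X = 0" by simp
  obtain Q :: "('a \<Rightarrow> 'a) set" where Q: "countable Q" "\<And>\<phi>. \<phi> \<in> Q \<Longrightarrow> orthogonal_transformation \<phi>"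
    "\<And>\<phi>0 \<epsilon>. orthogonal_transformation \<phi>0 \<Longrightarrow> \<epsilon> > 0 \<Longrightarrow> \<exists>\<phi>\<in>Q. \<forall>x. norm (\<phi> x - \<phi>0 x) \<le> \<epsilon> * norm x"
    using countable_dense_orthogonal_transformations by metis
  have sets: "sets \<nu> = sets (fell_borel K (origin_flats K q))" and sp: "space \<nu> = origin_flats K q"
    and ps: "prob_space \<nu>"
    using \<nu> by (auto simp: invariant_origin_flat_prob_def)
  have "(`) \<phi> -` X \<inter> space \<nu> \<in> null_sets \<nu>" if "\<phi> \<in> Q" for \<phi>
  proof -
    have m: "(`) \<phi> \<in> measurable \<nu> \<nu>"
      using measurable_image_origin_flats[OF Q(2)[OF that] K] measurable_cong_sets[OF sets sets] by blast
    have "distr \<nu> \<nu> ((`) \<phi>) = \<nu>"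
      using \<nu> orthogonal_transformation_origin_isometry[OF Q(2)[OF that]]
      by (auto simp: invariant_origin_flat_prob_def)
    then have "emeasure \<nu> ((`) \<phi> -` X \<inter> space \<nu>) = 0"
      using emeasure_distr[OF m X] X0 by simp
    then show ?thesis using measurable_sets[OF m X] by auto
  qed
  then have "(\<Union>\<phi>\<in>Q. (`) \<phi> -` X \<inter> space \<nu>) \<in> null_sets \<nu>" by (intro null_sets_UN' Q(1))
  moreover have "(\<Union>\<phi>\<in>Q. (`) \<phi> -` X \<inter> space \<nu>) = space \<nu>"
  proof
    show "space \<nu> \<subseteq> (\<Union>\<phi>\<in>Q. (`) \<phi> -` X \<inter> space \<nu>)"
    proof
      fix V assume V: "V \<in> space \<nu>"
      then have "V \<in> origin_flats K q" using sp by simp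
      from loc[OF this] obtain \<phi>0 \<epsilon> where l: "orthogonal_transformation \<phi>0 \<and> \<epsilon> > 0 \<and>
        (\<forall>\<phi>. orthogonal_transformation \<phi> \<and> (\<forall>x. norm (\<phi> x - \<phi>0 x) \<le> \<epsilon> * norm x) \<longrightarrow> \<phi> ` V \<in> X)"
        by (elim exE)
      obtain \<phi> where \<phi>: "\<phi> \<in> Q" "\<forall>x. norm (\<phi> x - \<phi>0 x) \<le> \<epsilon> * norm x"
        using Q(3)[OF conjunct1[OF l] conjunct1[OF conjunct2[OF l]]] by (elim bexE)
      have "\<phi> ` V \<in> X" using l \<phi>(2) Q(2)[OF \<phi>(1)] by simp
      with \<phi>(1) have "\<phi> \<in> Q" "\<phi> ` V \<in> X" by auto
      then show "V \<in> (\<Union>\<phi>\<in>Q. (`) \<phi> -` X \<inter> space \<nu>)" using V by auto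
    qed
  qed auto
  ultimately show False using prob_space.emeasure_space_1[OF ps] by (auto simp: null_sets_def)
qed

section \<open>Flats\<close>

text \<open>For \<open>x \<in> W\<close> this is the fibre over \<open>x\<close> of the orthogonal projection to \<open>W\<close>, and also the flat
  through \<open>x\<close> that is orthogonal to \<open>W\<close> in the hyperbolic sense.\<close>

definition perp_flat :: "real \<Rightarrow> 'a::euclidean_space set \<Rightarrow> 'a \<Rightarrow> 'a set" where
  "perp_flat K W x = {y \<in> hyp_space K. \<forall>w\<in>W. (y - x) \<bullet> w = 0}"

lemma mem_translation_iff: "y \<in> (+) x ` U \<longleftrightarrow> y - x \<in> U" for x :: "'a::ab_group_add"
  by (auto intro: rev_image_eqI[of "y - x"])

lemma open_hyp_space: "open (hyp_space K)"
  by (simp add: hyp_space_def)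

lemma flatsE:
  assumes "E \<in> flats K k"
  obtains A where "affine A" "aff_dim A = int k" "E = A \<inter> hyp_space K" "A \<inter> hyp_space K \<noteq> {}"
  using assms unfolding flats_def mem_Collect_eq by (elim exE conjE) (rule that)

lemma flatsI: "affine A \<Longrightarrow> aff_dim A = int k \<Longrightarrow> A \<inter> hyp_space K \<noteq> {} \<Longrightarrow> A \<inter> hyp_space K \<in> flats K k"
  unfolding flats_def mem_Collect_eq by (intro exI[of _ A] conjI refl)

lemma dim_orthogonal_comp:
  fixes W :: "'a::euclidean_space set"
  assumes "subspace W" shows "dim (W\<^sup>\<bottom>) + dim W = DIM('a)"
  using dim_subspace_orthogonal_to_vectors[OF assms subspace_UNIV] by (simp add: orthogonal_comp_def)

lemma perp_flat_eq: "perp_flat K W x = (+) x ` (W\<^sup>\<bottom>) \<inter> hyp_space K"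
proof -
  have "y \<in> (+) x ` (W\<^sup>\<bottom>) \<longleftrightarrow> (\<forall>w\<in>W. (y - x) \<bullet> w = 0)" for y
    by (simp add: mem_translation_iff orthogonal_comp_def orthogonal_def inner_commute)
  then show ?thesis by (auto simp: perp_flat_def)
qed

lemma affine_perp: "affine ((+) x ` (W\<^sup>\<bottom>))"
  using affine_translation subspace_imp_affine[OF subspace_orthogonal_comp] by blast

lemma perp_flat_in_flats:
  fixes W :: "'a::euclidean_space set"
  assumes "subspace W" "dim W + k = DIM('a)" "x \<in> hyp_space K"
  shows "perp_flat K W x \<in> flats K k"
proof -
  have "aff_dim ((+) x ` (W\<^sup>\<bottom>)) = int k"
    using dim_orthogonal_comp[OF assms(1)] assms(2)
    by (simp add: aff_dim_translation_eq aff_dim_subspace subspace_orthogonal_comp)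
  moreover have "x \<in> (+) x ` (W\<^sup>\<bottom>) \<inter> hyp_space K"
    using assms(3) subspace_0[OF subspace_orthogonal_comp] by (simp add: mem_translation_iff)
  ultimately show ?thesis unfolding perp_flat_eq by (intro flatsI affine_perp) auto
qed

lemma flats_eq_perp_flat:
  fixes E :: "'a::euclidean_space set"
  assumes E: "E \<in> flats K k"
  obtains W x where "subspace W" "dim W + k = DIM('a)" "x \<in> W \<inter> hyp_space K" "E = perp_flat K W x"
proof -
  obtain A where A: "affine A" "aff_dim A = int k" "E = A \<inter> hyp_space K" "A \<inter> hyp_space K \<noteq> {}"
    by (rule flatsE[OF E])
  then obtain a where a: "a \<in> A" "a \<in> hyp_space K" by auto
  define U where "U = (\<lambda>x. x - a) ` A"
  have U: "subspace U" unfolding U_def by (rule affine_diffs_subspace_subtract[OF A(1) a(1)])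
  have dU: "dim U = k"
    using A(2) aff_dim_subspace[OF U] aff_dim_translation_eq_subtract[of a A] by (simp add: U_def)
  define W where "W = U\<^sup>\<bottom>"
  have W: "subspace W" by (simp add: W_def subspace_orthogonal_comp)
  define x where "x = orth_proj W a"
  have "norm x \<le> norm a" unfolding x_def by (rule norm_orth_proj_le[OF W])
  then have "x \<in> W \<inter> hyp_space K" using a(2) orth_proj(2)[OF W] by (auto simp: x_def hyp_space_def)
  moreover have "dim W + k = DIM('a)" using dim_orthogonal_comp[OF U] dU by (simp add: W_def)
  moreover have "A = (+) x ` (W\<^sup>\<bottom>)"
  proof -
    have WU: "W\<^sup>\<bottom> = U" unfolding W_def by (rule orthogonal_comp_self[OF U])
    have "a - x \<in> U" unfolding WU[symmetric] using orth_proj(3)[OF W]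
      by (simp add: orthogonal_comp_def orthogonal_def inner_commute x_def)
    then have "y \<in> A \<longleftrightarrow> y - x \<in> U" for y
    proof -
      assume ax: "a - x \<in> U"
      have "y \<in> A \<longleftrightarrow> y - a \<in> U" by (auto simp: U_def)
      also have "\<dots> \<longleftrightarrow> y - x \<in> U"
        using subspace_add[OF U _ ax, of "y - a"] subspace_diff[OF U _ ax, of "y - x"] by auto
      finally show ?thesis .
    qed
    then show ?thesis unfolding WU by (intro set_eqI) (simp add: mem_translation_iff)
  qed
  ultimately show thesis using that[OF W] A(3) by (simp add: perp_flat_eq)
qed

lemma mem_perp_flat_iff_orth_proj:
  assumes "subspace W" "x \<in> W"
  shows "y \<in> perp_flat K W x \<longleftrightarrow> y \<in> hyp_space K \<and> orth_proj W y = x"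
  using orth_proj_unique[OF assms, of y] orth_proj(3)[OF assms(1)] by (auto simp: perp_flat_def)

lemma norm_le_perp_flat:
  assumes "subspace W" "x \<in> W" "y \<in> perp_flat K W x" shows "norm x \<le> norm y"
  using assms norm_orth_proj_le[of W y] by (auto simp: mem_perp_flat_iff_orth_proj)

lemma perp_flat_hits_cball_iff:
  assumes "subspace W" "x \<in> W" "x \<in> hyp_space K"
  shows "perp_flat K W x \<inter> cball 0 s \<noteq> {} \<longleftrightarrow> norm x \<le> s"
proof
  assume "norm x \<le> s"
  then have "x \<in> perp_flat K W x \<inter> cball 0 s" using assms by (simp add: perp_flat_def)
  then show "perp_flat K W x \<inter> cball 0 s \<noteq> {}" by blast
qed (use norm_le_perp_flat[OF assms(1,2)] in fastforce)

text \<open>At a point \<open>x\<close> of \<open>W\<close>, orthogonality to \<open>W\<close> with respect to the Riemannian metric is the same as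
  Euclidean orthogonality: pairing a tangent vector \<open>v\<close> with \<open>x\<close> itself first gives \<open>x \<bullet> v = 0\<close>,
  and then the second term of the metric vanishes. A flat of complementary
  dimension is then determined by its direction space.\<close>

lemma orthogonal_flat_eq:
  fixes L :: "'a::euclidean_space set"
  assumes K: "K < 0" and W: "subspace W" "dim W + k = DIM('a)" and L: "L = W \<inter> hyp_space K" and x: "x \<in> L"
  shows "orthogonal_flat K k L x = perp_flat K W x"
  unfolding orthogonal_flat_def
proof (rule the_equality)
  have xW: "x \<in> W" and xH: "x \<in> hyp_space K" using x L by auto
  define c where "c = 1 + K * (x \<bullet> x)"
  have c: "0 < c" using xH K by (simp add: c_def mem_hyp_space_iff)
  have "hyp_inner K x (y - x) (z - x) = 0" if "y \<in> perp_flat K W x" "z \<in> L" for y z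
  proof -
    have "(y - x) \<bullet> x = 0" "(y - x) \<bullet> z = 0" using that xW L by (auto simp: perp_flat_def)
    then show ?thesis by (simp add: hyp_inner_def inner_diff_right inner_commute)
  qed
  moreover have "x \<in> perp_flat K W x" using xH by (simp add: perp_flat_def)
  ultimately show "perp_flat K W x \<in> flats K k \<and> x \<in> perp_flat K W x \<and>
      (\<forall>y\<in>perp_flat K W x. \<forall>z\<in>L. hyp_inner K x (y - x) (z - x) = 0)"
    using perp_flat_in_flats[OF W xH] by blast
  fix E assume E: "E \<in> flats K k \<and> x \<in> E \<and> (\<forall>y\<in>E. \<forall>z\<in>L. hyp_inner K x (y - x) (z - x) = 0)"
  then obtain A where A: "affine A" "aff_dim A = int k" "E = A \<inter> hyp_space K"
    by (blast elim: flatsE)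
  have xA: "x \<in> A" using E A by auto
  define U where "U = (\<lambda>y. y - x) ` A"
  have U: "subspace U" unfolding U_def by (rule affine_diffs_subspace_subtract[OF A(1) xA])
  have dU: "dim U = k"
    using A(2) aff_dim_subspace[OF U] aff_dim_translation_eq_subtract[of x A] by (simp add: U_def)
  \<comment> \<open>Small multiples of every vector stay in the open ball, so that the orthogonality condition
    extends by bilinearity from the points of the flats to their direction spaces.\<close>
  have small: "\<exists>t>0. x + t *\<^sub>R v \<in> hyp_space K" for v
  proof -
    obtain e where e: "e > 0" "ball x e \<subseteq> hyp_space K"
      by (rule openE[OF open_hyp_space xH])
    have "x + (e / (2 * (norm v + 1))) *\<^sub>R v \<in> ball x e"
    proof -
      have p: "0 < norm v + 1" by (simp add: add_nonneg_pos)
      have "e / (2 * (norm v + 1)) * norm v \<le> e / (2 * (norm v + 1)) * (norm v + 1)"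
        using e(1) p by (intro mult_left_mono) auto
      also have "\<dots> = e / 2" using p by (simp add: divide_simps)
      also have "\<dots> < e" using e(1) by simp
      finally show ?thesis using e(1) p by (simp add: dist_norm)
    qed
    moreover have "0 < e / (2 * (norm v + 1))" using e(1) by (intro divide_pos_pos) (simp_all add: add_nonneg_pos)
    ultimately show ?thesis using e(2) by blast
  qed
  have form: "(v \<bullet> w) * c = K * (x \<bullet> v) * (x \<bullet> w)" if v: "v \<in> U" and w: "w \<in> W" for v w
  proof -
    obtain s where s: "s > 0" "x + s *\<^sub>R v \<in> hyp_space K" using small by blast
    obtain t where t: "t > 0" "x + t *\<^sub>R w \<in> hyp_space K" using small by blast
    have "s *\<^sub>R v \<in> U" using v U by (simp add: subspace_scale)
    then have "x + s *\<^sub>R v \<in> A" by (auto simp: U_def algebra_simps)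
    then have "x + s *\<^sub>R v \<in> E" using A s by simp
    moreover have "x + t *\<^sub>R w \<in> L" using t w xW W(1) L by (simp add: subspace_add subspace_scale)
    ultimately have "hyp_inner K x (s *\<^sub>R v) (t *\<^sub>R w) = 0" using E by fastforce
    then have "(s * t) * ((v \<bullet> w) / c - K * (x \<bullet> v) * (x \<bullet> w) / c\<^sup>2) = 0"
      unfolding hyp_inner_def c_def[symmetric] by (simp add: algebra_simps)
    then have "(v \<bullet> w) / c = K * (x \<bullet> v) * (x \<bullet> w) / c\<^sup>2" using s t by simp
    then show ?thesis using c by (simp add: field_simps power2_eq_square)
  qed
  have "U \<subseteq> W\<^sup>\<bottom>"
  proof
    fix v assume v: "v \<in> U"
    have "x \<bullet> v = 0"
      using form[OF v xW] by (simp add: c_def algebra_simps inner_commute)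
    then have "v \<bullet> w = 0" if "w \<in> W" for w using form[OF v that] c by simp
    then show "v \<in> W\<^sup>\<bottom>" by (simp add: orthogonal_comp_def orthogonal_def inner_commute)
  qed
  moreover have "dim (W\<^sup>\<bottom>) = dim U" using dim_orthogonal_comp[OF W(1)] W(2) dU by simp
  ultimately have "U = W\<^sup>\<bottom>"
    using subspace_dim_equal[OF U subspace_orthogonal_comp, of W] by simp
  moreover have "A = (+) x ` U" by (auto simp: U_def image_image)
  ultimately show "E = perp_flat K W x" using A(3) by (simp add: perp_flat_eq)
qed

section \<open>Intersections with a random flat through the origin\<close>

lemma ball_eq_UN_cball:
  assumes t: "0 < t"
  shows "ball (0::'a::euclidean_space) t = (\<Union>n. cball 0 ((1 - 1 / real (Suc n)) * t))"
proof -
  have "x \<in> ball 0 t \<longleftrightarrow> x \<in> (\<Union>n. cball (0::'a) ((1 - 1 / real (Suc n)) * t))" for x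
  proof
    assume "x \<in> ball 0 t"
    then have "0 < 1 - norm x / t" using t by simp
    then obtain n where "1 / real (Suc n) < 1 - norm x / t" using nat_approx_posE by blast
    then have "norm x / t \<le> 1 - 1 / real (Suc n)" by simp
    then have "norm x \<le> (1 - 1 / real (Suc n)) * t" using t by (simp add: divide_le_eq)
    then show "x \<in> (\<Union>n. cball (0::'a) ((1 - 1 / real (Suc n)) * t))" by auto
  next
    assume "x \<in> (\<Union>n. cball (0::'a) ((1 - 1 / real (Suc n)) * t))"
    then obtain n where n: "norm x \<le> (1 - 1 / real (Suc n)) * t" by auto
    also have "\<dots> < 1 * t" using t by (intro mult_strict_right_mono) auto
    finally show "x \<in> ball 0 t" by simp
  qed
  then show ?thesis by blast
qed

lemma cball_subset_hyp_space: "K < 0 \<Longrightarrow> s < 1 / sqrt (- K) \<Longrightarrow> cball 0 s \<subseteq> hyp_space K"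
  by (auto simp: hyp_space_def)

lemma origin_flats_closedin: "L \<in> origin_flats K q \<Longrightarrow> closedin (top_of_set (hyp_space K)) L"
  unfolding origin_flats_def by (blast intro: closedin_flat)

lemma sets_missing_flat:
  fixes E :: "'a::euclidean_space set"
  assumes K: "K < 0" and E: "closedin (top_of_set (hyp_space K)) E"
  shows "{V \<in> origin_flats K q. V \<inter> E = {}} \<in> sets (fell_borel K (origin_flats K q))"
proof -
  let ?r = "\<lambda>n. (1 - 1 / real (Suc n)) * (1 / sqrt (- K))"
  define C where "C n = E \<inter> cball 0 (?r n)" for n
  have sub: "cball 0 (?r n) \<subseteq> hyp_space K" for n
    using K by (intro cball_subset_hyp_space) (auto intro: divide_strict_right_mono)
  have "E \<subseteq> hyp_space K" using E closedin_subset by force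
  also have "hyp_space K = (\<Union>n. cball (0::'a) (?r n))"
    unfolding hyp_space_def using K by (intro ball_eq_UN_cball) simp
  finally have "E = (\<Union>n. C n)" unfolding C_def by blast
  then have "{V \<in> origin_flats K q. V \<inter> E = {}} =
      space (fell_borel K (origin_flats K q)) - (\<Union>n. {V \<in> origin_flats K q. V \<inter> C n \<noteq> {}})"
    by auto
  moreover have hit: "{V \<in> origin_flats K q. V \<inter> C n \<noteq> {}} \<in> sets (fell_borel K (origin_flats K q))" for n
    using compact_flat_Int[OF E compact_cball sub, of n] sub[of n]
    by (intro sets_hitting_compact origin_flats_closedin) (auto simp: C_def)
  have "(\<Union>n. {V \<in> origin_flats K q. V \<inter> C n \<noteq> {}}) \<in> sets (fell_borel K (origin_flats K q))"
    using hit by (intro sets.countable_UN) auto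
  ultimately show ?thesis by (simp only: sets.compl_sets)
qed

text \<open>Every flat can be rotated into the hyperplane orthogonal to \<open>x\<close>. There \<open>y \<bullet> x = 0\<close>, whereas
  \<open>y \<bullet> x = \<bar>x\<bar>\<^sup>2\<close> on \<open>perp_flat K W x\<close>, and a small further rotation changes \<open>y \<bullet> x\<close> by less than
  \<open>\<bar>x\<bar>\<^sup>2\<close> on the whole ball.\<close>

lemma prob_missing_flat_pos:
  fixes \<nu> :: "'a::euclidean_space set measure"
  assumes \<nu>: "invariant_origin_flat_prob K q \<nu>" and K: "K < 0" and q: "q < DIM('a)"
    and W: "subspace W" and x: "x \<in> W" "x \<noteq> 0" and E: "perp_flat K W x \<in> flats K k"
  shows "emeasure \<nu> {V \<in> origin_flats K q. V \<inter> perp_flat K W x = {}} > 0"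
proof (rule invariant_origin_flat_prob_positive[OF \<nu> K])
  show "{V \<in> origin_flats K q. V \<inter> perp_flat K W x = {}} \<in> sets \<nu>"
    using sets_missing_flat[OF K closedin_flat[OF E], of q] \<nu> by (simp add: invariant_origin_flat_prob_def)
  fix V :: "'a set" assume V: "V \<in> origin_flats K q"
  then obtain S where S: "subspace S" "dim S = q" "V = S \<inter> hyp_space K" using origin_flats_iff[OF K] by blast
  have "dim (span {x}\<^sup>\<bottom>) + 1 = DIM('a)"
    using dim_orthogonal_comp[OF subspace_span, of "{x}"] x(2) by simp
  then have "q \<le> dim (span {x}\<^sup>\<bottom>)" using q by simp
  then obtain T where T: "subspace T" "T \<subseteq> span (span {x}\<^sup>\<bottom>)" "dim T = q"
    by (rule choose_subspace_of_subspace)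
  obtain \<phi>0 where \<phi>0: "orthogonal_transformation \<phi>0" "\<phi>0 ` S = T"
    using orthogonal_transformation_between_subspaces[OF S(1) T(1)] S(2) T(3) by metis
  have Tx: "t \<bullet> x = 0" if "t \<in> T" for t
  proof -
    have "t \<in> span {x}\<^sup>\<bottom>" using T(2) that span_eq_iff subspace_orthogonal_comp by blast
    then show ?thesis using span_base[of x "{x}"]
      by (auto simp: orthogonal_comp_def orthogonal_def inner_commute)
  qed
  define \<epsilon> where "\<epsilon> = sqrt (- K) * norm x"
  have \<epsilon>: "\<epsilon> > 0" using K x by (simp add: \<epsilon>_def)
  have "\<phi> ` V \<in> {V \<in> origin_flats K q. V \<inter> perp_flat K W x = {}}"
    if \<phi>: "orthogonal_transformation \<phi>" "\<forall>y. norm (\<phi> y - \<phi>0 y) \<le> \<epsilon> * norm y" for \<phi>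
  proof -
    have "\<phi> ` V \<in> origin_flats K q"
      using measurable_space[OF measurable_image_origin_flats[OF \<phi>(1) K, of q]] V by simp
    moreover have False if z: "z \<in> \<phi> ` V" "z \<in> perp_flat K W x" for z
    proof -
      obtain v where v: "v \<in> S" "v \<in> hyp_space K" "z = \<phi> v" using z(1) S(3) by auto
      have "\<phi>0 v \<bullet> x = 0" using Tx \<phi>0(2) v(1) by blast
      then have "(norm x)\<^sup>2 = (\<phi> v - \<phi>0 v) \<bullet> x"
        using z(2) x(1) v(3) by (simp add: perp_flat_def inner_diff_left power2_norm_eq_inner)
      also have "\<dots> \<le> norm (\<phi> v - \<phi>0 v) * norm x" by (rule norm_cauchy_schwarz)
      also have "\<dots> \<le> \<epsilon> * norm v * norm x" using \<phi>(2) by (intro mult_right_mono) auto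
      also have "\<dots> = (sqrt (- K) * norm v) * (norm x)\<^sup>2" by (simp add: \<epsilon>_def power2_eq_square)
      also have "\<dots> < 1 * (norm x)\<^sup>2"
        using v(2) K x(2) by (intro mult_strict_right_mono) (auto simp: hyp_space_def field_simps)
      finally show False by simp
    qed
    ultimately show ?thesis by blast
  qed
  then show "\<exists>(\<phi>0 :: 'a \<Rightarrow> 'a) \<epsilon>. orthogonal_transformation \<phi>0 \<and> \<epsilon> > 0 \<and>
      (\<forall>\<phi> :: 'a \<Rightarrow> 'a. orthogonal_transformation \<phi> \<and> (\<forall>y. norm (\<phi> y - \<phi>0 y) \<le> \<epsilon> * norm y) \<longrightarrow>
        \<phi> ` V \<in> {V \<in> origin_flats K q. V \<inter> perp_flat K W x = {}})"
    using \<phi>0(1) \<epsilon> by (intro exI[of _ \<phi>0] exI[of _ \<epsilon>]) simp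
qed

text \<open>The flats through the origin that meet every \<open>perp_flat K W x\<close>, for small \<open>x \<in> W\<close>, at most twice as
  far from the origin as \<open>x\<close>. Quantifying over all small \<open>x\<close> makes the probability of this event
  depend on \<open>W\<close> only, so that rotation invariance makes it the same for all \<open>W\<close> of the same
  dimension.\<close>

definition transversal_flats :: "real \<Rightarrow> nat \<Rightarrow> 'a::euclidean_space set \<Rightarrow> 'a set set" where
  "transversal_flats K q W = {V \<in> origin_flats K q. \<forall>x\<in>W. norm x \<le> 1 / (3 * sqrt (- K)) \<longrightarrow>
      V \<inter> perp_flat K W x \<inter> cball 0 (2 * norm x) \<noteq> {}}"

text \<open>The complement is a union over all \<open>x\<close> of sets that are open in the Fell topology; it is therefore
  open although the union is uncountable.\<close>

lemma sets_transversal_flats: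
  fixes W :: "'a::euclidean_space set"
  assumes K: "K < 0" and W: "subspace W" "dim W + k = DIM('a)"
  shows "transversal_flats K q W \<in> sets (fell_borel K (origin_flats K q))"
proof -
  let ?X = "{x \<in> W. norm x \<le> 1 / (3 * sqrt (- K))}"
  let ?miss = "\<lambda>x. {V \<in> origin_flats K q. V \<inter> (perp_flat K W x \<inter> cball 0 (2 * norm x)) = {}}"
  have "openin (subtopology (fell_topology K) (origin_flats K q)) (?miss x)" if x: "x \<in> ?X" for x
  proof (rule openin_missing_compact)
    have "norm x < 1 / sqrt (- K)" "2 * norm x < 1 / sqrt (- K)"
      using x K by (auto simp: field_simps intro: le_less_trans[of _ "1 / (3 * sqrt (- K))"])
    then have "x \<in> hyp_space K" and sub: "cball (0::'a) (2 * norm x) \<subseteq> hyp_space K"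
      by (auto simp: hyp_space_def)
    then have "closedin (top_of_set (hyp_space K)) (perp_flat K W x)"
      by (intro closedin_flat[OF perp_flat_in_flats[OF W]])
    then show "compact (perp_flat K W x \<inter> cball 0 (2 * norm x))"
      by (rule compact_flat_Int[OF _ compact_cball sub])
    show "perp_flat K W x \<inter> cball 0 (2 * norm x) \<subseteq> hyp_space K" using sub by auto
  qed (rule origin_flats_closedin)
  then have "openin (subtopology (fell_topology K) (origin_flats K q)) (\<Union>x\<in>?X. ?miss x)"
    by (intro openin_Union) auto
  then have "(\<Union>x\<in>?X. ?miss x) \<in> sets (fell_borel K (origin_flats K q))" by (rule sets_fell_borelI)
  moreover have "transversal_flats K q W = space (fell_borel K (origin_flats K q)) - (\<Union>x\<in>?X. ?miss x)"
    by (auto simp: transversal_flats_def Int_assoc)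
  ultimately show ?thesis by (simp only: sets.compl_sets)
qed

text \<open>Every flat can be rotated by some \<open>\<phi>0\<close> so that it contains \<open>W\<close>; let \<open>S'\<close> be the subspace with
  \<open>\<phi>0 S' = W\<close>. For a nearby rotation \<open>\<phi>\<close> the map \<open>T = orth_proj W \<circ> \<phi>\<close> is close to \<open>\<phi>0\<close> on \<open>S'\<close>; so it
  shrinks norms at most by the factor 2, is injective and, by dimension, maps onto \<open>W\<close>.
  If \<open>T v = x\<close>, then \<open>\<phi> v\<close> is the required point over \<open>x\<close>.\<close>

lemma prob_transversal_flats_pos:
  fixes \<nu> :: "'a::euclidean_space set measure"
  assumes \<nu>: "invariant_origin_flat_prob K q \<nu>" and K: "K < 0" and q: "q \<le> DIM('a)"
    and W: "subspace W" "dim W + k = DIM('a)" and Wq: "dim W \<le> q"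
  shows "emeasure \<nu> (transversal_flats K q W) > 0"
proof (rule invariant_origin_flat_prob_positive[OF \<nu> K])
  show "transversal_flats K q W \<in> sets \<nu>"
    using sets_transversal_flats[OF K W, of q] \<nu> by (simp add: invariant_origin_flat_prob_def)
  fix V :: "'a set" assume V: "V \<in> origin_flats K q"
  then obtain S where S: "subspace S" "dim S = q" "V = S \<inter> hyp_space K" using origin_flats_iff[OF K] by blast
  obtain S' where S': "subspace S'" "S' \<subseteq> span S" "dim S' = dim W"
    using choose_subspace_of_subspace[of "dim W" S] Wq S(2) by auto
  have S'S: "S' \<subseteq> S" using S'(2) S(1) span_eq_iff by blast
  obtain \<phi>0 where \<phi>0: "orthogonal_transformation \<phi>0" "\<phi>0 ` S' = W"
    using orthogonal_transformation_between_subspaces[OF S'(1) W(1)] S'(3) by metis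
  have "\<phi> ` V \<in> transversal_flats K q W"
    if \<phi>: "orthogonal_transformation \<phi>" "\<forall>y. norm (\<phi> y - \<phi>0 y) \<le> 1 / 2 * norm y" for \<phi>
  proof -
    have lin: "linear \<phi>" "linear \<phi>0" using \<phi> \<phi>0 by (auto simp: orthogonal_transformation_def)
    have p: "linear (orth_proj W)" by (rule orth_proj(1)[OF W(1)])
    define T where "T = orth_proj W \<circ> \<phi>"
    have T: "linear T" unfolding T_def by (rule linear_compose[OF lin(1) p])
    have Tn: "norm (T v) \<ge> norm v / 2" if v: "v \<in> S'" for v
    proof -
      have "\<phi>0 v \<in> W" using \<phi>0(2) v by blast
      then have "\<phi>0 v - T v = orth_proj W (\<phi>0 v - \<phi> v)"
        using linear_diff[OF p] by (simp add: T_def orth_proj_id[OF W(1)])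
      then have "norm (\<phi>0 v - T v) \<le> norm (\<phi> v - \<phi>0 v)"
        using norm_orth_proj_le[OF W(1)] by (metis norm_minus_commute)
      also have "\<dots> \<le> norm v / 2" using \<phi>(2) by simp
      finally have "norm (\<phi>0 v) - norm (T v) \<le> norm v / 2" using norm_triangle_ineq2 order_trans by blast
      moreover have "norm (\<phi>0 v) = norm v" using \<phi>0(1) by (rule orthogonal_transformation_norm)
      ultimately show ?thesis by simp
    qed
    have inj: "inj_on T S'"
      using Tn by (subst linear_injective_on_subspace_0[OF T S'(1)]) force
    have "T ` S' \<subseteq> W" using orth_proj(2)[OF W(1)] by (auto simp: T_def)
    moreover have "subspace (T ` S')" using T S'(1) by (rule linear_subspace_image)
    moreover have "dim (T ` S') = dim W"
    proof -
      have sp: "span S' = S'" using S'(1) by (simp only: span_eq_iff)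
      from dim_image_eq[OF T, of S', unfolded sp, OF inj] S'(3) show ?thesis by (simp only:)
    qed
    ultimately have TS: "T ` S' = W" using subspace_dim_equal[OF _ W(1), of "T ` S'"] by simp
    have "V' \<inter> perp_flat K W x \<inter> cball 0 (2 * norm x) \<noteq> {}"
      if V': "V' = \<phi> ` V" and x: "x \<in> W" "norm x \<le> 1 / (3 * sqrt (- K))" for V' x
    proof -
      obtain v where v: "v \<in> S'" "T v = x" using TS x(1) by blast
      have n: "norm (\<phi> v) = norm v" using \<phi>(1) by (rule orthogonal_transformation_norm)
      have v2: "norm v \<le> 2 * norm x" using Tn[OF v(1)] v(2) by simp
      also have "\<dots> \<le> 2 * (1 / (3 * sqrt (- K)))" using x(2) by simp
      also have "\<dots> < 1 / sqrt (- K)" using K by (simp add: field_simps)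
      finally have h: "v \<in> hyp_space K" "\<phi> v \<in> hyp_space K" by (simp_all add: hyp_space_def n)
      then have "\<phi> v \<in> \<phi> ` V" using v(1) S'S S(3) by auto
      moreover have "\<phi> v \<in> perp_flat K W x"
        using h v(2) x(1) by (simp add: mem_perp_flat_iff_orth_proj[OF W(1)] T_def)
      moreover have "\<phi> v \<in> cball 0 (2 * norm x)" using v2 n by simp
      ultimately show ?thesis unfolding V' by blast
    qed
    moreover have "\<phi> ` V \<in> origin_flats K q"
      using measurable_space[OF measurable_image_origin_flats[OF \<phi>(1) K, of q]] V by simp
    ultimately show ?thesis unfolding transversal_flats_def by blast
  qed
  then show "\<exists>(\<phi>0 :: 'a \<Rightarrow> 'a) \<epsilon>. orthogonal_transformation \<phi>0 \<and> \<epsilon> > 0 \<and>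
      (\<forall>\<phi> :: 'a \<Rightarrow> 'a. orthogonal_transformation \<phi> \<and> (\<forall>y. norm (\<phi> y - \<phi>0 y) \<le> \<epsilon> * norm y) \<longrightarrow>
        \<phi> ` V \<in> transversal_flats K q W)"
    using \<phi>0(1) by (intro exI[of _ \<phi>0] exI[of _ "1 / 2"]) simp
qed

lemma perp_flat_image:
  fixes \<psi> :: "'a::euclidean_space \<Rightarrow> 'a"
  assumes \<psi>: "orthogonal_transformation \<psi>"
  shows "perp_flat K (\<psi> ` W) (\<psi> x) = \<psi> ` perp_flat K W x"
proof -
  have lin: "linear \<psi>" and inn: "\<psi> v \<bullet> \<psi> w = v \<bullet> w" for v w
    using \<psi> by (auto simp: orthogonal_transformation_def)
  have mem: "\<psi> y \<in> perp_flat K (\<psi> ` W) (\<psi> x) \<longleftrightarrow> y \<in> perp_flat K W x" for y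
  proof -
    have "\<psi> y \<in> hyp_space K \<longleftrightarrow> y \<in> hyp_space K"
      using orthogonal_transformation_norm[OF \<psi>] by (simp add: hyp_space_def)
    moreover have "(\<psi> y - \<psi> x) \<bullet> \<psi> w = (y - x) \<bullet> w" for w by (simp add: inn flip: linear_diff[OF lin])
    ultimately show ?thesis by (simp add: perp_flat_def)
  qed
  show ?thesis
  proof (intro equalityI subsetI)
    fix z assume z: "z \<in> perp_flat K (\<psi> ` W) (\<psi> x)"
    obtain y where "z = \<psi> y" using orthogonal_transformation_surj[OF \<psi>] by (rule surjE)
    then show "z \<in> \<psi> ` perp_flat K W x" using z mem by simp
  qed (use mem in auto)
qed

lemma prob_transversal_flats_image:
  fixes \<nu> :: "'a::euclidean_space set measure" and \<psi> :: "'a \<Rightarrow> 'a"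
  assumes \<nu>: "invariant_origin_flat_prob K q \<nu>" and K: "K < 0"
    and W: "subspace W" "dim W + k = DIM('a)" and \<psi>: "orthogonal_transformation \<psi>"
  shows "emeasure \<nu> (transversal_flats K q (\<psi> ` W)) = emeasure \<nu> (transversal_flats K q W)"
proof -
  have lin: "linear \<psi>" and inj: "inj \<psi>"
    using \<psi> orthogonal_transformation_linear orthogonal_transformation_inj by auto
  have W': "subspace (\<psi> ` W)" "dim (\<psi> ` W) + k = DIM('a)"
    using W lin inj by (auto simp: linear_subspace_image dim_image_eq inj_on_subset)
  have sets: "sets \<nu> = sets (fell_borel K (origin_flats K q))" and sp: "space \<nu> = origin_flats K q"
    using \<nu> by (auto simp: invariant_origin_flat_prob_def)
  have m: "(`) \<psi> \<in> measurable \<nu> \<nu>"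
    using measurable_image_origin_flats[OF \<psi> K, of q] measurable_cong_sets[OF sets sets] by blast
  have X: "transversal_flats K q (\<psi> ` W) \<in> sets \<nu>" using sets_transversal_flats[OF K W'] sets by simp
  have "distr \<nu> \<nu> ((`) \<psi>) = \<nu>"
    using \<nu> orthogonal_transformation_origin_isometry[OF \<psi>] by (simp add: invariant_origin_flat_prob_def)
  then have "emeasure \<nu> (transversal_flats K q (\<psi> ` W)) =
      emeasure \<nu> ((`) \<psi> -` transversal_flats K q (\<psi> ` W) \<inter> space \<nu>)"
    using emeasure_distr[OF m X] by simp
  also have "(`) \<psi> -` transversal_flats K q (\<psi> ` W) \<inter> space \<nu> = transversal_flats K q W"
  proof -
    have n: "norm (\<psi> x) = norm x" for x using \<psi> by (rule orthogonal_transformation_norm)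
    have "cball 0 r = \<psi> ` cball 0 r" for r
      using image_orthogonal_transformation_cball[OF \<psi>, of 0 r] linear_0[OF lin] by simp
    then have "\<psi> ` V \<inter> perp_flat K (\<psi> ` W) (\<psi> x) \<inter> cball 0 r = \<psi> ` (V \<inter> perp_flat K W x \<inter> cball 0 r)" for V x r
      by (simp add: perp_flat_image[OF \<psi>] image_Int[OF inj])
    then show ?thesis
      using measurable_space[OF m] unfolding sp transversal_flats_def by (auto simp: n)
  qed
  finally show ?thesis .
qed

lemma prob_transversal_flats_bounded_below:
  fixes \<nu> :: "'a::euclidean_space set measure"
  assumes \<nu>: "invariant_origin_flat_prob K q \<nu>" and K: "K < 0" and q: "q \<le> DIM('a)" "m \<le> q"
  obtains p where "p > 0" "\<And>W. subspace W \<Longrightarrow> dim W = m \<Longrightarrow> emeasure \<nu> (transversal_flats K q W) = p"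
proof -
  obtain W\<^sub>0 :: "'a set" where W\<^sub>0: "subspace W\<^sub>0" "dim W\<^sub>0 = m"
    using choose_subspace_of_subspace[of m "UNIV :: 'a set"] q by auto
  define k where "k = DIM('a) - m"
  have k: "dim W\<^sub>0 + k = DIM('a)" using W\<^sub>0 q by (simp add: k_def)
  show thesis
  proof
    show "emeasure \<nu> (transversal_flats K q W\<^sub>0) > 0"
      using W\<^sub>0 q by (intro prob_transversal_flats_pos[OF \<nu> K _ _ k]) auto
    fix W :: "'a set" assume W: "subspace W" "dim W = m"
    obtain \<psi> where "orthogonal_transformation \<psi>" "\<psi> ` W\<^sub>0 = W"
      using orthogonal_transformation_between_subspaces[OF W\<^sub>0(1) W(1)] W W\<^sub>0 by metis
    then show "emeasure \<nu> (transversal_flats K q W) = emeasure \<nu> (transversal_flats K q W\<^sub>0)"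
      using prob_transversal_flats_image[OF \<nu> K W\<^sub>0(1) k] by blast
  qed
qed

section \<open>Lower integrals\<close>

text \<open>The integrals in the definition of the invariant measure are taken over functions whose
  measurability is not known. Such an integral is a lower integral, which is still monotone and
  positively homogeneous.\<close>

lemma nn_integral_cmult_real:
  assumes c: "0 < c"
  shows "(\<integral>\<^sup>+x. ennreal c * f x \<partial>M) = ennreal c * (\<integral>\<^sup>+x. f x \<partial>M)"
proof -
  have le: "ennreal c * (\<integral>\<^sup>+x. f x \<partial>M) \<le> (\<integral>\<^sup>+x. ennreal c * f x \<partial>M)" if "0 < c" for c f
    unfolding nn_integral_def SUP_mult_left_ennreal
  proof (intro SUP_mono bexI)
    fix g assume "g \<in> {g. simple_function M g \<and> g \<le> f}"
    then show "(\<lambda>x. ennreal c * g x) \<in> {g. simple_function M g \<and> g \<le> (\<lambda>x. ennreal c * f x)}"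
      by (auto simp: le_fun_def intro: mult_left_mono)
    show "ennreal c * integral\<^sup>S M g \<le> integral\<^sup>S M (\<lambda>x. ennreal c * g x)"
      using \<open>g \<in> _\<close> by simp
  qed
  have cc: "ennreal (1 / c) * (ennreal c * y) = y" for y
    using c by (simp flip: mult.assoc ennreal_mult)
  have "ennreal (1 / c) * (\<integral>\<^sup>+x. ennreal c * f x \<partial>M) \<le> (\<integral>\<^sup>+x. f x \<partial>M)"
    using le[of "1 / c" "\<lambda>x. ennreal c * f x"] c by (simp add: cc)
  then have "ennreal c * (ennreal (1 / c) * (\<integral>\<^sup>+x. ennreal c * f x \<partial>M)) \<le> ennreal c * (\<integral>\<^sup>+x. f x \<partial>M)"
    by (rule mult_left_mono) simp
  then have "(\<integral>\<^sup>+x. ennreal c * f x \<partial>M) \<le> ennreal c * (\<integral>\<^sup>+x. f x \<partial>M)"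
    using cc[of "\<integral>\<^sup>+x. ennreal c * f x \<partial>M"] by (simp add: mult.left_commute)
  then show ?thesis using le[OF c] by (rule antisym)
qed

section \<open>Scaling of the Hausdorff measure on a flat through the origin\<close>

text \<open>A dilation by \<open>l \<le> 1\<close> changes hyperbolic distances in \<open>cball 0 b\<close> by the factor \<open>l\<close>, up to this
  constant factor; it is the product of the two constants in \<open>hyp_dist_bilipschitz\<close>.\<close>

definition distortion :: "real \<Rightarrow> real \<Rightarrow> real" where
  "distortion K b = 2 / (1 + K * b\<^sup>2) ^ 3"

lemma hyp_dist_scaleR_bounds:
  fixes x y :: "'a::euclidean_space"
  assumes K: "K < 0" and b: "0 < 1 + K * b\<^sup>2" and x: "norm x \<le> b" and y: "norm y \<le> b"
    and l: "0 < l" "l \<le> 1"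
  shows "hyp_dist K (l *\<^sub>R x) (l *\<^sub>R y) \<le> (distortion K b * l) * hyp_dist K x y"
    and "hyp_dist K x y \<le> (distortion K b / l) * hyp_dist K (l *\<^sub>R x) (l *\<^sub>R y)"
proof -
  define c where "c = 1 + K * b\<^sup>2"
  have c: "0 < c" using b by (simp add: c_def)
  have lx: "norm (l *\<^sub>R x) \<le> b" "norm (l *\<^sub>R y) \<le> b"
    using l x y mult_left_le_one_le[of "norm x" l] mult_left_le_one_le[of "norm y" l] by auto
  have n: "norm (l *\<^sub>R x - l *\<^sub>R y) = l * norm (x - y)" using l by (simp flip: scaleR_diff_right)
  have "hyp_dist K (l *\<^sub>R x) (l *\<^sub>R y) \<le> l * norm (x - y) / c"
    using hyp_dist_bilipschitz(1)[OF K b lx] by (simp add: n c_def)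
  also have "\<dots> \<le> l * (2 / c\<^sup>2 * hyp_dist K x y) / c"
    using hyp_dist_bilipschitz(2)[OF K b x y] l c by (intro divide_right_mono mult_left_mono) (auto simp: c_def)
  also have "\<dots> = (distortion K b * l) * hyp_dist K x y"
    by (simp add: distortion_def c_def power2_eq_square power3_eq_cube)
  finally show "hyp_dist K (l *\<^sub>R x) (l *\<^sub>R y) \<le> (distortion K b * l) * hyp_dist K x y" .
  have "hyp_dist K x y \<le> norm (x - y) / c" using hyp_dist_bilipschitz(1)[OF K b x y] by (simp add: c_def)
  also have "\<dots> = (l * norm (x - y)) / (l * c)" using l by simp
  also have "\<dots> \<le> (2 / c\<^sup>2 * hyp_dist K (l *\<^sub>R x) (l *\<^sub>R y)) / (l * c)"
    using hyp_dist_bilipschitz(2)[OF K b lx] l c by (intro divide_right_mono) (auto simp: n c_def)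
  also have "\<dots> = (distortion K b / l) * hyp_dist K (l *\<^sub>R x) (l *\<^sub>R y)"
    by (simp add: distortion_def c_def power2_eq_square power3_eq_cube)
  finally show "hyp_dist K x y \<le> (distortion K b / l) * hyp_dist K (l *\<^sub>R x) (l *\<^sub>R y)" .
qed

lemma sets_hausdorff_on: "sets (hausdorff_on K n L) = sets (restrict_space borel L)"
  and space_hausdorff_on: "space (hausdorff_on K n L) = L"
proof -
  have "sigma_algebra L (sets (restrict_space borel L))"
    using sets.sigma_algebra_axioms[of "restrict_space borel L"] by (simp add: space_restrict_space)
  then show "sets (hausdorff_on K n L) = sets (restrict_space borel L)" "space (hausdorff_on K n L) = L"
    unfolding hausdorff_on_def by (simp_all add: sigma_algebra.sets_measure_of_eq space_measure_of_conv)
qed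

text \<open>By the convention for \<^const>\<open>measure_of\<close>, the measure is identically zero if the outer measure
  is not countably additive on the Borel sets. Both alternatives are compatible with all
  estimates below, since these compare the measures of two sets.\<close>

lemma emeasure_hausdorff_on:
  "(\<forall>A\<in>sets (hausdorff_on K n L). emeasure (hausdorff_on K n L) A = hausdorff_outer K n A) \<or>
   (\<forall>A. emeasure (hausdorff_on K n L) A = 0)"
proof -
  have "sets (restrict_space borel L) \<subseteq> Pow L"
    using sets.space_closed[of "restrict_space borel L"] by (simp add: space_restrict_space)
  then show ?thesis unfolding hausdorff_on_def emeasure_measure_of_conv sets_measure_of_conv by auto
qed

lemma emeasure_hausdorff_on_image_le:
  assumes C: "0 < C" and A: "A \<in> sets (hausdorff_on K n L)" "f ` A \<in> sets (hausdorff_on K n L)"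
    and L: "L \<subseteq> hyp_space K"
    and lip: "\<And>x y. x \<in> A \<Longrightarrow> y \<in> A \<Longrightarrow> hyp_dist K (f x) (f y) \<le> C * hyp_dist K x y"
  shows "emeasure (hausdorff_on K n L) (f ` A) \<le> ennreal (C ^ n) * emeasure (hausdorff_on K n L) A"
proof -
  have "f ` A \<subseteq> hyp_space K" using sets.sets_into_space[OF A(2)] L by (auto simp: space_hausdorff_on)
  then have "hausdorff_outer K n (f ` A) \<le> ennreal (C ^ n) * hausdorff_outer K n A"
    using C lip by (intro hausdorff_outer_image_le) auto
  then show ?thesis using emeasure_hausdorff_on[of K n L] A by auto
qed

lemma sets_hausdorff_on_scaleR:
  fixes L :: "'a::euclidean_space set"
  assumes W: "subspace W" and L: "L = W \<inter> hyp_space K" and l: "0 < l" "l \<le> 1"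
    and A: "A \<in> sets (hausdorff_on K n L)"
  shows "(*\<^sub>R) l ` A \<in> sets (hausdorff_on K n L)"
proof -
  have Lb: "L \<in> sets borel" unfolding L hyp_space_def
    by (intro sets.Int borel_closed closed_subspace[OF W] borel_open open_ball)
  then have "A \<in> sets borel" and AL: "A \<subseteq> L"
    using A by (auto simp: sets_hausdorff_on sets_restrict_space)
  have "(*\<^sub>R) l ` A = (\<lambda>x. x /\<^sub>R l) -` A"
    using l by (auto simp: image_iff) (metis scaleR_one scaleR_scaleR right_inverse less_irrefl)
  also have "\<dots> \<in> sets borel"
    using measurable_sets[of "\<lambda>x. x /\<^sub>R l" borel borel A] \<open>A \<in> sets borel\<close> by simp
  finally have "(*\<^sub>R) l ` A \<in> sets borel" .
  moreover have "(*\<^sub>R) l ` A \<subseteq> L"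
  proof -
    have "l * norm x < 1 / sqrt (- K)" if "norm x < 1 / sqrt (- K)" for x :: 'a
      using mult_left_le_one_le[of "norm x" l] l that by simp
    then show ?thesis using AL W l unfolding L by (auto simp: hyp_space_def subspace_scale)
  qed
  ultimately show ?thesis using Lb by (simp add: sets_hausdorff_on sets_restrict_space_iff)
qed

lemma emeasure_hausdorff_on_scaleR:
  fixes L :: "'a::euclidean_space set"
  assumes K: "K < 0" and b: "0 < 1 + K * b\<^sup>2" and W: "subspace W" and L: "L = W \<inter> hyp_space K"
    and l: "0 < l" "l \<le> 1" and A: "A \<in> sets (hausdorff_on K n L)" "A \<subseteq> cball 0 b"
  shows "emeasure (hausdorff_on K n L) ((*\<^sub>R) l ` A) \<le>
      ennreal ((distortion K b * l) ^ n) * emeasure (hausdorff_on K n L) A"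
    and "emeasure (hausdorff_on K n L) A \<le>
      ennreal ((distortion K b / l) ^ n) * emeasure (hausdorff_on K n L) ((*\<^sub>R) l ` A)"
proof -
  have d: "0 < distortion K b" using b by (simp add: distortion_def)
  have lA: "(*\<^sub>R) l ` A \<in> sets (hausdorff_on K n L)" by (rule sets_hausdorff_on_scaleR[OF W L l A(1)])
  have LH: "L \<subseteq> hyp_space K" using L by auto
  show "emeasure (hausdorff_on K n L) ((*\<^sub>R) l ` A) \<le>
      ennreal ((distortion K b * l) ^ n) * emeasure (hausdorff_on K n L) A"
    using A l d by (intro emeasure_hausdorff_on_image_le lA LH hyp_dist_scaleR_bounds(1) K b) auto
  have inv: "(*\<^sub>R) (1 / l) ` (*\<^sub>R) l ` A = A" using l by (simp add: image_image)
  have "emeasure (hausdorff_on K n L) ((*\<^sub>R) (1 / l) ` (*\<^sub>R) l ` A) \<le>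
      ennreal ((distortion K b / l) ^ n) * emeasure (hausdorff_on K n L) ((*\<^sub>R) l ` A)"
  proof (rule emeasure_hausdorff_on_image_le[OF _ lA _ LH])
    show "(*\<^sub>R) (1 / l) ` (*\<^sub>R) l ` A \<in> sets (hausdorff_on K n L)" using A by (simp only: inv)
    fix x y assume "x \<in> (*\<^sub>R) l ` A" "y \<in> (*\<^sub>R) l ` A"
    then obtain x' y' where xy: "x = l *\<^sub>R x'" "y = l *\<^sub>R y'" "x' \<in> A" "y' \<in> A" by auto
    then have "norm x' \<le> b" "norm y' \<le> b" using A(2) by auto
    from hyp_dist_scaleR_bounds(2)[OF K b this l]
    show "hyp_dist K ((1 / l) *\<^sub>R x) ((1 / l) *\<^sub>R y) \<le> distortion K b / l * hyp_dist K x y"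
      using xy l by simp
  qed (use d l in auto)
  then show "emeasure (hausdorff_on K n L) A \<le>
      ennreal ((distortion K b / l) ^ n) * emeasure (hausdorff_on K n L) ((*\<^sub>R) l ` A)"
    by (simp only: inv)
qed

lemma sets_hausdorff_on_cball:
  fixes L :: "'a::euclidean_space set"
  assumes W: "subspace W" and L: "L = W \<inter> hyp_space K"
  shows "L \<inter> cball 0 s \<in> sets (hausdorff_on K n L)"
  by (auto simp: sets_hausdorff_on sets_restrict_space)

lemma scaleR_image_flat_cball:
  fixes L :: "'a::euclidean_space set"
  assumes W: "subspace W" and L: "L = W \<inter> hyp_space K" and t: "0 < s" "0 < t"
    and H: "cball 0 s \<subseteq> (hyp_space K :: 'a set)" "cball 0 t \<subseteq> (hyp_space K :: 'a set)"
  shows "(*\<^sub>R) (s / t) ` (L \<inter> cball 0 t) = L \<inter> cball 0 s"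
proof -
  have sub: "(*\<^sub>R) (s / t) ` (L \<inter> cball 0 t) \<subseteq> L \<inter> cball 0 s"
    if st: "0 < s" "0 < t" and sH: "cball 0 s \<subseteq> (hyp_space K :: 'a set)" for s t
  proof
    fix x assume "x \<in> (*\<^sub>R) (s / t) ` (L \<inter> cball 0 t)"
    then obtain y where "x = (s / t) *\<^sub>R y" "y \<in> L \<inter> cball 0 t" by (rule imageE)
    then have y: "x = (s / t) *\<^sub>R y" "y \<in> L" "norm y \<le> t" by auto
    then have "x \<in> W" using W L by (simp add: subspace_scale)
    moreover have "norm x \<le> s" using y st mult_left_mono[of "norm y" t "s / t"] by auto
    ultimately show "x \<in> L \<inter> cball 0 s" using sH L by auto
  qed
  show ?thesis
  proof
    show "L \<inter> cball 0 s \<subseteq> (*\<^sub>R) (s / t) ` (L \<inter> cball 0 t)"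
    proof
      fix x assume "x \<in> L \<inter> cball 0 s"
      then have "(t / s) *\<^sub>R x \<in> L \<inter> cball 0 t" using sub[OF t(2,1) H(2)] by blast
      then show "x \<in> (*\<^sub>R) (s / t) ` (L \<inter> cball 0 t)"
        using t by (intro image_eqI[of _ _ "(t / s) *\<^sub>R x"]) auto
    qed
  qed (rule sub[OF t H(1)])
qed

lemma emeasure_hausdorff_on_cball_le:
  fixes L :: "'a::euclidean_space set"
  assumes K: "K < 0" and b: "0 < 1 + K * b\<^sup>2" and W: "subspace W" and L: "L = W \<inter> hyp_space K"
    and s: "0 < s" "s \<le> b" and t: "0 < t" "t \<le> b"
  shows "emeasure (hausdorff_on K n L) (L \<inter> cball 0 s) \<le>
      ennreal ((distortion K b * (s / t)) ^ n) * emeasure (hausdorff_on K n L) (L \<inter> cball 0 t)"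
proof -
  have H: "cball 0 r \<subseteq> (hyp_space K :: 'a set)" if "r \<le> b" for r
    using cball_subset_hyp_space_if[OF K b] subset_cball[OF that] by blast
  have sub: "L \<inter> cball 0 r \<subseteq> cball 0 b" if "r \<le> b" for r using that by auto
  note scale = emeasure_hausdorff_on_scaleR[OF K b W L _ _ sets_hausdorff_on_cball[OF W L] sub, of _ _ n]
  show ?thesis
  proof (cases "s \<le> t")
    case True
    then show ?thesis
      using scale(1)[of "s / t" t] s t
      by (simp add: scaleR_image_flat_cball[OF W L s(1) t(1) H[OF s(2)] H[OF t(2)]])
  next
    case False
    then show ?thesis
      using scale(2)[of "t / s" s] s t
      by (simp add: scaleR_image_flat_cball[OF W L t(1) s(1) H[OF t(2)] H[OF s(2)]])
  qed
qed

section \<open>The shadow of a flat\<close>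

text \<open>The points \<open>x \<in> W\<close> over which \<open>S\<close> has a point at distance less than \<open>t\<close> from the origin. The
  infimum of all such \<open>t\<close> is the Euclidean distance from the origin of the part of \<open>S\<close> over \<open>x\<close>.\<close>

definition shadow :: "'a::euclidean_space set \<Rightarrow> 'a set \<Rightarrow> real \<Rightarrow> 'a set" where
  "shadow W S t = orth_proj W ` (S \<inter> ball 0 t)"

lemma shadow_mono: "s \<le> t \<Longrightarrow> shadow W S s \<subseteq> shadow W S t"
  by (auto simp: shadow_def)

lemma shadow_scaleR_iff:
  assumes W: "subspace W" and S: "subspace S" and l: "0 < l"
  shows "l *\<^sub>R x \<in> shadow W S (l * t) \<longleftrightarrow> x \<in> shadow W S t"
proof -
  have p: "linear (orth_proj W)" by (rule orth_proj(1)[OF W])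
  have up: "l *\<^sub>R x \<in> shadow W S (l * t)" if x: "x \<in> shadow W S t" and l: "0 < l" for l x t
  proof -
    obtain y where y: "y \<in> S" "norm y < t" "x = orth_proj W y" using x by (auto simp: shadow_def)
    then have "l *\<^sub>R y \<in> S \<inter> ball 0 (l * t)" using l S by (simp add: subspace_scale)
    moreover have "l *\<^sub>R x = orth_proj W (l *\<^sub>R y)" using y linear_cmul[OF p] by simp
    ultimately show ?thesis unfolding shadow_def by blast
  qed
  show ?thesis
  proof
    assume "l *\<^sub>R x \<in> shadow W S (l * t)"
    from up[OF this, of "1 / l"] show "x \<in> shadow W S t" using l by simp
  qed (rule up[OF _ l])
qed

lemma borel_shadow:
  assumes W: "subspace W" and S: "subspace S" and t: "0 < t"
  shows "shadow W S t \<in> sets borel"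
proof -
  have "shadow W S t = (\<Union>n. orth_proj W ` (S \<inter> cball 0 ((1 - 1 / real (Suc n)) * t)))"
    unfolding shadow_def ball_eq_UN_cball[OF t] by blast
  moreover have "orth_proj W ` (S \<inter> cball 0 r) \<in> sets borel" for r
  proof -
    have "compact (S \<inter> cball 0 r)" using closed_subspace[OF S] by (intro closed_Int_compact compact_cball)
    moreover have "continuous_on (S \<inter> cball 0 r) (orth_proj W)"
      using orth_proj(1)[OF W] by (simp add: linear_continuous_on linear_conv_bounded_linear)
    ultimately show ?thesis by (intro borel_compact compact_continuous_image)
  qed
  ultimately show ?thesis by auto
qed

lemma perp_flat_meets_iff_shadow:
  fixes x :: "'a::euclidean_space"
  assumes W: "subspace W" "x \<in> W" and t: "t \<le> 1 / sqrt (- K)"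
  shows "perp_flat K W x \<inter> (S \<inter> hyp_space K) \<inter> ball 0 t \<noteq> {} \<longleftrightarrow> x \<in> shadow W S t"
proof -
  have eq: "perp_flat K W x \<inter> (S \<inter> hyp_space K) \<inter> ball 0 t = {y \<in> S \<inter> ball 0 t. orth_proj W y = x}"
  proof (intro set_eqI)
    fix y :: 'a
    have "norm y < t \<Longrightarrow> y \<in> hyp_space K" using t by (simp add: hyp_space_def)
    then show "y \<in> perp_flat K W x \<inter> (S \<inter> hyp_space K) \<inter> ball 0 t \<longleftrightarrow> y \<in> {y \<in> S \<inter> ball 0 t. orth_proj W y = x}"
      unfolding Int_iff mem_perp_flat_iff_orth_proj[OF W] by auto
  qed
  show ?thesis unfolding eq shadow_def by blast
qed

text \<open>The points \<open>x\<close> for which the part of \<open>S\<close> over \<open>x\<close> has its distance from the origin in the shell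
  between \<open>(1 - e) t\<close> and \<open>t\<close>, with \<open>e = 1 / (2 J)\<close>. The dilations by \<open>1 - j e\<close> for \<open>j < J\<close> carry this
  set to disjoint sets, because \<open>1 - (j + 1) e \<le> (1 - j e) (1 - e)\<close>. All factors are at least
  \<open>1 / 2\<close>, so each copy carries at least a fixed proportion of the measure of the original.\<close>

lemma emeasure_shadow_shell:
  fixes W :: "'a::euclidean_space set"
  assumes K: "K < 0" and b: "0 < 1 + K * b\<^sup>2" and W: "subspace W" and L: "L = W \<inter> hyp_space K"
    and S: "subspace S" and J: "J > 0" and t: "t > 0"
    and A: "A = L \<inter> cball 0 b \<inter> shadow W S t - shadow W S ((1 - 1 / (2 * real J)) * t)"
  shows "A \<in> sets (hausdorff_on K n L)"
    and "emeasure (hausdorff_on K n L) A * ennreal (real J) \<le>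
      ennreal ((2 * distortion K b) ^ n) * emeasure (hausdorff_on K n L) (L \<inter> cball 0 b)"
proof -
  let ?H = "hausdorff_on K n L"
  define e where "e = 1 / (2 * real J)"
  have e: "0 < e" "e \<le> 1 / 2" using J by (auto simp: e_def field_simps)
  define l where "l j = 1 - real j * e" for j
  have l: "1 / 2 \<le> l j" "l j \<le> 1" if "j < J" for j
  proof -
    have "real j * e \<le> real J * e" using that e by (intro mult_right_mono) auto
    also have "\<dots> = 1 / 2" using J by (simp add: e_def)
    finally show "1 / 2 \<le> l j" by (simp add: l_def)
  qed (use e in \<open>simp add: l_def\<close>)
  have d: "0 < distortion K b" using b by (simp add: distortion_def)
  have Lb: "L \<in> sets borel" unfolding L hyp_space_def
    by (intro sets.Int borel_closed closed_subspace[OF W] borel_open open_ball)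
  have "A \<in> sets borel" unfolding A using J t
    by (intro sets.Diff sets.Int Lb borel_closed closed_cball borel_shadow[OF W S]) (auto simp: field_simps)
  then show As: "A \<in> sets ?H" using Lb A by (auto simp: sets_hausdorff_on sets_restrict_space_iff)
  have Ab: "A \<subseteq> cball 0 b" using A by auto
  have lAs: "(*\<^sub>R) (l j) ` A \<in> sets ?H" if "j < J" for j
    using l[OF that] by (intro sets_hausdorff_on_scaleR[OF W L _ _ As]) auto
  have disj: "disjoint_family_on (\<lambda>j. (*\<^sub>R) (l j) ` A) {..<J}"
  proof -
    have no: False if ij: "i < j" "j < J" and x: "x \<in> (*\<^sub>R) (l i) ` A" "x \<in> (*\<^sub>R) (l j) ` A" for i j x
    proof -
      have li: "0 < l i" "0 < l j" using l[of i] l[of j] ij by auto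
      obtain y where y: "y \<in> A" "x = l i *\<^sub>R y" using x by auto
      obtain z where z: "z \<in> A" "x = l j *\<^sub>R z" using x by auto
      have "l j * t \<le> l i * ((1 - e) * t)"
      proof -
        have "l j \<le> l i - e"
        proof -
          have "(real i + 1) * e \<le> real j * e" using ij e by (intro mult_right_mono) auto
          then show ?thesis by (simp add: l_def algebra_simps)
        qed
        also have "\<dots> \<le> l i - l i * e" using l[of i] ij e by (simp add: mult_left_le_one_le)
        finally have "l j \<le> l i * (1 - e)" by (simp add: algebra_simps)
        then show ?thesis using t by (simp flip: mult.assoc)
      qed
      moreover have "x \<in> shadow W S (l j * t)"
        using z shadow_scaleR_iff[OF W S li(2)] A by auto
      ultimately have "x \<in> shadow W S (l i * ((1 - e) * t))" using shadow_mono by blast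
      then have "y \<in> shadow W S ((1 - e) * t)" unfolding y(2) using shadow_scaleR_iff[OF W S li(1)] by blast
      then show False using y(1) A by (simp add: e_def)
    qed
    show ?thesis unfolding disjoint_family_on_def
    proof (intro ballI impI equals0I)
      fix i j x assume "i \<in> {..<J}" "j \<in> {..<J}" "i \<noteq> j" "x \<in> (*\<^sub>R) (l i) ` A \<inter> (*\<^sub>R) (l j) ` A"
      then show False using no[of i j x] no[of j i x] by (cases "i < j") auto
    qed
  qed
  have sub: "(*\<^sub>R) (l j) ` A \<subseteq> L \<inter> cball 0 b" if j: "j < J" for j
  proof
    fix x assume x: "x \<in> (*\<^sub>R) (l j) ` A"
    then obtain y where y: "y \<in> A" "x = l j *\<^sub>R y" by auto
    then have "norm x \<le> norm y" using l[OF j] by (simp add: mult_left_le_one_le)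
    then have "x \<in> cball 0 b" using y(1) A by auto
    moreover have "x \<in> L" using x sets.sets_into_space[OF lAs[OF j]] by (auto simp: space_hausdorff_on)
    ultimately show "x \<in> L \<inter> cball 0 b" by simp
  qed
  have one: "emeasure ?H A \<le> ennreal ((2 * distortion K b) ^ n) * emeasure ?H ((*\<^sub>R) (l j) ` A)" if j: "j < J" for j
  proof -
    have "emeasure ?H A \<le> ennreal ((distortion K b / l j) ^ n) * emeasure ?H ((*\<^sub>R) (l j) ` A)"
      using l[OF j] by (intro emeasure_hausdorff_on_scaleR(2)[OF K b W L _ _ As Ab]) auto
    also have "\<dots> \<le> ennreal ((2 * distortion K b) ^ n) * emeasure ?H ((*\<^sub>R) (l j) ` A)"
    proof (intro mult_right_mono ennreal_leI power_mono)
      have "distortion K b / l j \<le> distortion K b / (1 / 2)" using l[OF j] d by (intro divide_left_mono) auto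
      then show "distortion K b / l j \<le> 2 * distortion K b" by simp
      show "0 \<le> distortion K b / l j" using l[OF j] d by (intro divide_nonneg_pos) auto
    qed simp
    finally show ?thesis .
  qed
  have "emeasure ?H A * ennreal (real J) = (\<Sum>j<J. emeasure ?H A)"
    by (simp add: mult.commute ennreal_of_nat_eq_real_of_nat)
  also have "\<dots> \<le> (\<Sum>j<J. ennreal ((2 * distortion K b) ^ n) * emeasure ?H ((*\<^sub>R) (l j) ` A))"
    using one by (intro sum_mono) auto
  also have "\<dots> = ennreal ((2 * distortion K b) ^ n) * emeasure ?H (\<Union>j<J. (*\<^sub>R) (l j) ` A)"
    using lAs disj by (subst sum_emeasure[symmetric]) (auto simp: sum_distrib_left)
  also have "\<dots> \<le> ennreal ((2 * distortion K b) ^ n) * emeasure ?H (L \<inter> cball 0 b)"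
    using sub by (intro mult_left_mono emeasure_mono sets_hausdorff_on_cball[OF W L]) auto
  finally show "emeasure ?H A * ennreal (real J) \<le>
      ennreal ((2 * distortion K b) ^ n) * emeasure ?H (L \<inter> cball 0 b)" .
qed

section \<open>The invariant measure on flats\<close>

text \<open>The inner integral in the definition of the invariant measure: the contribution of the flats
  orthogonal to \<open>L\<close>.\<close>

definition fibre_mass :: "real \<Rightarrow> nat \<Rightarrow> nat \<Rightarrow> 'a::euclidean_space set \<Rightarrow> 'a set set \<Rightarrow> ennreal" where
  "fibre_mass K k n L X =
    (\<integral>\<^sup>+x. indicator X (orthogonal_flat K k L x) * ennreal (cosh (sqrt (- K) * hyp_dist K x 0) ^ k)
      \<partial>hausdorff_on K n L)"

text \<open>A non-zero value excludes the default case of \<^const>\<open>measure_of\<close>, so that the defining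
  function is countably additive.\<close>

lemma emeasure_flat_measure:
  fixes X :: "'a::euclidean_space set set"
  assumes nz: "emeasure (flat_measure K k \<nu>) X\<^sub>0 \<noteq> 0" and n: "n + k = DIM('a)"
    and X: "X \<in> sets (fell_borel K (flats K k))"
  shows "emeasure (flat_measure K k \<nu>) X = (\<integral>\<^sup>+L. fibre_mass K k n L X \<partial>\<nu>)"
proof -
  have sig: "sigma_sets (flats K k) (sets (fell_borel K (flats K k))) = sets (fell_borel K (flats K k))"
    using sets.sigma_sets_eq[of "fell_borel K (flats K k)"] by simp
  have n': "DIM('a) - k = n" using n by simp
  show ?thesis
    using nz X unfolding flat_measure_def fibre_mass_def emeasure_measure_of_conv sig n' by (auto split: if_splits)
qed

lemma
  fixes \<nu> :: "'a::euclidean_space set measure"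
  shows sets_flat_measure [simp]: "sets (flat_measure K k \<nu>) = sets (fell_borel K (flats K k))"
    and space_flat_measure [simp]: "space (flat_measure K k \<nu>) = flats K k"
proof -
  have "sets (fell_borel K (flats K k)) \<subseteq> Pow (flats K k :: 'a set set)"
    using sets.space_closed[of "fell_borel K (flats K k :: 'a set set)"] by simp
  then show "sets (flat_measure K k \<nu>) = sets (fell_borel K (flats K k))"
    unfolding flat_measure_def using sets.sigma_sets_eq[of "fell_borel K (flats K k :: 'a set set)"] by simp
  show "space (flat_measure K k \<nu>) = flats K k" by (simp add: flat_measure_def space_measure_of_conv)
qed

lemma cosh_hyp_dist_bounds:
  assumes K: "K < 0" and x: "x \<in> hyp_cball K u"
  shows "1 \<le> cosh (sqrt (- K) * hyp_dist K x 0) ^ k"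
    and "cosh (sqrt (- K) * hyp_dist K x 0) ^ k \<le> cosh (sqrt (- K) * u) ^ k"
proof -
  have xH: "x \<in> hyp_space K" and d: "hyp_dist K x 0 \<le> u" using x by (auto simp: hyp_cball_def)
  have "0 \<le> hyp_dist K x 0"
    using norm_le_hyp_dist_0[OF K xH] norm_ge_zero[of x] hyp_dist_0[OF K xH] by linarith
  then have "cosh (sqrt (- K) * hyp_dist K x 0) \<le> cosh (sqrt (- K) * u)"
    using d K by (subst cosh_real_nonneg_le_iff) (auto intro: mult_left_mono)
  then show "cosh (sqrt (- K) * hyp_dist K x 0) ^ k \<le> cosh (sqrt (- K) * u) ^ k"
    by (intro power_mono) auto
  show "1 \<le> cosh (sqrt (- K) * hyp_dist K x 0) ^ k" by (simp add: cosh_real_ge_1)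
qed

lemma flat_measure_le:
  fixes \<nu> :: "'a::euclidean_space set measure"
  assumes nz: "emeasure (flat_measure K k \<nu>) X\<^sub>0 \<noteq> 0" and n: "n + k = DIM('a)" and c: "0 < c"
    and X: "X \<in> sets (fell_borel K (flats K k))" and Y: "Y \<in> sets (fell_borel K (flats K k))"
    and le: "\<And>L. L \<in> space \<nu> \<Longrightarrow> fibre_mass K k n L X \<le> ennreal c * fibre_mass K k n L Y"
  shows "emeasure (flat_measure K k \<nu>) X \<le> ennreal c * emeasure (flat_measure K k \<nu>) Y"
proof -
  have "emeasure (flat_measure K k \<nu>) X = (\<integral>\<^sup>+L. fibre_mass K k n L X \<partial>\<nu>)"
    by (rule emeasure_flat_measure[OF nz n X])
  also have "\<dots> \<le> (\<integral>\<^sup>+L. ennreal c * fibre_mass K k n L Y \<partial>\<nu>)" by (rule nn_integral_mono) (rule le)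
  also have "\<dots> = ennreal c * (\<integral>\<^sup>+L. fibre_mass K k n L Y \<partial>\<nu>)" by (rule nn_integral_cmult_real[OF c])
  also have "(\<integral>\<^sup>+L. fibre_mass K k n L Y \<partial>\<nu>) = emeasure (flat_measure K k \<nu>) Y"
    by (rule emeasure_flat_measure[OF nz n Y, symmetric])
  finally show ?thesis .
qed

lemma fibre_mass_le:
  assumes K: "K < 0" and A: "A \<in> sets (hausdorff_on K n L)" "A \<subseteq> hyp_cball K u"
    and X: "\<And>x. x \<in> L \<Longrightarrow> orthogonal_flat K k L x \<in> X \<Longrightarrow> x \<in> A"
  shows "fibre_mass K k n L X \<le> ennreal (cosh (sqrt (- K) * u) ^ k) * emeasure (hausdorff_on K n L) A"
proof -
  have "fibre_mass K k n L X \<le> (\<integral>\<^sup>+x. ennreal (cosh (sqrt (- K) * u) ^ k) * indicator A x \<partial>hausdorff_on K n L)"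
    unfolding fibre_mass_def
  proof (rule nn_integral_mono)
    fix x assume "x \<in> space (hausdorff_on K n L)"
    then have x: "x \<in> L" by (simp add: space_hausdorff_on)
    show "indicator X (orthogonal_flat K k L x) * ennreal (cosh (sqrt (- K) * hyp_dist K x 0) ^ k)
      \<le> ennreal (cosh (sqrt (- K) * u) ^ k) * indicator A x"
      using X[OF x] cosh_hyp_dist_bounds(2)[OF K, of x u k] A(2)
      by (cases "orthogonal_flat K k L x \<in> X") (auto intro!: ennreal_leI)
  qed
  also have "\<dots> = ennreal (cosh (sqrt (- K) * u) ^ k) * emeasure (hausdorff_on K n L) A"
    using A by (simp add: nn_integral_cmult_indicator)
  finally show ?thesis .
qed

lemma fibre_mass_ge:
  assumes K: "K < 0" and A: "A \<in> sets (hausdorff_on K n L)" "A \<subseteq> hyp_cball K u"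
    and X: "\<And>x. x \<in> A \<Longrightarrow> orthogonal_flat K k L x \<in> X"
  shows "emeasure (hausdorff_on K n L) A \<le> fibre_mass K k n L X"
proof -
  have "emeasure (hausdorff_on K n L) A = (\<integral>\<^sup>+x. indicator A x \<partial>hausdorff_on K n L)"
    using A by simp
  also have "\<dots> \<le> fibre_mass K k n L X"
    unfolding fibre_mass_def
  proof (rule nn_integral_mono)
    fix x
    show "indicator A x \<le> indicator X (orthogonal_flat K k L x) * ennreal (cosh (sqrt (- K) * hyp_dist K x 0) ^ k)"
    proof (cases "x \<in> A")
      case True
      then have "ennreal 1 \<le> ennreal (cosh (sqrt (- K) * hyp_dist K x 0) ^ k)"
        using cosh_hyp_dist_bounds(1)[OF K, of x u k] A(2) by (intro ennreal_leI) auto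
      then show ?thesis using True X[OF True] by simp
    qed simp
  qed
  finally show ?thesis .
qed

definition hitting_flats :: "real \<Rightarrow> nat \<Rightarrow> real \<Rightarrow> 'a::euclidean_space set set" where
  "hitting_flats K k s = {E \<in> flats K k. E \<inter> cball 0 s \<noteq> {}}"

lemma hitting_flats_mono: "s \<le> t \<Longrightarrow> hitting_flats K k s \<subseteq> hitting_flats K k t"
  by (fastforce simp: hitting_flats_def)

lemma hitting_flats_Int: "s \<le> t \<Longrightarrow> hitting_flats K k t \<inter> hitting_flats K k s = hitting_flats K k s"
  using hitting_flats_mono by blast

lemma sets_hitting_flats:
  "K < 0 \<Longrightarrow> s < 1 / sqrt (- K) \<Longrightarrow> hitting_flats K k s \<in> sets (fell_borel K (flats K k))"
  unfolding hitting_flats_def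
  by (intro sets_hitting_compact closedin_flat compact_cball cball_subset_hyp_space)

lemma flats_hitting_ball_eq:
  "K < 0 \<Longrightarrow> flats_hitting_ball K k u = hitting_flats K k (tanh (sqrt (- K) * u) / sqrt (- K))"
  by (simp add: flats_hitting_ball_def hitting_flats_def hyp_cball_eq)

lemma klein_radius_bounds:
  assumes K: "K < 0" and u: "0 < u" and b_def: "b = tanh (sqrt (- K) * u) / sqrt (- K)"
  shows "0 < b" "b < 1 / sqrt (- K)" "0 < 1 + K * b\<^sup>2"
proof -
  have t: "0 < tanh (sqrt (- K) * u)" "tanh (sqrt (- K) * u) < 1"
    using K u tanh_real_lt_1 by auto
  then show "0 < b" "b < 1 / sqrt (- K)"
    unfolding b_def using K by (auto intro: divide_strict_right_mono)
  have "(tanh (sqrt (- K) * u))\<^sup>2 < 1\<^sup>2" using t by (intro power_strict_mono) auto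
  then show "0 < 1 + K * b\<^sup>2" unfolding b_def using K by (simp add: power_divide)
qed

context
  fixes K u b :: real and k m :: nat and \<nu> :: "'a::euclidean_space set measure"
  assumes K: "K < 0" and u: "0 < u" and b_def: "b = tanh (sqrt (- K) * u) / sqrt (- K)"
    and m: "m + k = DIM('a)" and \<nu>: "space \<nu> = origin_flats K m"
    and nz: "emeasure (flat_measure K k \<nu>) (hitting_flats K k b) \<noteq> 0"
begin

lemmas b_bounds = klein_radius_bounds[OF K u b_def]

lemma cball_subset_hyp_cball: "s \<le> b \<Longrightarrow> cball (0::'a) s \<subseteq> hyp_cball K u"
  by (auto simp: hyp_cball_eq[OF K] b_def)

lemma orthogonal_flat_hits_iff:
  fixes W L :: "'a set"
  assumes "subspace W" "dim W = m" "L = W \<inter> hyp_space K" "x \<in> L"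
  shows "orthogonal_flat K k L x \<in> hitting_flats K k s \<longleftrightarrow> norm x \<le> s"
proof -
  have W: "dim W + k = DIM('a)" using assms m by simp
  have x: "x \<in> W" "x \<in> hyp_space K" using assms by auto
  show ?thesis
    using perp_flat_in_flats[OF assms(1) W x(2)] perp_flat_hits_cball_iff[OF assms(1) x]
    by (simp add: orthogonal_flat_eq[OF K assms(1) W assms(3,4)] hitting_flats_def)
qed

text \<open>A flat orthogonal to \<open>W\<close> at \<open>x\<close> hits \<open>cball 0 s\<close> if and only if \<open>\<bar>x\<bar> \<le> s\<close>, and \<open>W \<inter> cball 0 s\<close> is a
  dilation of \<open>W \<inter> cball 0 t\<close>. The weights lie between \<open>1\<close> and their value at distance \<open>u\<close>.\<close>

lemma flat_measure_hitting_flats_le: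
  assumes s: "0 < s" "s \<le> b" and t: "0 < t" "t \<le> b"
  shows "emeasure (flat_measure K k \<nu>) (hitting_flats K k s) \<le>
    ennreal (cosh (sqrt (- K) * u) ^ k * (distortion K b * (s / t)) ^ m) *
      emeasure (flat_measure K k \<nu>) (hitting_flats K k t)"
proof (rule flat_measure_le[OF nz m])
  have d: "0 < distortion K b" using b_bounds by (simp add: distortion_def)
  show "0 < cosh (sqrt (- K) * u) ^ k * (distortion K b * (s / t)) ^ m"
    using d s t by (intro mult_pos_pos zero_less_power) auto
  show "hitting_flats K k s \<in> sets (fell_borel K (flats K k))"
    "hitting_flats K k t \<in> sets (fell_borel K (flats K k))"
    using s t b_bounds by (auto intro!: sets_hitting_flats[OF K])
  fix L assume "L \<in> space \<nu>"
  then obtain W where W: "subspace W" "dim W = m" "L = W \<inter> hyp_space K"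
    using \<nu> origin_flats_iff[OF K] by blast
  let ?H = "hausdorff_on K m L" and ?I = "\<lambda>s. fibre_mass K k m L (hitting_flats K k s)"
  note hits = orthogonal_flat_hits_iff[OF W]
  have "?I s \<le> ennreal (cosh (sqrt (- K) * u) ^ k) * emeasure ?H (L \<inter> cball 0 s)"
    using cball_subset_hyp_cball[OF s(2)]
    by (intro fibre_mass_le K sets_hausdorff_on_cball[OF W(1,3)]) (auto simp: hits)
  also have "\<dots> \<le> ennreal (cosh (sqrt (- K) * u) ^ k) *
      (ennreal ((distortion K b * (s / t)) ^ m) * emeasure ?H (L \<inter> cball 0 t))"
    using emeasure_hausdorff_on_cball_le[OF K b_bounds(3) W(1,3) s t] by (intro mult_left_mono) auto
  also have "\<dots> \<le> ennreal (cosh (sqrt (- K) * u) ^ k) * (ennreal ((distortion K b * (s / t)) ^ m) * ?I t)"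
    using cball_subset_hyp_cball[OF t(2)]
    by (intro mult_left_mono fibre_mass_ge[where u = u] K sets_hausdorff_on_cball[OF W(1,3)])
      (auto simp: hits)
  also have "\<dots> = ennreal (cosh (sqrt (- K) * u) ^ k * (distortion K b * (s / t)) ^ m) * ?I t"
    using d s t by (simp add: ennreal_mult mult.assoc)
  finally show "?I s \<le> ennreal (cosh (sqrt (- K) * u) ^ k * (distortion K b * (s / t)) ^ m) * ?I t" .
qed

text \<open>The flats orthogonal to \<open>W\<close> whose intersection with \<open>V\<close> is non-empty but avoids the smaller ball
  belong to points \<open>x\<close> of the set in \<open>emeasure_shadow_shell\<close>.\<close>

lemma flat_measure_shell_le:
  assumes V: "V \<in> origin_flats K q" and J: "J > 0"
    and X: "X \<in> sets (fell_borel K (flats K k))" "X \<subseteq> hitting_flats K k b"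
    and far: "\<And>E. E \<in> X \<Longrightarrow> E \<inter> V \<noteq> {} \<and> E \<inter> V \<inter> ball 0 ((1 - 1 / (2 * real J)) / sqrt (- K)) = {}"
  shows "emeasure (flat_measure K k \<nu>) X \<le>
    ennreal (cosh (sqrt (- K) * u) ^ k * (2 * distortion K b) ^ m / real J) *
      emeasure (flat_measure K k \<nu>) (hitting_flats K k b)"
proof (rule flat_measure_le[OF nz m _ X(1)])
  have d: "0 < distortion K b" using b_bounds by (simp add: distortion_def)
  show "0 < cosh (sqrt (- K) * u) ^ k * (2 * distortion K b) ^ m / real J"
    using d J by (intro divide_pos_pos mult_pos_pos zero_less_power) auto
  show "hitting_flats K k b \<in> sets (fell_borel K (flats K k))"
    using b_bounds by (auto intro!: sets_hitting_flats[OF K])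
  obtain S where S: "subspace S" "V = S \<inter> hyp_space K"
    using V origin_flats_iff[OF K] by blast
  fix L assume "L \<in> space \<nu>"
  then obtain W where W: "subspace W" "dim W = m" "L = W \<inter> hyp_space K"
    using \<nu> origin_flats_iff[OF K] by blast
  have Wk: "dim W + k = DIM('a)" using W(2) m by simp
  let ?H = "hausdorff_on K m L"
  note hits = orthogonal_flat_hits_iff[OF W]
  define t where "t = 1 / sqrt (- K)"
  have t: "t > 0" "hyp_space K = ball (0::'a) t" using K by (auto simp: t_def hyp_space_def)
  define A where "A = L \<inter> cball 0 b \<inter> shadow W S t - shadow W S ((1 - 1 / (2 * real J)) * t)"
  note shell = emeasure_shadow_shell[OF K b_bounds(3) W(1,3) S(1) J t(1) A_def, of m]
  have XA: "x \<in> A" if x: "x \<in> L" "orthogonal_flat K k L x \<in> X" for x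
  proof -
    let ?E = "perp_flat K W x"
    have xW: "x \<in> W" using x(1) W(3) by simp
    have E: "?E \<in> X" using x orthogonal_flat_eq[OF K W(1) Wk W(3) x(1)] by simp
    then have "norm x \<le> b" using hits[OF x(1), of b] x(2) X(2) by auto
    moreover have "?E \<inter> (S \<inter> hyp_space K) \<inter> ball 0 t \<noteq> {}"
      using far[OF E] S(2) t(2) by auto
    then have "x \<in> shadow W S t"
      by (subst perp_flat_meets_iff_shadow[OF W(1) xW, symmetric, of _ K]) (simp_all add: t_def)
    moreover have "x \<notin> shadow W S ((1 - 1 / (2 * real J)) * t)"
    proof -
      have "(1 - 1 / (2 * real J)) * t \<le> 1 * t" using t(1) by (intro mult_right_mono) auto
      moreover have "?E \<inter> (S \<inter> hyp_space K) \<inter> ball 0 ((1 - 1 / (2 * real J)) * t) = {}"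
        using far[OF E] S(2) by (simp add: t_def)
      ultimately show ?thesis
        by (subst perp_flat_meets_iff_shadow[OF W(1) xW, symmetric, of _ K]) (simp_all add: t_def)
    qed
    ultimately show ?thesis using x(1) by (simp add: A_def)
  qed
  have "emeasure ?H A = emeasure ?H A * ennreal (real J) * ennreal (1 / real J)"
    using J by (simp add: mult.assoc flip: ennreal_mult)
  also have "\<dots> \<le> (ennreal ((2 * distortion K b) ^ m) * emeasure ?H (L \<inter> cball 0 b)) * ennreal (1 / real J)"
    by (intro mult_right_mono shell(2)) simp
  also have "\<dots> = ennreal ((2 * distortion K b) ^ m / real J) * emeasure ?H (L \<inter> cball 0 b)"
  proof -
    have "ennreal ((2 * distortion K b) ^ m / real J) = ennreal ((2 * distortion K b) ^ m) * ennreal (1 / real J)"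
      using d by (subst ennreal_mult[symmetric]) auto
    then show ?thesis by (simp add: mult_ac)
  qed
  finally have HA: "emeasure ?H A \<le> ennreal ((2 * distortion K b) ^ m / real J) * emeasure ?H (L \<inter> cball 0 b)" .
  have "fibre_mass K k m L X \<le>
      ennreal (cosh (sqrt (- K) * u) ^ k) * emeasure ?H A"
    using cball_subset_hyp_cball[OF order_refl]
    by (intro fibre_mass_le K shell(1) XA) (auto simp: A_def)
  also have "\<dots> \<le> ennreal (cosh (sqrt (- K) * u) ^ k) *
      (ennreal ((2 * distortion K b) ^ m / real J) * emeasure ?H (L \<inter> cball 0 b))"
    by (intro mult_left_mono HA) simp
  also have "\<dots> \<le> ennreal (cosh (sqrt (- K) * u) ^ k) * (ennreal ((2 * distortion K b) ^ m / real J) *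
      fibre_mass K k m L (hitting_flats K k b))"
    using cball_subset_hyp_cball[OF order_refl]
    by (intro mult_left_mono fibre_mass_ge[where u = u] K sets_hausdorff_on_cball[OF W(1,3)]) (auto simp: hits)
  also have "\<dots> = ennreal (cosh (sqrt (- K) * u) ^ k * (2 * distortion K b) ^ m / real J) *
      fibre_mass K k m L (hitting_flats K k b)"
  proof -
    have "ennreal (cosh (sqrt (- K) * u) ^ k * (2 * distortion K b) ^ m / real J) =
      ennreal (cosh (sqrt (- K) * u) ^ k) * ennreal ((2 * distortion K b) ^ m / real J)"
      using d by (subst ennreal_mult[symmetric]) auto
    then show ?thesis by (simp only: mult.assoc)
  qed
  finally show "fibre_mass K k m L X \<le> ennreal (cosh (sqrt (- K) * u) ^ k * (2 * distortion K b) ^ m / real J) *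
      fibre_mass K k m L (hitting_flats K k b)" .
qed

end

section \<open>Moments and small or large deviations\<close>

lemma ennreal_powr_top_pos: "a > 0 \<Longrightarrow> ennreal_powr \<infinity> a = \<infinity>"
  by (simp add: ennreal_powr_def)

lemma ennreal_powr_ennreal: "0 < r \<Longrightarrow> ennreal_powr (ennreal r) a = ennreal (r powr a)"
  by (simp add: ennreal_powr_def)

lemma nn_integral_powr_eq_top_of_top:
  assumes "a > 0" and "emeasure M {\<omega> \<in> space M. R \<omega> = \<infinity>} > 0"
  shows "(\<integral>\<^sup>+\<omega>. ennreal_powr (R \<omega>) a \<partial>M) = \<infinity>"
proof -
  let ?A = "{\<omega> \<in> space M. R \<omega> = \<infinity>}"
  have A: "?A \<in> sets M" using assms(2) emeasure_neq_0_sets[of M ?A] by simp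
  have "\<infinity> = \<infinity> * emeasure M ?A" using assms(2) by (simp add: ennreal_top_mult)
  also have "\<dots> = (\<integral>\<^sup>+\<omega>. \<infinity> * indicator ?A \<omega> \<partial>M)" using A by (simp add: nn_integral_cmult_indicator)
  also have "\<dots> \<le> (\<integral>\<^sup>+\<omega>. ennreal_powr (R \<omega>) a \<partial>M)"
    using assms(1) by (intro nn_integral_mono) (auto simp: ennreal_powr_top_pos[simplified] split: split_indicator)
  finally show ?thesis by (simp add: top_unique)
qed

lemma ennreal_powr_neg_ge:
  assumes "0 < t" "t \<le> 1" "0 < a" "a \<le> s" and R: "R \<le> ennreal t"
  shows "ennreal (t powr - a) \<le> ennreal_powr R (- s)"
proof (cases "R = 0")
  case True
  then show ?thesis using assms by (simp add: ennreal_powr_def)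
next
  case False
  obtain r where r: "R = ennreal r" "0 \<le> r" using R by (cases R) (auto simp: top_unique)
  then have r: "R = ennreal r" "0 < r" "r \<le> t"
    using False R assms(1) by (auto simp: less_le ennreal_le_iff simp del: ennreal_le_iff2)
  have "t powr - a \<le> t powr - s" using assms by (intro powr_mono') auto
  also have "\<dots> \<le> r powr - s" using r assms by (intro powr_mono2') auto
  finally show ?thesis using r by (simp add: ennreal_powr_ennreal)
qed

lemma eq_top_if_of_nat_le: "(\<And>n::nat. of_nat n \<le> (x::ennreal)) \<Longrightarrow> x = \<infinity>"
  using ennreal_Ex_less_of_nat[of x] by (metis infinity_ennreal_def less_top not_less)

text \<open>In the sum over \<open>n < N\<close> of \<open>2 ^ (n m)\<close> times the indicator of \<open>R \<le> t (1 / 2) ^ n\<close>, the last non-zero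
  summand dominates by geometric growth, and it is at most a multiple of \<open>R powr - s\<close>. But each of
  the \<open>N\<close> summands has an integral of at least \<open>c\<close>.\<close>

lemma nn_integral_negative_powr_eq_top:
  fixes R :: "'w \<Rightarrow> ennreal" and m :: nat
  assumes R: "R \<in> borel_measurable M" and m: "m \<ge> 1" and s: "real m \<le> s"
    and t: "0 < t" "t \<le> 1" and c: "0 < c"
    and small: "\<And>n. ennreal (c * (1 / 2) ^ (n * m)) \<le> emeasure M {\<omega> \<in> space M. R \<omega> \<le> ennreal (t * (1 / 2) ^ n)}"
  shows "(\<integral>\<^sup>+\<omega>. ennreal_powr (R \<omega>) (- s) \<partial>M) = \<infinity>"
proof -
  let ?A = "\<lambda>n. {\<omega> \<in> space M. R \<omega> \<le> ennreal (t * (1 / 2) ^ n)}"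
  let ?f = "\<lambda>N \<omega>. \<Sum>n<N. ennreal (2 ^ (n * m)) * indicator (?A n) \<omega>"
  have A: "?A n \<in> sets M" for n using R by measurable
  have geo: "(\<Sum>n<N. (2::real) ^ (n * m)) \<le> 2 ^ (N * m)" for N
  proof (induction N)
    case (Suc N)
    have "(\<Sum>n<Suc N. (2::real) ^ (n * m)) \<le> 2 ^ (N * m) + 2 ^ (N * m)" using Suc by simp
    also have "\<dots> = 2 ^ (1 + N * m)" by simp
    also have "\<dots> \<le> 2 ^ (Suc N * m)" using m by (intro power_increasing) auto
    finally show ?case .
  qed simp
  have bound: "?f N \<omega> \<le> ennreal (2 ^ m) * ennreal_powr (R \<omega>) (- s)" for N \<omega>
  proof (induction N)
    case (Suc N)
    show ?case
    proof (cases "\<omega> \<in> ?A N")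
      case False
      then show ?thesis using Suc by simp
    next
      case True
      have "?f (Suc N) \<omega> \<le> (\<Sum>n<Suc N. ennreal (2 ^ (n * m)))"
        by (intro sum_mono) (auto split: split_indicator)
      also have "\<dots> = ennreal (\<Sum>n<Suc N. 2 ^ (n * m))" by (rule sum_ennreal) simp
      also have "\<dots> \<le> ennreal (2 ^ (Suc N * m))" by (intro ennreal_leI geo)
      also have "\<dots> = ennreal (2 ^ m) * ennreal (2 ^ (N * m))"
        by (simp add: power_add flip: ennreal_mult)
      also have "\<dots> \<le> ennreal (2 ^ m) * ennreal_powr (R \<omega>) (- s)"
      proof (rule mult_left_mono)
        have t1: "0 < t * (1 / 2) ^ N" "t * (1 / 2) ^ N \<le> 1"
          using t by (auto intro!: mult_le_one power_le_one)
        have "(2::real) ^ (N * m) = ((1 / 2) ^ N) powr - real m"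
          by (simp add: powr_minus powr_realpow power_one_over power_mult)
        also have "\<dots> \<le> (t * (1 / 2) ^ N) powr - real m"
          using t by (intro powr_mono2') (auto simp: mult_left_le_one_le)
        finally have "ennreal (2 ^ (N * m)) \<le> ennreal ((t * (1 / 2) ^ N) powr - real m)" by (rule ennreal_leI)
        also have "\<dots> \<le> ennreal_powr (R \<omega>) (- s)"
          using t1 m s True by (intro ennreal_powr_neg_ge) auto
        finally show "ennreal (2 ^ (N * m)) \<le> ennreal_powr (R \<omega>) (- s)" .
      qed simp
      finally show ?thesis .
    qed
  qed simp
  have le: "of_nat N * ennreal c \<le> (\<integral>\<^sup>+\<omega>. ennreal (2 ^ m) * ennreal_powr (R \<omega>) (- s) \<partial>M)" for N
  proof -
    have "of_nat N * ennreal c = (\<Sum>n<N. ennreal c)" by simp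
    also have "\<dots> \<le> (\<Sum>n<N. ennreal (2 ^ (n * m)) * emeasure M (?A n))"
    proof (intro sum_mono)
      fix n
      have "ennreal c = ennreal (2 ^ (n * m)) * ennreal (c * (1 / 2) ^ (n * m))"
        using c by (simp add: power_one_over flip: ennreal_mult)
      also have "\<dots> \<le> ennreal (2 ^ (n * m)) * emeasure M (?A n)" by (intro mult_left_mono small) simp
      finally show "ennreal c \<le> ennreal (2 ^ (n * m)) * emeasure M (?A n)" .
    qed
    also have "\<dots> = (\<integral>\<^sup>+\<omega>. ?f N \<omega> \<partial>M)"
      using A by (subst nn_integral_sum) (auto simp: nn_integral_cmult_indicator intro!: borel_measurable_times)
    also have "\<dots> \<le> (\<integral>\<^sup>+\<omega>. ennreal (2 ^ m) * ennreal_powr (R \<omega>) (- s) \<partial>M)"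
      by (intro nn_integral_mono bound)
    finally show ?thesis .
  qed
  let ?I = "\<integral>\<^sup>+\<omega>. ennreal_powr (R \<omega>) (- s) \<partial>M"
  have "of_nat N \<le> ennreal (1 / c) * (ennreal (2 ^ m) * ?I)" for N
  proof -
    have "of_nat N = ennreal (1 / c) * (of_nat N * ennreal c)"
      using c by (simp add: mult.left_commute flip: ennreal_mult)
    also have "\<dots> \<le> ennreal (1 / c) * (ennreal (2 ^ m) * ?I)"
      using le[of N] by (intro mult_left_mono) (simp_all add: nn_integral_cmult_real)
    finally show ?thesis .
  qed
  then have "ennreal (1 / c) * (ennreal (2 ^ m) * ?I) = \<infinity>" by (rule eq_top_if_of_nat_le)
  then show ?thesis by (auto simp: ennreal_mult_eq_top_iff)
qed

lemma suminf_geometric_finite: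
  assumes x: "0 \<le> x" "x < 1" and c: "0 \<le> c"
  shows "(\<Sum>n. ennreal (c * x ^ n)) < \<infinity>"
proof -
  have "summable (\<lambda>n. c * x ^ n)" using x by (intro summable_mult summable_geometric) auto
  then have "(\<Sum>n. ennreal (c * x ^ n)) = ennreal (\<Sum>n. c * x ^ n)"
    using x c by (intro suminf_ennreal2) auto
  then show ?thesis by simp
qed

lemma nn_integral_suminf_indicator:
  assumes "\<And>n. A n \<in> sets M"
  shows "(\<integral>\<^sup>+\<omega>. (\<Sum>n. c n * indicator (A n) \<omega>) \<partial>M) = (\<Sum>n. c n * emeasure M (A n))"
  using assms by (subst nn_integral_suminf) (auto simp: nn_integral_cmult_indicator intro!: borel_measurable_times)

lemma ennreal_suminf_upper: "f n \<le> (\<Sum>i. f i :: ennreal)"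
  using sum_le_suminf[of f "{n}"] by (simp add: summableI)

text \<open>The function \<open>R powr - s\<close> is at most \<open>1\<close> plus the sum over all \<open>n\<close> of \<open>2 powr ((n + 1) s)\<close> times the
  indicator of \<open>R \<le> (1 / 2) ^ n\<close>. The integrals of the summands decay geometrically for \<open>s < m\<close>.\<close>

lemma nn_integral_negative_powr_finite:
  fixes R :: "'w \<Rightarrow> ennreal" and m :: nat
  assumes M: "prob_space M" and R: "R \<in> borel_measurable M" and s: "0 < s" "s < real m" and C: "0 \<le> C"
    and small: "\<And>n. emeasure M {\<omega> \<in> space M. R \<omega> \<le> ennreal ((1 / 2) ^ n)} \<le> ennreal (C * (1 / 2) ^ (n * m))"
  shows "(\<integral>\<^sup>+\<omega>. ennreal_powr (R \<omega>) (- s) \<partial>M) < \<infinity>"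
proof -
  let ?A = "\<lambda>n. {\<omega> \<in> space M. R \<omega> \<le> ennreal ((1 / 2) ^ n)}"
  let ?c = "\<lambda>n. 2 powr ((real n + 1) * s)"
  have A: "?A n \<in> sets M" for n using R by measurable
  have bound: "ennreal_powr (R \<omega>) (- s) \<le> 1 + (\<Sum>n. ennreal (?c n) * indicator (?A n) \<omega>)"
    if \<omega>: "\<omega> \<in> space M" for \<omega>
  proof -
    consider "R \<omega> = 0" | "R \<omega> = \<infinity>" | r where "R \<omega> = ennreal r" "1 < r" | r where "R \<omega> = ennreal r" "0 < r" "r \<le> 1"
      by (cases "R \<omega>") (force simp: not_less)+
    then show ?thesis
    proof cases
      case 1
      have "of_nat N \<le> (\<Sum>n. ennreal (?c n) * indicator (?A n) \<omega>)" for N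
      proof -
        have "of_nat N = (\<Sum>n<N. (1::ennreal))" by simp
        also have "\<dots> \<le> (\<Sum>n<N. ennreal (?c n) * indicator (?A n) \<omega>)"
        proof (intro sum_mono)
          fix n
          have "ennreal 1 \<le> ennreal (?c n)" using s by (intro ennreal_leI ge_one_powr_ge_zero) auto
          then show "1 \<le> ennreal (?c n) * indicator (?A n) \<omega>" using 1 \<omega> by simp
        qed
        also have "\<dots> \<le> (\<Sum>n. ennreal (?c n) * indicator (?A n) \<omega>)" by (intro sum_le_suminf) (auto simp: summableI)
        finally show ?thesis .
      qed
      then have "(\<Sum>n. ennreal (?c n) * indicator (?A n) \<omega>) = \<infinity>" by (rule eq_top_if_of_nat_le)
      then show ?thesis by simp
    next
      case 2
      then show ?thesis using s by (simp add: ennreal_powr_def)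
    next
      case (3 r)
      have "r powr - s \<le> r powr 0" using 3 s by (intro powr_mono) auto
      then have "ennreal_powr (R \<omega>) (- s) \<le> 1" using 3 by (simp add: ennreal_powr_ennreal)
      then show ?thesis by (rule order_trans) simp
    next
      case (4 r)
      obtain n0 where n0: "(1 / 2) ^ n0 < r" using real_arch_pow_inv[of r "1 / 2"] 4 by auto
      define n where "n = (LEAST n. (1 / 2) ^ n < r)"
      have n: "(1 / 2) ^ n < r" unfolding n_def using n0 by (rule LeastI)
      then have "n \<noteq> 0" using 4 by (cases n) auto
      then obtain n' where n': "n = Suc n'" by (cases n) auto
      have "\<not> (1 / 2) ^ n' < r" unfolding n_def[symmetric] using not_less_Least[of n' "\<lambda>n. (1 / 2) ^ n < r"] n' n_def by simp
      then have "\<omega> \<in> ?A n'" using \<omega> 4 by (simp add: ennreal_leI)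
      moreover have "r powr - s \<le> ((1 / 2) ^ n) powr - s" using n s by (intro powr_mono2') auto
      moreover have "((1 / 2) ^ n) powr - s = ?c n'"
      proof -
        have "(1 / 2 :: real) ^ n = 2 powr - real n"
          by (simp add: powr_minus powr_realpow power_one_over inverse_eq_divide)
        then have "((1 / 2 :: real) ^ n) powr - s = 2 powr (real n * s)" by (simp add: powr_powr)
        moreover have "real n = real n' + 1" using n' by simp
        ultimately show ?thesis by (simp only:)
      qed
      ultimately have "ennreal_powr (R \<omega>) (- s) \<le> ennreal (?c n') * indicator (?A n') \<omega>"
        using 4 by (simp add: ennreal_powr_ennreal ennreal_leI)
      also have "\<dots> \<le> (\<Sum>n. ennreal (?c n) * indicator (?A n) \<omega>)" by (rule ennreal_suminf_upper)
      also have "\<dots> \<le> 1 + \<dots>" by simp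
      finally show ?thesis .
    qed
  qed
  define x where "x = 2 powr (s - real m)"
  have x: "0 \<le> x" "x < 1" using s by (auto simp: x_def powr_less_one)
  have "(\<integral>\<^sup>+\<omega>. ennreal_powr (R \<omega>) (- s) \<partial>M) \<le> (\<integral>\<^sup>+\<omega>. 1 + (\<Sum>n. ennreal (?c n) * indicator (?A n) \<omega>) \<partial>M)"
    by (rule nn_integral_mono) (rule bound)
  also have "\<dots> = (\<integral>\<^sup>+\<omega>. 1 \<partial>M) + (\<integral>\<^sup>+\<omega>. (\<Sum>n. ennreal (?c n) * indicator (?A n) \<omega>) \<partial>M)"
    using A by (intro nn_integral_add) (auto intro!: borel_measurable_suminf borel_measurable_times)
  also have "\<dots> = 1 + (\<Sum>n. ennreal (?c n) * emeasure M (?A n))"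
    using prob_space.emeasure_space_1[OF M] by (subst nn_integral_suminf_indicator[OF A]) simp
  also have "\<dots> \<le> 1 + (\<Sum>n. ennreal ((C * 2 powr s) * x ^ n))"
  proof (intro add_left_mono suminf_le)
    fix n
    have "ennreal (?c n) * emeasure M (?A n) \<le> ennreal (?c n) * ennreal (C * (1 / 2) ^ (n * m))"
      by (intro mult_left_mono small) simp
    also have "\<dots> = ennreal (?c n * (C * (1 / 2) ^ (n * m)))" using C by (simp flip: ennreal_mult)
    also have "?c n * (C * (1 / 2) ^ (n * m)) = (C * 2 powr s) * x ^ n"
    proof -
      have "(1 / 2 :: real) ^ (n * m) = 2 powr - (real n * real m)"
        by (simp add: powr_minus power_one_over powr_realpow inverse_eq_divide flip: of_nat_mult)
      moreover have "x ^ n = 2 powr (real n * (s - real m))"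
        by (simp add: x_def powr_powr mult.commute flip: powr_realpow)
      moreover have "?c n * 2 powr - (real n * real m) = 2 powr s * 2 powr (real n * (s - real m))"
        by (simp add: algebra_simps flip: powr_add)
      ultimately show ?thesis by (simp add: mult.left_commute mult.assoc)
    qed
    finally show "ennreal (?c n) * emeasure M (?A n) \<le> ennreal ((C * 2 powr s) * x ^ n)" .
  qed (auto simp: summableI)
  also have "\<dots> < \<infinity>"
    using suminf_geometric_finite[OF x, of "C * 2 powr s"] C by (simp add: less_top)
  finally show ?thesis .
qed

text \<open>If \<open>R\<close> grows at most linearly in \<open>n\<close> on events \<open>B n\<close> of geometrically small probability, then all
  its positive moments are finite, since polynomial growth does not compensate for the geometric decay.\<close>

lemma nn_integral_positive_powr_finite:
  fixes R :: "'w \<Rightarrow> ennreal" and B :: "nat \<Rightarrow> 'w set"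
  assumes M: "prob_space M" and F: "F \<in> sets M" "emeasure M F > 0" and B: "\<And>n. B n \<in> sets M"
    and a: "0 < a" and c: "0 < c" and C: "0 \<le> C"
    and far: "\<And>n. emeasure M (B n) \<le> ennreal (C * (1 / 2) ^ n)"
    and R: "\<And>\<omega>. \<omega> \<in> F \<Longrightarrow> R \<omega> \<le> ennreal (2 * c) \<or> (\<exists>n. \<omega> \<in> B n \<and> R \<omega> \<le> ennreal ((real n + 3) * c))"
  shows "(\<integral>\<^sup>+\<omega>. ennreal_powr (R \<omega>) a \<partial>uniform_measure M F) < \<infinity>"
proof -
  let ?U = "uniform_measure M F"
  let ?c = "\<lambda>n. ((real n + 3) * c) powr a"
  have le: "ennreal_powr r a \<le> ennreal (t powr a)" if rt: "r \<le> ennreal t" "0 < t" for r t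
  proof (cases "r = 0")
    case False
    then obtain x where x: "r = ennreal x" "0 < x" using rt by (cases r) (auto simp: top_unique less_le)
    then have "x \<le> t" using rt by (simp add: ennreal_le_iff)
    then show ?thesis using x a by (simp add: ennreal_powr_ennreal ennreal_leI powr_mono2)
  qed (use a in \<open>simp add: ennreal_powr_def\<close>)
  have bound: "ennreal_powr (R \<omega>) a \<le> ennreal ((2 * c) powr a) + (\<Sum>n. ennreal (?c n) * indicator (B n) \<omega>)"
    if \<omega>: "\<omega> \<in> F" for \<omega>
    using R[OF \<omega>]
  proof (elim disjE exE conjE)
    assume "R \<omega> \<le> ennreal (2 * c)"
    then have "ennreal_powr (R \<omega>) a \<le> ennreal ((2 * c) powr a)" using c by (intro le) auto
    then show ?thesis by (rule order_trans) simp
  next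
    fix n assume n: "\<omega> \<in> B n" "R \<omega> \<le> ennreal ((real n + 3) * c)"
    then have "ennreal_powr (R \<omega>) a \<le> ennreal (?c n) * indicator (B n) \<omega>" using c by (simp add: le)
    also have "\<dots> \<le> (\<Sum>n. ennreal (?c n) * indicator (B n) \<omega>)" by (rule ennreal_suminf_upper)
    finally show ?thesis by (rule order_trans) simp
  qed
  have F': "emeasure M F \<noteq> 0" "emeasure M F \<noteq> \<infinity>"
    using F prob_space.emeasure_le_1[OF M, of F] by (auto simp: top_unique)
  define p where "p = measure M F"
  have p: "emeasure M F = ennreal p" "0 < p"
    using F' F(2) by (auto simp: p_def emeasure_eq_ennreal_measure less_le measure_nonneg)
  have U: "emeasure ?U (B n) \<le> ennreal (C / p * (1 / 2) ^ n)" for n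
  proof -
    have "emeasure ?U (B n) = emeasure M (F \<inter> B n) / ennreal p" using F(1) B p by simp
    also have "\<dots> \<le> ennreal (C * (1 / 2) ^ n) / ennreal p"
      using order_trans[OF emeasure_mono[OF Int_lower2 B] far] by (rule divide_right_mono_ennreal)
    also have "\<dots> = ennreal (C / p * (1 / 2) ^ n)" using p C by (simp add: divide_ennreal)
    finally show ?thesis .
  qed
  have sum: "summable (\<lambda>n. ?c n * (C / p * (1 / 2) ^ n))"
  proof (rule summable_comparison_test_bigo)
    show "summable (\<lambda>n. norm ((3 / 4 :: real) ^ n))" by simp
    show "(\<lambda>n. ?c n * (C / p * (1 / 2) ^ n)) \<in> O(\<lambda>n. (3 / 4) ^ n)" using c a p C by real_asymp
  qed
  have "(\<integral>\<^sup>+\<omega>. ennreal_powr (R \<omega>) a \<partial>?U) \<le>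
      (\<integral>\<^sup>+\<omega>. ennreal ((2 * c) powr a) + (\<Sum>n. ennreal (?c n) * indicator (B n) \<omega>) \<partial>?U)"
    using bound F(1) by (intro nn_integral_mono_AE AE_uniform_measureI) auto
  also have "\<dots> = (\<integral>\<^sup>+\<omega>. ennreal ((2 * c) powr a) \<partial>?U) + (\<integral>\<^sup>+\<omega>. (\<Sum>n. ennreal (?c n) * indicator (B n) \<omega>) \<partial>?U)"
    using B by (intro nn_integral_add) (auto intro!: borel_measurable_suminf borel_measurable_times)
  also have "\<dots> = ennreal ((2 * c) powr a) * emeasure ?U (space M) + (\<Sum>n. ennreal (?c n) * emeasure ?U (B n))"
    using B by (subst nn_integral_suminf_indicator) auto
  also have "\<dots> \<le> ennreal ((2 * c) powr a) * 1 + (\<Sum>n. ennreal (?c n * (C / p * (1 / 2) ^ n)))"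
  proof (intro add_mono mult_left_mono suminf_le)
    have "prob_space ?U" using F' by (rule prob_space_uniform_measure)
    then show "emeasure ?U (space M) \<le> 1" using prob_space.emeasure_le_1 by blast
    show "ennreal (?c n) * emeasure ?U (B n) \<le> ennreal (?c n * (C / p * (1 / 2) ^ n))" for n
      using mult_left_mono[OF U[of n], of "ennreal (?c n)"] p C by (simp flip: ennreal_mult)
  qed (auto simp: summableI)
  also have "(\<Sum>n. ennreal (?c n * (C / p * (1 / 2) ^ n))) = ennreal (\<Sum>n. ?c n * (C / p * (1 / 2) ^ n))"
    using p C by (intro suminf_ennreal2 sum) auto
  finally show ?thesis by (rule le_less_trans) (simp add: less_top)
qed

section \<open>The distance of the intersection from the origin\<close>

lemma closedin_Int_flats:
  "E \<in> flats K k \<Longrightarrow> V \<in> origin_flats K q \<Longrightarrow> E \<inter> V \<subseteq> hyp_space K"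
  using closedin_flat[of E K k] closedin_subset by fastforce

text \<open>The condition is split into countably many hitting conditions for compact balls, which are
  measurable in the Fell topology.\<close>

lemma origin_dist_less_iff:
  fixes F :: "'a::euclidean_space set"
  assumes K: "K < 0" and F: "F \<subseteq> hyp_space K"
  shows "origin_dist K F < ennreal r \<longleftrightarrow>
    (\<exists>n. F \<inter> cball 0 (tanh (sqrt (- K) * (r - 1 / real (Suc n))) / sqrt (- K)) \<noteq> {})"
proof -
  have "origin_dist K F < ennreal r \<longleftrightarrow> (\<exists>x\<in>F. ennreal (hyp_dist K 0 x) < ennreal r)"
    by (simp add: origin_dist_def INF_less_iff)
  also have "\<dots> \<longleftrightarrow> (\<exists>x\<in>F. \<exists>n. hyp_dist K x 0 \<le> r - 1 / real (Suc n))"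
  proof (intro bex_cong refl)
    fix x assume "x \<in> F"
    then have x: "x \<in> hyp_space K" using F by auto
    have 0: "0 \<le> hyp_dist K 0 x" using norm_le_hyp_dist_0[OF K x] norm_ge_zero order_trans by blast
    have "ennreal (hyp_dist K 0 x) < ennreal r \<longleftrightarrow> hyp_dist K 0 x < r" using 0 by (simp add: ennreal_less_iff)
    also have "\<dots> \<longleftrightarrow> (\<exists>n. hyp_dist K 0 x \<le> r - 1 / real (Suc n))"
    proof
      assume "hyp_dist K 0 x < r"
      then obtain n where "1 / real (Suc n) < r - hyp_dist K 0 x" using nat_approx_posE[of "r - hyp_dist K 0 x"] by auto
      then show "\<exists>n. hyp_dist K 0 x \<le> r - 1 / real (Suc n)" by (intro exI[of _ n]) simp
    next
      assume "\<exists>n. hyp_dist K 0 x \<le> r - 1 / real (Suc n)"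
      then obtain n where "hyp_dist K 0 x \<le> r - 1 / real (Suc n)" ..
      moreover have "0 < 1 / real (Suc n)" by simp
      ultimately show "hyp_dist K 0 x < r" by linarith
    qed
    finally show "ennreal (hyp_dist K 0 x) < ennreal r \<longleftrightarrow> (\<exists>n. hyp_dist K x 0 \<le> r - 1 / real (Suc n))"
      by (simp add: hyp_dist_0[OF K x])
  qed
  also have "\<dots> \<longleftrightarrow> (\<exists>n. F \<inter> cball 0 (tanh (sqrt (- K) * (r - 1 / real (Suc n))) / sqrt (- K)) \<noteq> {})"
  proof -
    have "hyp_dist K x 0 \<le> s \<longleftrightarrow> x \<in> cball 0 (tanh (sqrt (- K) * s) / sqrt (- K))" if "x \<in> F" for x s
      using hyp_dist_0_le_iff[OF K, of x s] F that by auto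
    then show ?thesis by blast
  qed
  finally show ?thesis .
qed

lemma origin_dist_less_top_iff: "origin_dist K F < \<infinity> \<longleftrightarrow> F \<noteq> {}"
  by (auto simp: origin_dist_def INF_less_iff)

lemma origin_dist_le: "x \<in> F \<Longrightarrow> hyp_dist K 0 x \<le> r \<Longrightarrow> origin_dist K F \<le> ennreal r"
  unfolding origin_dist_def by (rule INF_lower2) (auto intro: ennreal_leI)

lemma hits_cball_if_origin_dist_le:
  assumes K: "K < 0" and F: "F \<subseteq> hyp_space K" and r: "origin_dist K F \<le> ennreal r" "0 \<le> r" "r < s"
  shows "F \<inter> cball 0 s \<noteq> {}"
proof -
  have "origin_dist K F < ennreal s" using r by (auto intro: le_less_trans simp: ennreal_less_iff)
  then obtain x where x: "x \<in> F" "ennreal (hyp_dist K 0 x) < ennreal s"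
    by (auto simp: origin_dist_def INF_less_iff)
  have "norm x \<le> hyp_dist K 0 x" using x F by (intro norm_le_hyp_dist_0[OF K]) auto
  then have "norm x \<le> s" using x(2) norm_ge_zero[of x] by (simp add: ennreal_less_iff)
  then show ?thesis using x(1) by auto
qed

text \<open>
  Let \<open>n\<close> be least such that \<open>F\<close> meets the ball of Euclidean radius \<open>1 - (1 / 2) ^ (n + 1)\<close> times
  the radius of the Klein ball. Then the distance of \<open>F\<close> from the origin is at most \<open>(n + 2) / sqrt (- K)\<close>, and
  for \<open>n \<noteq> 0\<close> the index \<open>n - 1\<close> is as required.
\<close>

lemma origin_dist_dyadic:
  fixes F :: "'a::euclidean_space set"
  assumes K: "K < 0" and F: "F \<subseteq> hyp_space K" "F \<noteq> {}"
  shows "origin_dist K F \<le> ennreal (2 * (1 / sqrt (- K))) \<or>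
    (\<exists>n. F \<inter> ball 0 ((1 - (1 / 2) ^ (n + 1)) / sqrt (- K)) = {} \<and>
      origin_dist K F \<le> ennreal ((real n + 3) * (1 / sqrt (- K))))"
proof -
  let ?hit = "\<lambda>n. F \<inter> ball 0 ((1 - (1 / 2) ^ (n + 1)) / sqrt (- K)) \<noteq> {}"
  have le: "origin_dist K F \<le> ennreal ((real n + 2) * (1 / sqrt (- K)))" if hit: "?hit n" for n
  proof -
    obtain x where x: "x \<in> F" "norm x < (1 - (1 / 2) ^ (n + 1)) / sqrt (- K)" using hit by auto
    have "hyp_dist K 0 x \<le> (real (n + 1) + 1) / sqrt (- K)"
      using x(2) by (intro hyp_dist_0_le_of_norm_le[OF K]) simp
    then show ?thesis using x(1) by (intro origin_dist_le[of x]) (simp_all add: add.commute)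
  qed
  obtain x where x: "x \<in> F" "x \<in> hyp_space K" using F by auto
  then have "0 < 1 - sqrt (- K) * norm x" using K by (simp add: hyp_space_def field_simps)
  then obtain n0 where "(1 / 2) ^ n0 < 1 - sqrt (- K) * norm x"
    using real_arch_pow_inv[of "1 - sqrt (- K) * norm x" "1 / 2"] by auto
  then have "(1 / 2) ^ (n0 + 1) < 1 - sqrt (- K) * norm x"
    by (rule le_less_trans[rotated]) (simp add: power_decreasing)
  then have "norm x < (1 - (1 / 2) ^ (n0 + 1)) / sqrt (- K)"
    using K by (simp add: less_divide_eq mult.commute)
  then have n0: "?hit n0" using x(1) by auto
  define n where "n = (LEAST n. ?hit n)"
  have n: "?hit n" unfolding n_def using n0 by (rule LeastI)
  show ?thesis
  proof (cases n)
    case 0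
    then show ?thesis using le[OF n] by simp
  next
    case (Suc n')
    then have "\<not> ?hit n'" using not_less_Least[of n' ?hit] by (simp add: n_def)
    then show ?thesis using le[OF n] Suc by (intro disjI2 exI[of _ n']) (simp add: add.commute)
  qed
qed

section \<open>Measurability of the intersection\<close>

abbreviation meet_space :: "real \<Rightarrow> nat \<Rightarrow> nat \<Rightarrow> ('a::euclidean_space set \<times> 'a set) measure" where
  "meet_space K k q \<equiv> fell_borel K (flats K k) \<Otimes>\<^sub>M fell_borel K (origin_flats K q)"

lemma sets_meet_cball:
  assumes K: "K < 0" and s: "s < 1 / sqrt (- K)"
  shows "{p \<in> flats K k \<times> origin_flats K q. fst p \<inter> snd p \<inter> cball 0 s \<noteq> {}} \<in> sets (meet_space K k q)"
  by (intro sets_hitting_compact_pair closedin_flat origin_flats_closedin compact_cball cball_subset_hyp_space K s)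

lemma sets_meet_ball:
  assumes K: "K < 0" and t: "0 < t" "t \<le> 1 / sqrt (- K)"
  shows "{p \<in> flats K k \<times> origin_flats K q. fst p \<inter> snd p \<inter> ball 0 t \<noteq> {}} \<in> sets (meet_space K k q)"
proof -
  have eq: "{p \<in> flats K k \<times> origin_flats K q. fst p \<inter> snd p \<inter> ball 0 t \<noteq> {}} =
    (\<Union>n. {p \<in> flats K k \<times> origin_flats K q. fst p \<inter> snd p \<inter> cball 0 ((1 - 1 / real (Suc n)) * t) \<noteq> {}})"
    unfolding ball_eq_UN_cball[OF t(1)] by blast
  have lt: "(1 - 1 / real (Suc n)) * t < 1 / sqrt (- K)" for n
  proof -
    have "(1 - 1 / real (Suc n)) * t < 1 * t" using t by (intro mult_strict_right_mono) auto
    also have "\<dots> \<le> 1 / sqrt (- K)" using t by simp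
    finally show ?thesis .
  qed
  show ?thesis unfolding eq by (intro sets.countable_nat_UN image_subsetI sets_meet_cball K lt)
qed

lemma borel_measurable_origin_dist_meet:
  assumes K: "K < 0"
  shows "(\<lambda>p. origin_dist K (fst p \<inter> snd p :: 'a::euclidean_space set)) \<in> borel_measurable (meet_space K k q)"
proof (rule borel_measurableI_less)
  fix y :: ennreal
  let ?M = "meet_space K k q :: ('a set \<times> 'a set) measure"
  have sp: "space ?M = flats K k \<times> origin_flats K q" by (simp add: space_pair_measure)
  have sub: "fst p \<inter> snd p \<subseteq> hyp_space K" if "p \<in> flats K k \<times> origin_flats K q" for p :: "'a set \<times> 'a set"
    using that closedin_Int_flats[of "fst p" K k "snd p" q] by auto
  show "{p \<in> space ?M. origin_dist K (fst p \<inter> snd p) < y} \<in> sets ?M"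
  proof (cases y)
    case (real r)
    have eq: "{p \<in> space ?M. origin_dist K (fst p \<inter> snd p) < y} =
      (\<Union>n. {p \<in> flats K k \<times> origin_flats K q.
        fst p \<inter> snd p \<inter> cball 0 (tanh (sqrt (- K) * (r - 1 / real (Suc n))) / sqrt (- K)) \<noteq> {}})"
      unfolding sp real using origin_dist_less_iff[OF K sub, of _ r] by blast
    have lt: "tanh (sqrt (- K) * z) / sqrt (- K) < 1 / sqrt (- K)" for z
      using K tanh_real_lt_1 by (simp add: divide_strict_right_mono)
    show ?thesis unfolding eq by (intro sets.countable_nat_UN image_subsetI sets_meet_cball K lt)
  next
    case top
    have H: "hyp_space K = ball (0::'a) (1 / sqrt (- K))" by (simp add: hyp_space_def)
    have "origin_dist K (fst p \<inter> snd p) < y \<longleftrightarrow> fst p \<inter> snd p \<inter> ball 0 (1 / sqrt (- K)) \<noteq> {}"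
      if "p \<in> flats K k \<times> origin_flats K q" for p :: "'a set \<times> 'a set"
    proof -
      have "fst p \<inter> snd p \<inter> ball 0 (1 / sqrt (- K)) = fst p \<inter> snd p"
        using sub[OF that] unfolding H by (rule Int_absorb2)
      then show ?thesis using origin_dist_less_top_iff[of K "fst p \<inter> snd p"] by (simp add: top)
    qed
    then have "{p \<in> space ?M. origin_dist K (fst p \<inter> snd p) < y} =
      {p \<in> flats K k \<times> origin_flats K q. fst p \<inter> snd p \<inter> ball 0 (1 / sqrt (- K)) \<noteq> {}}"
      unfolding sp by (intro Collect_cong conj_cong refl)
    then show ?thesis using sets_meet_ball[OF K, of "1 / sqrt (- K)" k q] K by simp
  qed
qed

section \<open>The joint law\<close>

text \<open>
  In the following \<open>Q\<close> is the law of \<open>E\<close>, \<open>b\<close> is the Euclidean radius of the ball of hyperbolic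
  radius \<open>u\<close>, and \<open>w\<close> bounds the weights in the invariant measure.
\<close>

context
  fixes K u b D w :: real and k m q :: nat and \<nu>m \<nu>q :: "'a::euclidean_space set measure"
    and Q :: "'a set measure"
  assumes K: "K < 0" and u: "0 < u" and b_def: "b = tanh (sqrt (- K) * u) / sqrt (- K)"
    and m: "m + k = DIM('a)" "1 \<le> m" "m \<le> q" and q: "q < DIM('a)"
    and \<nu>m: "invariant_origin_flat_prob K m \<nu>m" and \<nu>q: "invariant_origin_flat_prob K q \<nu>q"
    and nz: "emeasure (flat_measure K k \<nu>m) (hitting_flats K k b) \<noteq> 0"
    and fin: "emeasure (flat_measure K k \<nu>m) (hitting_flats K k b) \<noteq> \<infinity>"
    and Q_def: "Q = uniform_measure (flat_measure K k \<nu>m) (hitting_flats K k b)"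
    and D_def: "D = distortion K b" and w_def: "w = cosh (sqrt (- K) * u) ^ k"
begin

lemmas b_bounds' = klein_radius_bounds[OF K u b_def]

lemma D_ge_1: "1 \<le> D" and w_ge_1: "1 \<le> w"
proof -
  have c: "0 < 1 + K * b\<^sup>2" "1 + K * b\<^sup>2 \<le> 1" using b_bounds' K by (auto simp: mult_le_0_iff)
  have "(1 + K * b\<^sup>2) ^ 3 \<le> 1" using c by (intro power_le_one) auto
  then have "(1 + K * b\<^sup>2) ^ 3 \<le> 2" by simp
  then show "1 \<le> D" using c unfolding D_def distortion_def by (subst le_divide_eq_1_pos) auto
  show "1 \<le> w" unfolding w_def by (simp add: cosh_real_ge_1)
qed

lemma space_\<nu>m: "space \<nu>m = origin_flats K m"
  using \<nu>m by (simp add: invariant_origin_flat_prob_def)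

lemma prob_space_Q: "prob_space Q"
  unfolding Q_def by (rule prob_space_uniform_measure[OF nz fin])

lemma sets_Q: "sets Q = sets (fell_borel K (flats K k))" and space_Q: "space Q = flats K k"
  by (simp_all add: Q_def)

lemma sets_\<nu>q: "sets \<nu>q = sets (fell_borel K (origin_flats K q))" and space_\<nu>q: "space \<nu>q = origin_flats K q"
  and prob_space_\<nu>q: "prob_space \<nu>q"
  using \<nu>q by (simp_all add: invariant_origin_flat_prob_def)

lemma sets_hit: "s \<le> b \<Longrightarrow> (hitting_flats K k s :: 'a set set) \<in> sets (fell_borel K (flats K k))"
  using b_bounds' by (intro sets_hitting_flats[OF K]) auto

lemma emeasure_Q:
  "X \<in> sets (fell_borel K (flats K k)) \<Longrightarrow> emeasure Q X =
    emeasure (flat_measure K k \<nu>m) (hitting_flats K k b \<inter> X) / emeasure (flat_measure K k \<nu>m) (hitting_flats K k b)"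
  using sets_hit[OF order_refl] by (simp add: Q_def)

lemma Q_le:
  assumes "X \<in> sets (fell_borel K (flats K k))" "0 \<le> c"
    and "emeasure (flat_measure K k \<nu>m) (hitting_flats K k b \<inter> X) \<le>
      ennreal c * emeasure (flat_measure K k \<nu>m) (hitting_flats K k b)"
  shows "emeasure Q X \<le> ennreal c"
  unfolding emeasure_Q[OF assms(1)] using assms(3) nz
  by (intro divide_le_posI_ennreal) (auto simp: mult.commute zero_less_iff_neq_zero)

lemma Q_hitting_flats_le:
  assumes "0 < s" "s \<le> b"
  shows "emeasure Q (hitting_flats K k s) \<le> ennreal (w * (D * (s / b)) ^ m)"
proof (rule Q_le)
  show "emeasure (flat_measure K k \<nu>m) (hitting_flats K k b \<inter> hitting_flats K k s) \<le>
      ennreal (w * (D * (s / b)) ^ m) * emeasure (flat_measure K k \<nu>m) (hitting_flats K k b)"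
    using flat_measure_hitting_flats_le[OF K u b_def m(1) space_\<nu>m nz assms b_bounds'(1) order_refl]
    by (simp add: D_def w_def hitting_flats_Int[OF assms(2)])
qed (use assms w_ge_1 D_ge_1 in \<open>auto intro!: sets_hit mult_nonneg_nonneg\<close>)

lemma Q_hitting_flats_ge:
  assumes "0 < s" "s \<le> b"
  shows "ennreal ((s / (b * D)) ^ m / w) \<le> emeasure Q (hitting_flats K k s)"
proof -
  let ?F = "emeasure (flat_measure K k \<nu>m)"
  define c where "c = w * (D * (b / s)) ^ m"
  have c: "0 < c" using assms w_ge_1 D_ge_1 b_bounds' by (auto simp: c_def intro!: mult_pos_pos zero_less_power divide_pos_pos)
  have Q: "emeasure Q (hitting_flats K k s) = ?F (hitting_flats K k s) / ?F (hitting_flats K k b)"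
    using emeasure_Q[OF sets_hit[OF assms(2)]] by (simp add: hitting_flats_Int[OF assms(2)])
  have "?F (hitting_flats K k b) \<le> ennreal c * ?F (hitting_flats K k s)"
    using flat_measure_hitting_flats_le[OF K u b_def m(1) space_\<nu>m nz b_bounds'(1) order_refl assms]
    by (simp add: D_def w_def c_def)
  then have "ennreal (1 / c) * ?F (hitting_flats K k b) \<le> ennreal (1 / c) * (ennreal c * ?F (hitting_flats K k s))"
    by (rule mult_left_mono) simp
  also have "\<dots> = ?F (hitting_flats K k s)" using c by (simp flip: mult.assoc ennreal_mult)
  finally have "ennreal (1 / c) * ?F (hitting_flats K k b) / ?F (hitting_flats K k b) \<le> emeasure Q (hitting_flats K k s)"
    unfolding Q by (rule divide_right_mono_ennreal)
  then have "ennreal (1 / c) \<le> emeasure Q (hitting_flats K k s)"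
    using nz fin by (simp add: mult_divide_eq_ennreal)
  moreover have "1 / c = (s / (b * D)) ^ m / w"
    using assms by (simp add: c_def power_divide power_mult_distrib field_simps)
  ultimately show ?thesis by simp
qed

lemma Q_shell_le:
  assumes V: "V \<in> origin_flats K q" and J: "J > 0" and X: "X \<in> sets (fell_borel K (flats K k))"
    and far: "\<And>E. E \<in> X \<Longrightarrow> E \<inter> V \<noteq> {} \<and> E \<inter> V \<inter> ball 0 ((1 - 1 / (2 * real J)) / sqrt (- K)) = {}"
  shows "emeasure Q X \<le> ennreal (w * (2 * D) ^ m / real J)"
proof (rule Q_le[OF X])
  show "emeasure (flat_measure K k \<nu>m) (hitting_flats K k b \<inter> X) \<le>
      ennreal (w * (2 * D) ^ m / real J) * emeasure (flat_measure K k \<nu>m) (hitting_flats K k b)"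
    unfolding D_def w_def using far
    by (intro flat_measure_shell_le[OF K u b_def m(1) space_\<nu>m nz V J] sets.Int sets_hit X) auto
qed (use w_ge_1 D_ge_1 in auto)

abbreviation "joint \<equiv> Q \<Otimes>\<^sub>M \<nu>q"

lemma sets_joint: "sets joint = sets (meet_space K k q)"
  and space_joint: "space joint = flats K k \<times> origin_flats K q"
  by (simp_all add: sets_pair_measure_cong[OF sets_Q sets_\<nu>q] space_pair_measure space_Q space_\<nu>q)

lemma pair_prob_joint: "pair_prob_space Q \<nu>q" and prob_space_joint: "prob_space joint"
proof -
  interpret Q: prob_space Q by (rule prob_space_Q)
  interpret \<nu>: prob_space \<nu>q by (rule prob_space_\<nu>q)
  interpret P: pair_prob_space Q \<nu>q ..
  show "pair_prob_space Q \<nu>q" "prob_space joint" by unfold_locales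
qed

lemma emeasure_joint_by_E:
  "S \<in> sets joint \<Longrightarrow> emeasure joint S = (\<integral>\<^sup>+E. emeasure \<nu>q (Pair E -` S) \<partial>Q)"
proof -
  interpret P: pair_prob_space Q \<nu>q by (rule pair_prob_joint)
  show "S \<in> sets joint \<Longrightarrow> ?thesis" by (rule P.M2.emeasure_pair_measure_alt)
qed

lemma emeasure_joint_by_L:
  "S \<in> sets joint \<Longrightarrow> emeasure joint S = (\<integral>\<^sup>+V. emeasure Q ((\<lambda>E. (E, V)) -` S) \<partial>\<nu>q)"
proof -
  interpret P: pair_prob_space Q \<nu>q by (rule pair_prob_joint)
  show "S \<in> sets joint \<Longrightarrow> ?thesis" by (rule P.emeasure_pair_measure_alt2)
qed

abbreviation "meet_dist p \<equiv> origin_dist K (fst p \<inter> snd p)"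

lemma measurable_meet_dist: "meet_dist \<in> borel_measurable joint"
  unfolding measurable_cong_sets[OF sets_joint refl] by (rule borel_measurable_origin_dist_meet[OF K])

lemma joint_sub: "p \<in> space joint \<Longrightarrow> fst p \<inter> snd p \<subseteq> hyp_space K"
  using closedin_Int_flats[of "fst p" K k "snd p" q] by (auto simp: space_joint)

lemma flat_cases:
  assumes "(E :: 'a set) \<in> flats K k"
  obtains W x where "subspace W" "dim W = m" "x \<in> W" "x \<in> hyp_space K" "E = perp_flat K W x"
proof -
  obtain W x where "subspace W" "dim W + k = DIM('a)" "x \<in> W \<inter> hyp_space K" "E = perp_flat K W x"
    by (rule flats_eq_perp_flat[OF assms])
  then show thesis using m(1) by (intro that[of W x]) auto
qed

text \<open>A point of \<open>E \<inter> L\<close> at hyperbolic distance at most \<open>r\<close> lies in \<open>E \<inter> cball 0 (2 r)\<close>; the factor \<open>2\<close> is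
  slack for the infimum in the distance. For radii beyond \<open>b\<close> the trivial bound \<open>1\<close> is
  absorbed by the constant.\<close>

lemma joint_small_le:
  obtains C where "0 \<le> C"
    "\<And>n. emeasure joint {p \<in> space joint. meet_dist p \<le> ennreal ((1 / 2) ^ n)} \<le> ennreal (C * (1 / 2) ^ (n * m))"
proof
  define C where "C = (1 + w * D ^ m) * (2 / b) ^ m"
  show "0 \<le> C" using w_ge_1 D_ge_1 b_bounds' by (auto simp: C_def)
  fix n
  define r where "r = (1 / 2 :: real) ^ n"
  have r: "0 < r" by (simp add: r_def)
  have C: "C * (1 / 2) ^ (n * m) = (1 + w * D ^ m) * (2 * r / b) ^ m"
    by (simp add: C_def r_def power_mult power_mult_distrib power_divide)
  have le1: "emeasure joint X \<le> 1" for X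
    using prob_space.emeasure_le_1[OF prob_space_joint] .
  show "emeasure joint {p \<in> space joint. meet_dist p \<le> ennreal ((1 / 2) ^ n)} \<le> ennreal (C * (1 / 2) ^ (n * m))"
  proof (cases "2 * r \<le> b")
    case False
    then have "1 \<le> (2 * r / b) ^ m" using b_bounds' by (intro one_le_power) simp
    then have "1 * 1 \<le> (1 + w * D ^ m) * (2 * r / b) ^ m"
      using w_ge_1 D_ge_1 by (intro mult_mono) auto
    then have "ennreal 1 \<le> ennreal (C * (1 / 2) ^ (n * m))" unfolding C by (intro ennreal_leI) simp
    then show ?thesis by (intro order_trans[OF le1]) simp
  next
    case True
    have "{p \<in> space joint. meet_dist p \<le> ennreal r} \<subseteq> hitting_flats K k (2 * r) \<times> space \<nu>q"
    proof
      fix p assume p: "p \<in> {p \<in> space joint. meet_dist p \<le> ennreal r}"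
      then have "fst p \<inter> snd p \<inter> cball 0 (2 * r) \<noteq> {}"
        using r by (intro hits_cball_if_origin_dist_le[OF K joint_sub, where r = r]) auto
      then show "p \<in> hitting_flats K k (2 * r) \<times> space \<nu>q"
        using p by (cases p) (auto simp: hitting_flats_def space_joint space_\<nu>q)
    qed
    moreover have X: "hitting_flats K k (2 * r) \<in> sets Q" using sets_hit[OF True] by (simp add: sets_Q)
    ultimately have "emeasure joint {p \<in> space joint. meet_dist p \<le> ennreal r} \<le>
        emeasure joint (hitting_flats K k (2 * r) \<times> space \<nu>q)"
      by (intro emeasure_mono) auto
    also have "\<dots> = emeasure Q (hitting_flats K k (2 * r)) * emeasure \<nu>q (space \<nu>q)"
    proof -
      interpret P: pair_prob_space Q \<nu>q by (rule pair_prob_joint)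
      show ?thesis using X by (intro P.M2.emeasure_pair_measure_Times) auto
    qed
    also have "\<dots> = emeasure Q (hitting_flats K k (2 * r))"
      using prob_space.emeasure_space_1[OF prob_space_\<nu>q] by simp
    also have "\<dots> \<le> ennreal (w * (D * (2 * r / b)) ^ m)"
      using Q_hitting_flats_le[of "2 * r"] r True by simp
    also have "\<dots> \<le> ennreal (C * (1 / 2) ^ (n * m))"
      unfolding C power_mult_distrib using r b_bounds'
      by (intro ennreal_leI) (simp add: distrib_right mult.assoc)
    finally show ?thesis unfolding r_def .
  qed
qed

text \<open>If \<open>E\<close> hits \<open>cball 0 s\<close>, then a transversal \<open>L\<close> meets \<open>E\<close> within \<open>cball 0 (2 s)\<close>, where hyperbolic
  distances from the origin are at most twice the Euclidean ones. The bound on \<open>\<sigma>\<close> by a quarter of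
  the radius of the Klein ball serves both of these purposes, and \<open>\<sigma> \<le> 1 / 4\<close> ensures \<open>t \<le> 1\<close>.\<close>

lemma joint_small_ge:
  obtains t c where "0 < t" "t \<le> 1" "0 < c"
    "\<And>n. ennreal (c * (1 / 2) ^ (n * m)) \<le> emeasure joint {p \<in> space joint. meet_dist p \<le> ennreal (t * (1 / 2) ^ n)}"
proof -
  obtain pe where pe: "pe > 0" "\<And>W. subspace W \<Longrightarrow> dim W = m \<Longrightarrow> emeasure \<nu>q (transversal_flats K q W) = pe"
    using prob_transversal_flats_bounded_below[OF \<nu>q K _ m(3)] q by auto
  obtain \<pi> :: real where \<pi>: "0 < \<pi>" "ennreal \<pi> \<le> pe"
  proof (cases pe)
    case (real r)
    then show thesis using pe(1) by (intro that[of r]) auto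
  next
    case top
    then show thesis by (intro that[of 1]) auto
  qed
  define \<sigma> where "\<sigma> = min (min b (1 / (4 * sqrt (- K)))) (1 / 4)"
  have \<sigma>: "0 < \<sigma>" "\<sigma> \<le> b" "\<sigma> \<le> 1 / (4 * sqrt (- K))" "\<sigma> \<le> 1 / 4" using b_bounds' K by (auto simp: \<sigma>_def)
  define c where "c = \<pi> * ((\<sigma> / (b * D)) ^ m / w)"
  show thesis
  proof
    show "0 < 4 * \<sigma>" "4 * \<sigma> \<le> 1" using \<sigma> by auto
    show "0 < c" using \<pi> \<sigma> b_bounds' D_ge_1 w_ge_1
      by (auto simp: c_def intro!: mult_pos_pos divide_pos_pos zero_less_power)
    fix n
    define s where "s = \<sigma> * (1 / 2) ^ n"
    have "(1 / 2 :: real) ^ n \<le> 1" by (rule power_le_one) auto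
    then have s: "0 < s" "s \<le> \<sigma>" using \<sigma> by (auto simp: s_def)
    have 2: "2 * s \<le> 1 / (2 * sqrt (- K))" "2 * s < 1 / sqrt (- K)"
    proof -
      show "2 * s \<le> 1 / (2 * sqrt (- K))" using s \<sigma> by simp
      also have "\<dots> < 1 / sqrt (- K)" using K by (simp add: field_simps)
      finally show "2 * s < 1 / sqrt (- K)" .
    qed
    let ?S = "{p \<in> flats K k \<times> origin_flats K q :: ('a set \<times> 'a set) set. fst p \<inter> snd p \<inter> cball 0 (2 * s) \<noteq> {}}"
    have S: "?S \<in> sets joint" unfolding sets_joint by (rule sets_meet_cball[OF K 2(2)])
    have hitS: "hitting_flats K k s \<in> sets Q" using sets_hit[of s] s \<sigma> by (simp add: sets_Q)
    have "c * (1 / 2) ^ (n * m) = \<pi> * ((s / (b * D)) ^ m / w)"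
      by (simp add: c_def s_def power_mult power_mult_distrib power_divide)
    moreover have "0 \<le> (s / (b * D)) ^ m / w" using s b_bounds' D_ge_1 w_ge_1 by auto
    ultimately have "ennreal (c * (1 / 2) ^ (n * m)) = ennreal \<pi> * ennreal ((s / (b * D)) ^ m / w)"
      using \<pi>(1) by (simp only: ennreal_mult less_imp_le)
    also have "\<dots> \<le> ennreal \<pi> * emeasure Q (hitting_flats K k s)"
      using Q_hitting_flats_ge[of s] s \<sigma> by (intro mult_left_mono) auto
    also have "\<dots> = (\<integral>\<^sup>+E. ennreal \<pi> * indicator (hitting_flats K k s) E \<partial>Q)"
      using hitS by (simp add: nn_integral_cmult_indicator)
    also have "\<dots> \<le> (\<integral>\<^sup>+E. emeasure \<nu>q (Pair E -` ?S) \<partial>Q)"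
    proof (rule nn_integral_mono)
      fix E assume "E \<in> space Q"
      then have E: "E \<in> flats K k" by (simp add: space_Q)
      show "ennreal \<pi> * indicator (hitting_flats K k s) E \<le> emeasure \<nu>q (Pair E -` ?S)"
      proof (cases "E \<in> hitting_flats K k s")
        case True
        obtain W x where W: "subspace W" "dim W = m" "x \<in> W" "x \<in> hyp_space K" "E = perp_flat K W x"
          by (rule flat_cases[OF E])
        have x: "norm x \<le> s"
          using True perp_flat_hits_cball_iff[OF W(1,3,4)] by (simp add: hitting_flats_def W(5))
        also have "s \<le> 1 / (3 * sqrt (- K))"
          using s \<sigma>(3) K by (elim order_trans) (simp add: field_simps)
        finally have x3: "norm x \<le> 1 / (3 * sqrt (- K))" .
        have "transversal_flats K q W \<subseteq> Pair E -` ?S"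
        proof
          fix V assume V: "V \<in> transversal_flats K q W"
          then have "V \<inter> perp_flat K W x \<inter> cball 0 (2 * norm x) \<noteq> {}" "V \<in> origin_flats K q"
            using W(3) x3 by (auto simp: transversal_flats_def)
          moreover have "cball 0 (2 * norm x) \<subseteq> cball (0::'a) (2 * s)" using x by auto
          ultimately have "E \<inter> V \<inter> cball 0 (2 * s) \<noteq> {}" unfolding W(5) by blast
          then show "V \<in> Pair E -` ?S" using E \<open>V \<in> origin_flats K q\<close> by simp
        qed
        then have "pe \<le> emeasure \<nu>q (Pair E -` ?S)"
          unfolding pe(2)[OF W(1,2), symmetric] by (rule emeasure_mono[OF _ sets_Pair1[OF S]])
        then show ?thesis using True \<pi>(2) by simp
      qed simp
    qed
    also have "\<dots> = emeasure joint ?S" by (rule emeasure_joint_by_E[OF S, symmetric])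
    also have "\<dots> \<le> emeasure joint {p \<in> space joint. meet_dist p \<le> ennreal (4 * \<sigma> * (1 / 2) ^ n)}"
    proof (rule emeasure_mono)
      show "{p \<in> space joint. meet_dist p \<le> ennreal (4 * \<sigma> * (1 / 2) ^ n)} \<in> sets joint"
        using measurable_meet_dist by measurable
      show "?S \<subseteq> {p \<in> space joint. meet_dist p \<le> ennreal (4 * \<sigma> * (1 / 2) ^ n)}"
      proof
        fix p assume p: "p \<in> ?S"
        then obtain y where "y \<in> fst p \<inter> snd p \<inter> cball 0 (2 * s)" by blast
        then have y: "y \<in> fst p \<inter> snd p" "norm y \<le> 2 * s" by auto
        have "hyp_dist K 0 y \<le> 2 * norm y" using y(2) 2(1) by (intro hyp_dist_0_le_mult[OF K]) simp
        then have "hyp_dist K 0 y \<le> 4 * \<sigma> * (1 / 2) ^ n" using y(2) by (simp add: s_def)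
        then show "p \<in> {p \<in> space joint. meet_dist p \<le> ennreal (4 * \<sigma> * (1 / 2) ^ n)}"
          using p origin_dist_le[OF y(1)] by (simp add: space_joint)
      qed
    qed
    finally show "ennreal (c * (1 / 2) ^ (n * m)) \<le>
        emeasure joint {p \<in> space joint. meet_dist p \<le> ennreal (4 * \<sigma> * (1 / 2) ^ n)}" .
  qed
qed

lemma sets_joint_meet: "{p \<in> space joint. fst p \<inter> snd p \<noteq> {}} \<in> sets joint"
proof -
  have H: "hyp_space K = ball (0::'a) (1 / sqrt (- K))" by (simp add: hyp_space_def)
  have "{p \<in> space joint. fst p \<inter> snd p \<noteq> {}} =
      {p \<in> flats K k \<times> origin_flats K q. fst p \<inter> snd p \<inter> ball 0 (1 / sqrt (- K)) \<noteq> {}}"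
    using joint_sub unfolding H space_joint by blast
  then show ?thesis using sets_meet_ball[OF K, of "1 / sqrt (- K)" k q] K by (simp add: sets_joint)
qed

text \<open>Otherwise almost every \<open>E\<close> would pass through the origin, by \<open>prob_missing_flat_pos\<close>. But \<open>E\<close> hits
  a sufficiently small ball with probability less than \<open>1\<close>.\<close>

lemma joint_disjoint_pos: "emeasure joint {p \<in> space joint. fst p \<inter> snd p = {}} > 0"
proof (rule ccontr)
  let ?S = "{p \<in> space joint. fst p \<inter> snd p = {}}"
  interpret Q: prob_space Q by (rule prob_space_Q)
  interpret P: pair_prob_space Q \<nu>q by (rule pair_prob_joint)
  have "?S = space joint - {p \<in> space joint. fst p \<inter> snd p \<noteq> {}}" by auto
  then have S: "?S \<in> sets joint" using sets_joint_meet by (simp only: sets.compl_sets)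
  assume "\<not> emeasure joint ?S > 0"
  then have "(\<integral>\<^sup>+E. emeasure \<nu>q (Pair E -` ?S) \<partial>Q) = 0"
    using emeasure_joint_by_E[OF S] by simp
  then have AE: "AE E in Q. emeasure \<nu>q (Pair E -` ?S) = 0"
    using P.M2.measurable_emeasure_Pair[OF S] by (simp add: nn_integral_0_iff_AE)
  \<comment> \<open>This radius makes \<open>w * (D * (s / b)) ^ m\<close> less than \<open>1\<close>, since \<open>m \<ge> 1\<close>.\<close>
  define s where "s = b / (D * (w + 1))"
  have DW: "1 \<le> D * (w + 1)" using D_ge_1 w_ge_1 mult_mono[of 1 D 1 "w + 1"] by simp
  have s: "0 < s" "s \<le> b" using b_bounds' DW D_ge_1 w_ge_1 by (auto simp: s_def divide_le_eq mult_le_cancel_left1)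
  have hit: "hitting_flats K k s \<in> sets Q" using sets_hit[OF s(2)] by (simp add: sets_Q)
  have "AE E in Q. E \<in> hitting_flats K k s"
    using AE AE_space
  proof eventually_elim
    fix E assume 0: "emeasure \<nu>q (Pair E -` ?S) = 0" and "E \<in> space Q"
    then have E: "E \<in> flats K k" by (simp add: space_Q)
    obtain W x where W: "subspace W" "dim W = m" "x \<in> W" "x \<in> hyp_space K" "E = perp_flat K W x"
      by (rule flat_cases[OF E])
    have "x = 0"
    proof (rule ccontr)
      assume "x \<noteq> 0"
      then have "emeasure \<nu>q {V \<in> origin_flats K q. V \<inter> E = {}} > 0"
        using E W by (auto intro!: prob_missing_flat_pos[OF \<nu>q K q])
      moreover have "{V \<in> origin_flats K q. V \<inter> E = {}} = Pair E -` ?S"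
        using E by (auto simp: space_joint)
      ultimately show False using 0 by simp
    qed
    then show "E \<in> hitting_flats K k s"
      using E s perp_flat_hits_cball_iff[OF W(1,3,4), of s] by (simp add: hitting_flats_def W(5))
  qed
  then have "emeasure Q (hitting_flats K k s) = 1" by (rule Q.emeasure_eq_1_AE[OF hit])
  moreover have "emeasure Q (hitting_flats K k s) \<le> ennreal (w * (1 / (w + 1)) ^ m)"
    using Q_hitting_flats_le[OF s] D_ge_1 b_bounds' by (simp add: s_def)
  moreover have "w * (1 / (w + 1)) ^ m < 1"
  proof -
    have "(1 / (w + 1)) ^ m \<le> (1 / (w + 1)) ^ 1" using m(2) w_ge_1 by (intro power_decreasing) auto
    then have "w * (1 / (w + 1)) ^ m \<le> w * (1 / (w + 1))" using w_ge_1 by (intro mult_left_mono) auto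
    also have "\<dots> < 1" using w_ge_1 by simp
    finally show ?thesis .
  qed
  ultimately have "ennreal 1 < ennreal 1" using w_ge_1
    by (metis ennreal_1 ennreal_lessI order.strict_trans1 zero_less_one)
  then show False by simp
qed

lemma joint_far_le:
  defines "B \<equiv> \<lambda>n. {p \<in> space joint. fst p \<inter> snd p \<noteq> {} \<and>
      fst p \<inter> snd p \<inter> ball 0 ((1 - (1 / 2) ^ (n + 1)) / sqrt (- K)) = {}}"
  shows "B n \<in> sets joint" and "emeasure joint (B n) \<le> ennreal (w * (2 * D) ^ m * (1 / 2) ^ n)"
proof -
  let ?t = "(1 - (1 / 2) ^ (n + 1)) / sqrt (- K)"
  have p: "(1 / 2 :: real) ^ (n + 1) < 1" using power_Suc_less_one[of "1 / 2 :: real" n] by simp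
  then have t: "0 < ?t" "?t \<le> 1 / sqrt (- K)" using K by (auto intro!: divide_pos_pos divide_right_mono)
  have eq: "B n = {p \<in> space joint. fst p \<inter> snd p \<noteq> {}} -
      {p \<in> flats K k \<times> origin_flats K q. fst p \<inter> snd p \<inter> ball 0 ?t \<noteq> {}}"
    by (auto simp: B_def space_joint)
  have "{p \<in> flats K k \<times> origin_flats K q. fst p \<inter> snd p \<inter> ball 0 ?t \<noteq> {}} \<in> sets joint"
    unfolding sets_joint by (rule sets_meet_ball[OF K t])
  then show S: "B n \<in> sets joint" unfolding eq by (rule sets.Diff[OF sets_joint_meet])
  have "emeasure joint (B n) = (\<integral>\<^sup>+V. emeasure Q ((\<lambda>E. (E, V)) -` B n) \<partial>\<nu>q)"
    by (rule emeasure_joint_by_L[OF S])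
  also have "\<dots> \<le> (\<integral>\<^sup>+V. ennreal (w * (2 * D) ^ m / real (2 ^ n)) \<partial>\<nu>q)"
  proof (rule nn_integral_mono)
    fix V assume "V \<in> space \<nu>q"
    then have V: "V \<in> origin_flats K q" by (simp add: space_\<nu>q)
    have "1 / (2 * real (2 ^ n)) = (1 / 2) ^ (n + 1)" by (simp add: power_one_over)
    then have e: "1 - 1 / (2 * real (2 ^ n)) = 1 - (1 / 2) ^ (n + 1)" by (simp only:)
    show "emeasure Q ((\<lambda>E. (E, V)) -` B n) \<le> ennreal (w * (2 * D) ^ m / real (2 ^ n))"
    proof (rule Q_shell_le[OF V])
      show "(\<lambda>E. (E, V)) -` B n \<in> sets (fell_borel K (flats K k))"
        using sets_Pair2[OF S, of V] by (simp only: sets_Q)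
      fix E assume "E \<in> (\<lambda>E. (E, V)) -` B n"
      then show "E \<inter> V \<noteq> {} \<and> E \<inter> V \<inter> ball 0 ((1 - 1 / (2 * real (2 ^ n))) / sqrt (- K)) = {}"
        unfolding e B_def by simp
    qed simp
  qed
  also have "\<dots> = ennreal (w * (2 * D) ^ m * (1 / 2) ^ n)"
    using prob_space.emeasure_space_1[OF prob_space_\<nu>q] by (simp add: power_one_over)
  finally show "emeasure joint (B n) \<le> ennreal (w * (2 * D) ^ m * (1 / 2) ^ n)" .
qed

end

section \<open>Moments of the distance\<close>

text \<open>The estimates for the joint law are transported to \<open>M\<close> along \<open>\<omega> \<mapsto> (E \<omega>, L \<omega>)\<close>, whose law is the
  product measure by independence.\<close>

theorem corollary3p5:
  fixes K u :: real and q \<gamma> :: nat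
    and \<nu> :: "nat \<Rightarrow> 'a::euclidean_space set measure"
    and M :: "'w measure" and L E :: "'w \<Rightarrow> 'a set"
  assumes "DIM('a) \<ge> 2" and "1 \<le> q" and "q \<le> DIM('a) - 1" and "\<gamma> \<le> q - 1"
    and "u > 0" and "K < 0"
    and "\<And>k. k \<le> DIM('a) \<Longrightarrow> invariant_origin_flat_prob K k (\<nu> k)"
    and "prob_space M"
    and "L \<in> measurable M (fell_borel K (origin_flats K q))"
    and "distr M (fell_borel K (origin_flats K q)) L = \<nu> q"
    and "E \<in> measurable M (fell_borel K (flats K (DIM('a) - q + \<gamma>)))"
    and "distr M (fell_borel K (flats K (DIM('a) - q + \<gamma>))) E =
           hitting_flat_distribution K (DIM('a) - q + \<gamma>) u (\<nu> (q - \<gamma>))"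
    and "prob_space.indep_var M
           (fell_borel K (flats K (DIM('a) - q + \<gamma>))) E
           (fell_borel K (origin_flats K q)) L"
  shows "(\<forall>\<alpha>::real.
            (\<integral>\<^sup>+\<omega>. ennreal_powr (origin_dist K (E \<omega> \<inter> L \<omega>)) \<alpha> \<partial>M) < \<infinity>
              \<longleftrightarrow> \<alpha> \<in> {real \<gamma> - real q <.. 0}) \<and>
         emeasure M {\<omega> \<in> space M. origin_dist K (E \<omega> \<inter> L \<omega>) < \<infinity>} > 0 \<and>
         (\<forall>\<alpha>>0.
            (\<integral>\<^sup>+\<omega>. ennreal_powr (origin_dist K (E \<omega> \<inter> L \<omega>)) \<alpha>
               \<partial>uniform_measure M {\<omega> \<in> space M. origin_dist K (E \<omega> \<inter> L \<omega>) < \<infinity>}) < \<infinity>)"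
proof -
  define k where "k = DIM('a) - q + \<gamma>"
  define m where "m = q - \<gamma>"
  have mk: "m + k = DIM('a)" "1 \<le> m" "m \<le> q" and q: "q < DIM('a)" "real m = real q - real \<gamma>"
    using assms(1-4) by (auto simp: m_def k_def)
  note u = assms(5) and K = assms(6)
  have \<nu>m: "invariant_origin_flat_prob K m (\<nu> m)" and \<nu>q: "invariant_origin_flat_prob K q (\<nu> q)"
    using mk q by (auto intro: assms(7))
  interpret M: prob_space M by fact
  define b where "b = tanh (sqrt (- K) * u) / sqrt (- K)"
  define Q where "Q = uniform_measure (flat_measure K k (\<nu> m)) (hitting_flats K k b)"
  have E: "E \<in> measurable M (fell_borel K (flats K k))" and L: "L \<in> measurable M (fell_borel K (origin_flats K q))"
    using assms(9,11) by (auto simp: k_def)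
  have Q: "distr M (fell_borel K (flats K k)) E = Q"
    using assms(12) by (simp add: Q_def k_def m_def b_def hitting_flat_distribution_def flats_hitting_ball_eq[OF K])
  have hit: "hitting_flats K k b \<in> sets (fell_borel K (flats K k :: 'a set set))"
    using klein_radius_bounds[OF K u b_def] by (intro sets_hitting_flats[OF K])
  have "emeasure Q (flats K k) = 1"
    unfolding Q[symmetric] using prob_space.emeasure_space_1[OF M.prob_space_distr[OF E]] by simp
  moreover have "hitting_flats K k b \<inter> flats K k = (hitting_flats K k b :: 'a set set)" by (auto simp: hitting_flats_def)
  moreover have "flats K k \<in> sets (fell_borel K (flats K k :: 'a set set))"
    using sets.top[of "fell_borel K (flats K k :: 'a set set)"] by simp
  \<comment> \<open>In \<open>[0, \<infinity>]\<close> the quotients \<open>0 / 0\<close> and \<open>\<infinity> / \<infinity>\<close> are \<open>0\<close>, so that total mass \<open>1\<close> excludes both cases.\<close>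
  ultimately have "emeasure (flat_measure K k (\<nu> m)) (hitting_flats K k b) /
      emeasure (flat_measure K k (\<nu> m)) (hitting_flats K k b) = 1"
    using hit by (simp add: Q_def)
  then have nz: "emeasure (flat_measure K k (\<nu> m)) (hitting_flats K k b) \<noteq> 0"
    and fin: "emeasure (flat_measure K k (\<nu> m)) (hitting_flats K k b) \<noteq> \<infinity>"
    by (auto simp: divide_ennreal_def)
  note ctx = K u b_def mk q(1) \<nu>m \<nu>q nz fin Q_def refl refl
  let ?J = "Q \<Otimes>\<^sub>M \<nu> q"
  let ?R = "\<lambda>\<omega>. origin_dist K (E \<omega> \<inter> L \<omega>)"
  have EL: "(\<lambda>\<omega>. (E \<omega>, L \<omega>)) \<in> measurable M ?J"
    unfolding measurable_cong_sets[OF refl sets_joint[OF ctx]] using E L by (rule measurable_Pair)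
  have "distr M (fell_borel K (flats K k) \<Otimes>\<^sub>M fell_borel K (origin_flats K q)) (\<lambda>\<omega>. (E \<omega>, L \<omega>)) = ?J"
    using assms(13) Q assms(10) unfolding M.indep_var_distribution_eq k_def by simp
  then have J: "distr M ?J (\<lambda>\<omega>. (E \<omega>, L \<omega>)) = ?J"
    by (simp cong: distr_cong add: distr_cong[OF refl sets_joint[OF ctx] refl])
  have law: "emeasure M {\<omega> \<in> space M. P (E \<omega> \<inter> L \<omega>)} = emeasure ?J {p \<in> space ?J. P (fst p \<inter> snd p)}"
    "{\<omega> \<in> space M. P (E \<omega> \<inter> L \<omega>)} \<in> sets M"
    if P: "{p \<in> space ?J. P (fst p \<inter> snd p)} \<in> sets ?J" for P
  proof -
    have pre: "(\<lambda>\<omega>. (E \<omega>, L \<omega>)) -` {p \<in> space ?J. P (fst p \<inter> snd p)} \<inter> space M = {\<omega> \<in> space M. P (E \<omega> \<inter> L \<omega>)}"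
      using measurable_space[OF EL] by auto
    show "{\<omega> \<in> space M. P (E \<omega> \<inter> L \<omega>)} \<in> sets M"
      using measurable_sets[OF EL P] by (simp only: pre)
    have "emeasure ?J {p \<in> space ?J. P (fst p \<inter> snd p)} =
        emeasure (distr M ?J (\<lambda>\<omega>. (E \<omega>, L \<omega>))) {p \<in> space ?J. P (fst p \<inter> snd p)}" by (simp only: J)
    also have "\<dots> = emeasure M {\<omega> \<in> space M. P (E \<omega> \<inter> L \<omega>)}"
      by (simp only: emeasure_distr[OF EL P] pre)
    finally show "emeasure M {\<omega> \<in> space M. P (E \<omega> \<inter> L \<omega>)} = emeasure ?J {p \<in> space ?J. P (fst p \<inter> snd p)}" by simp
  qed
  have dist: "(\<lambda>p. origin_dist K (fst p \<inter> snd p)) \<in> borel_measurable ?J" by (rule measurable_meet_dist[OF ctx])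
  have R: "?R \<in> borel_measurable M"
    using measurable_compose[OF EL dist] by simp
  have le: "emeasure M {\<omega> \<in> space M. ?R \<omega> \<le> r} = emeasure ?J {p \<in> space ?J. origin_dist K (fst p \<inter> snd p) \<le> r}" for r
    using dist by (intro law(1)) measurable
  have neg_fin: "(\<integral>\<^sup>+\<omega>. ennreal_powr (?R \<omega>) (- s) \<partial>M) < \<infinity>" if s: "0 < s" "s < real m" for s
  proof -
    obtain C where C: "0 \<le> C" "\<And>n. emeasure M {\<omega> \<in> space M. ?R \<omega> \<le> ennreal ((1 / 2) ^ n)} \<le> ennreal (C * (1 / 2) ^ (n * m))"
      unfolding le by (rule joint_small_le[OF ctx]) blast
    show ?thesis by (rule nn_integral_negative_powr_finite[OF assms(8) R s C])
  qed
  have neg_inf: "(\<integral>\<^sup>+\<omega>. ennreal_powr (?R \<omega>) (- s) \<partial>M) = \<infinity>" if s: "real m \<le> s" for s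
  proof -
    obtain t c where tc: "0 < t" "t \<le> 1" "0 < c"
      "\<And>n. ennreal (c * (1 / 2) ^ (n * m)) \<le> emeasure M {\<omega> \<in> space M. ?R \<omega> \<le> ennreal (t * (1 / 2) ^ n)}"
      unfolding le by (rule joint_small_ge[OF ctx]) blast
    show ?thesis by (rule nn_integral_negative_powr_eq_top[OF R mk(2) s tc])
  qed
  have meet: "{\<omega> \<in> space M. ?R \<omega> < \<infinity>} = {\<omega> \<in> space M. E \<omega> \<inter> L \<omega> \<noteq> {}}"
    by (simp only: origin_dist_less_top_iff)
  have pos_inf: "(\<integral>\<^sup>+\<omega>. ennreal_powr (?R \<omega>) a \<partial>M) = \<infinity>" if a: "a > 0" for a
  proof (rule nn_integral_powr_eq_top_of_top[OF a])
    have "?R \<omega> = \<infinity> \<longleftrightarrow> E \<omega> \<inter> L \<omega> = {}" for \<omega>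
      using origin_dist_less_top_iff[of K "E \<omega> \<inter> L \<omega>"] by (auto simp: less_top)
    then have eq: "{\<omega> \<in> space M. ?R \<omega> = \<infinity>} = {\<omega> \<in> space M. E \<omega> \<inter> L \<omega> = {}}" by simp
    have S: "{p \<in> space ?J. fst p \<inter> snd p = {}} \<in> sets ?J"
      using joint_disjoint_pos[OF ctx] emeasure_neq_0_sets[of ?J "{p \<in> space ?J. fst p \<inter> snd p = {}}"] by auto
    show "emeasure M {\<omega> \<in> space M. ?R \<omega> = \<infinity>} > 0"
      unfolding eq law(1)[of "\<lambda>F. F = {}", OF S] by (rule joint_disjoint_pos[OF ctx])
  qed
  have meet_pos: "emeasure M {\<omega> \<in> space M. ?R \<omega> < \<infinity>} > 0"
  proof -
    obtain t c where tc: "0 < c"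
      "\<And>n. ennreal (c * (1 / 2) ^ (n * m)) \<le> emeasure M {\<omega> \<in> space M. ?R \<omega> \<le> ennreal (t * (1 / 2) ^ n)}"
      unfolding le by (rule joint_small_ge[OF ctx]) blast
    have "0 < ennreal c" using tc(1) by simp
    also have "\<dots> \<le> emeasure M {\<omega> \<in> space M. ?R \<omega> \<le> ennreal t}" using tc(2)[of 0] by simp
    also have "\<dots> \<le> emeasure M {\<omega> \<in> space M. ?R \<omega> < \<infinity>}"
    proof (rule emeasure_mono)
      show "{\<omega> \<in> space M. ?R \<omega> < \<infinity>} \<in> sets M" using R by measurable
    qed (auto intro: le_less_trans)
    finally show ?thesis .
  qed
  define c where "c = 1 / sqrt (- K)"
  define B where "B n = {\<omega> \<in> space M. E \<omega> \<inter> L \<omega> \<noteq> {} \<and>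
      E \<omega> \<inter> L \<omega> \<inter> ball 0 ((1 - (1 / 2) ^ (n + 1)) / sqrt (- K)) = {}}" for n
  have pos_fin: "(\<integral>\<^sup>+\<omega>. ennreal_powr (?R \<omega>) a \<partial>uniform_measure M {\<omega> \<in> space M. ?R \<omega> < \<infinity>}) < \<infinity>"
    if a: "a > 0" for a
  proof (rule nn_integral_positive_powr_finite[OF assms(8) _ meet_pos _ a])
    show "{\<omega> \<in> space M. ?R \<omega> < \<infinity>} \<in> sets M" using R by measurable
    show "0 < c" using K by (simp add: c_def)
    let ?C = "cosh (sqrt (- K) * u) ^ k * (2 * distortion K b) ^ m"
    show "0 \<le> ?C" using klein_radius_bounds[OF K u b_def] by (simp add: distortion_def)
    note far = joint_far_le[OF ctx]
    show "B n \<in> sets M" for n unfolding B_def by (rule law(2)[OF far(1)])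
    show "emeasure M (B n) \<le> ennreal (?C * (1 / 2) ^ n)" for n
      unfolding B_def law(1)[OF far(1)] by (rule far(2))
    fix \<omega> assume "\<omega> \<in> {\<omega> \<in> space M. ?R \<omega> < \<infinity>}"
    then have \<omega>: "\<omega> \<in> space M" "E \<omega> \<inter> L \<omega> \<noteq> {}" unfolding meet by auto
    have "E \<omega> \<inter> L \<omega> \<subseteq> hyp_space K"
      using closedin_Int_flats[of "E \<omega>" K k "L \<omega>" q] measurable_space[OF E \<omega>(1)] measurable_space[OF L \<omega>(1)] by simp
    from origin_dist_dyadic[OF K this \<omega>(2)]
    show "?R \<omega> \<le> ennreal (2 * c) \<or> (\<exists>n. \<omega> \<in> B n \<and> ?R \<omega> \<le> ennreal ((real n + 3) * c))"
      unfolding c_def B_def using \<omega> by blast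
  qed
  have "(\<integral>\<^sup>+\<omega>. ennreal_powr (?R \<omega>) a \<partial>M) < \<infinity> \<longleftrightarrow> a \<in> {real \<gamma> - real q <.. 0}" for a
  proof -
    consider "a > 0" | "a = 0" | "a < 0" by linarith
    then show ?thesis
    proof cases
      case 1
      then show ?thesis using pos_inf by simp
    next
      case 2
      have "(\<integral>\<^sup>+\<omega>. ennreal_powr (?R \<omega>) 0 \<partial>M) = 1"
        using M.emeasure_space_1 by (simp add: ennreal_powr_def)
      then show ?thesis using 2 q(2) mk(2) by simp
    next
      case 3
      then show ?thesis using neg_fin[of "- a"] neg_inf[of "- a"] q(2) by (cases "- a < real m") auto
    qed
  qed
  then show ?thesis using meet_pos pos_fin by blast
qed

end
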